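(* Let $\tau\in(0,1)$, let $\lambda_1>0$ be fixed and let $\lambda_2=\lambda_{2,n}>0$ depend on $n$. Put $\lambda_n=\lambda_2-\lambda_1$ and $\gamma_n=\gamma_2-\gamma_1$. Assume that $\Delta_n\to0$ and $n\Delta_n\to\infty$ as $n\to\infty$, and that $$\lambda_n\to0,\qquad \frac{\sqrt{n\Delta_n}\,\gamma_n}{\sqrt{\log n}}\to\infty .$$ Then $$\sqrt{n\Delta_n}\begin{pmatrix}\hat\lambda_1-\lambda_1\\ \hat\lambda_2-\lambda_2\end{pmatrix}\ \stackrel{d}{\to}\ N(0,\Sigma),\qquad \Sigma=\begin{pmatrix}\tau^{-1}\lambda_1&0\\0&(1-\tau)^{-1}\lambda_2\end{pmatrix},$$ where in $\Sigma$ the symbol $\lambda_2$ stands for the limit of $\lambda_{2,n}$ as $n\to\infty$ (which equals $\lambda_1$).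
   Context: Fix $v>0$. For each $n\ge 2$ let $\Delta_n>0$, $T=n\Delta_n$, $t_i=i\Delta_n$ for $i=0,\dots,n$. The telegraph process is $X(t)=V(0)\int_0^t(-1)^{N(s)}\,ds$, $0\le t\le T$, where $N$ is an inhomogeneous Poisson process with intensity $\lambda(t)=\lambda_1\mathbf 1_{\{t\le\theta_0\}}+\lambda_2\mathbf 1_{\{t>\theta_0\}}$, and $V(0)$ is independent of $N$ and takes the values $+v,-v$ with probability $1/2$ each. The change occurs at the observation time $\theta_0=k_0\Delta_n$ with $k_0=[n\tau]$ (integer part). Only $X_i=X(t_i)$, $i=0,\dots,n$ (with $X_0=0$) are observed. Put $\eta_i=X_i-X_{i-1}$ and $Y_i=\mathbf 1_{\{|\eta_i|<v\Delta_n\}}/\Delta_n$, $i=1,\dots,n$. Let $\gamma_m=\frac{1-e^{-\lambda_m\Delta_n}}{\Delta_n}$, $m=1,2$, which is the mean of $Y_i$ for $i\le k_0$ ($m=1$) and for $i>k_0$ ($m=2$). For $1\le k\le n-1$ let $\bar Y_k=\frac1k\sum_{i=1}^kY_i$, $\bar Y_{n-k}=\frac1{n-k}\sum_{i=k+1}^nY_i$ (the mean of the last $n-k$ variables), and $$V_k=\sqrt{\frac{k(n-k)}{n^2}}\,(\bar Y_{n-k}-\bar Y_k).$$ The least squares change point estimator $\hat k_0$ is $$\hat k_0=\arg\min_{1\le k\le n-1}\Big\{\sum_{i=1}^k(Y_i-\bar Y_k)^2+\sum_{i=k+1}^n(Y_i-\bar Y_{n-k})^2\Big\}=\arg\max_{1\le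 k\le n-1}V_k^2 .$$ Set $\hat\gamma_1=\bar Y_{\hat k_0}$ (mean of $Y_1,\dots,Y_{\hat k_0}$), $\hat\gamma_2=\bar Y_{n-\hat k_0}$ (mean of $Y_{\hat k_0+1},\dots,Y_n$), and $$\hat\lambda_m=-\frac1{\Delta_n}\log(1-\hat\gamma_m\Delta_n),\qquad m=1,2,$$ defined when $\hat\gamma_m\Delta_n<1$, an event of probability tending to $1$ (arbitrary otherwise). *)

theory Defs
  imports "HOL-Probability.Probability"
begin

section \<open>Convergence in distribution and the multivariate normal law\<close>

text \<open>
  The library's \<^const>\<open>weak_conv_m\<close> covers only measures on the real line. The random elements
  may live on a different probability space for each index, as is needed for triangular arrays.
\<close>
definition converges_in_distribution ::
  "(nat \<Rightarrow> 'a measure) \<Rightarrow> (nat \<Rightarrow> 'a \<Rightarrow> 'b::topological_space) \<Rightarrow> 'b measure \<Rightarrow> bool" where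
  "converges_in_distribution M Z \<mu> \<longleftrightarrow>
     (\<forall>f :: 'b \<Rightarrow> real. continuous_on UNIV f \<and> bounded (range f) \<longrightarrow>
        (\<lambda>n. integral\<^sup>L (distr (M n) borel (Z n)) f) \<longlonglongrightarrow> integral\<^sup>L \<mu> f)"

text \<open>Meaningful for symmetric positive definite covariance matrices only.\<close>
definition multivariate_normal :: "real ^ 'n \<Rightarrow> real ^ 'n ^ 'n \<Rightarrow> (real ^ 'n) measure" where
  "multivariate_normal m S = density lborel (\<lambda>x. ennreal
     (exp (- ((x - m) \<bullet> (matrix_inv S *v (x - m))) / 2) / sqrt ((2 * pi) ^ CARD('n) * det S)))"

section \<open>The telegraph process with a change of intensity\<close>

text \<open>
  Inhomogeneous Poisson process on the time interval from \<open>0\<close> to \<open>T\<close>. Truncated subtraction of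
  increments is harmless because paths are nondecreasing. The Poisson probabilities are written
  out because \<^const>\<open>poisson_pmf\<close> is only specified for strictly positive rates, whereas
  increments over degenerate intervals have rate \<open>0\<close>.
\<close>
definition inhom_poisson_process ::
  "'a measure \<Rightarrow> real \<Rightarrow> (real \<Rightarrow> real) \<Rightarrow> (real \<Rightarrow> 'a \<Rightarrow> nat) \<Rightarrow> bool" where
  "inhom_poisson_process M T lam N \<longleftrightarrow>
     prob_space M \<and>
     (\<forall>t\<in>{0..T}. N t \<in> measurable M (count_space UNIV)) \<and>
     (\<forall>\<omega>\<in>space M. N 0 \<omega> = 0 \<and> mono_on {0..T} (\<lambda>t. N t \<omega>) \<and>
        (\<forall>t\<in>{0..<T}. ((\<lambda>s. N s \<omega>) \<longlongrightarrow> N t \<omega>) (at_right t))) \<and>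
     (\<forall>s t. 0 \<le> s \<and> s \<le> t \<and> t \<le> T \<longrightarrow>
        (\<forall>j. measure M {\<omega>\<in>space M. N t \<omega> - N s \<omega> = j} =
              integral {s..t} lam ^ j / fact j * exp (- integral {s..t} lam))) \<and>
     (\<forall>m (t :: nat \<Rightarrow> real). mono_on {..m} t \<and> t ` {..m} \<subseteq> {0..T} \<longrightarrow>
        prob_space.indep_vars M (\<lambda>_. count_space UNIV)
          (\<lambda>i \<omega>. N (t (Suc i)) \<omega> - N (t i) \<omega>) {..<m})"

definition change_intensity :: "real \<Rightarrow> real \<Rightarrow> real \<Rightarrow> real \<Rightarrow> real" where
  "change_intensity lam1 lam2 \<theta> t = (if t \<le> \<theta> then lam1 else lam2)"

text \<open>
  The independence of \<open>V0\<close> and \<open>N\<close> is that of \<open>V0\<close> and the whole path of \<open>N\<close>. It is stated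
  for the generated sigma-algebras because the library's \<^const>\<open>prob_space.indep_var\<close> requires
  both variables to have the same value type.
\<close>
definition telegraph_driver ::
  "'a measure \<Rightarrow> real \<Rightarrow> (real \<Rightarrow> real) \<Rightarrow> real \<Rightarrow> ('a \<Rightarrow> real) \<Rightarrow> (real \<Rightarrow> 'a \<Rightarrow> nat) \<Rightarrow> bool" where
  "telegraph_driver M T lam v V0 N \<longleftrightarrow>
     inhom_poisson_process M T lam N \<and>
     measure M {\<omega>\<in>space M. V0 \<omega> = v} = 1 / 2 \<and>
     measure M {\<omega>\<in>space M. V0 \<omega> = - v} = 1 / 2 \<and>
     V0 \<in> borel_measurable M \<and>
     prob_space.indep_set M
       {V0 -` A \<inter> space M |A. A \<in> sets borel}
       {(\<lambda>\<omega>. \<lambda>t\<in>{0..T}. N t \<omega>) -` B \<inter> space M |B.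
         B \<in> sets (Pi\<^sub>M {0..T} (\<lambda>_. count_space UNIV))}"

definition telegraph_process :: "('a \<Rightarrow> real) \<Rightarrow> (real \<Rightarrow> 'a \<Rightarrow> nat) \<Rightarrow> real \<Rightarrow> 'a \<Rightarrow> real" where
  "telegraph_process V0 N t \<omega> = V0 \<omega> * integral {0..t} (\<lambda>s. (- 1) ^ N s \<omega>)"

section \<open>Change point estimation from discrete observations\<close>

text \<open>The variables \<open>Y\<^sub>i\<close>, for \<open>i \<ge> 1\<close>, computed from the observations \<open>x 0, x 1, \<dots>\<close>.\<close>
definition switch_var :: "real \<Rightarrow> real \<Rightarrow> (nat \<Rightarrow> real) \<Rightarrow> nat \<Rightarrow> real" where
  "switch_var v \<Delta> x i = (if \<bar>x i - x (i - 1)\<bar> < v * \<Delta> then 1 else 0) / \<Delta>"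

text \<open>The \<open>Y\<^sub>i\<close> as random variables, the observations being made at the times \<open>i * \<Delta>\<close>.\<close>
definition telegraph_switch_var ::
  "real \<Rightarrow> real \<Rightarrow> ('a \<Rightarrow> real) \<Rightarrow> (real \<Rightarrow> 'a \<Rightarrow> nat) \<Rightarrow> 'a \<Rightarrow> nat \<Rightarrow> real" where
  "telegraph_switch_var v \<Delta> V0 N \<omega> =
     switch_var v \<Delta> (\<lambda>i. telegraph_process V0 N (real i * \<Delta>) \<omega>)"

definition change_index :: "real \<Rightarrow> nat \<Rightarrow> nat" where
  "change_index \<tau> n = nat \<lfloor>real n * \<tau>\<rfloor>"

definition switch_mean :: "real \<Rightarrow> real \<Rightarrow> real" where
  "switch_mean \<Delta> lam = (1 - exp (- lam * \<Delta>)) / \<Delta>"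

definition mean_first :: "(nat \<Rightarrow> real) \<Rightarrow> nat \<Rightarrow> real" where
  "mean_first y k = (\<Sum>i=1..k. y i) / real k"

definition mean_last :: "nat \<Rightarrow> (nat \<Rightarrow> real) \<Rightarrow> nat \<Rightarrow> real" where
  "mean_last n y k = (\<Sum>i=k+1..n. y i) / real (n - k)"

definition least_squares :: "nat \<Rightarrow> (nat \<Rightarrow> real) \<Rightarrow> nat \<Rightarrow> real" where
  "least_squares n y k =
     (\<Sum>i=1..k. (y i - mean_first y k)\<^sup>2) + (\<Sum>i=k+1..n. (y i - mean_last n y k)\<^sup>2)"

text \<open>A relation rather than a function, since the minimizer need not be unique.\<close>
definition is_change_point_estimate :: "nat \<Rightarrow> (nat \<Rightarrow> real) \<Rightarrow> nat \<Rightarrow> bool" where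
  "is_change_point_estimate n y k \<longleftrightarrow> is_arg_min (least_squares n y) (\<lambda>k. k \<in> {1..n - 1}) k"

text \<open>
  The value \<open>l\<close> is an admissible estimate of the intensity given the estimate \<open>g\<close> of the mean of
  the \<open>Y\<^sub>i\<close>; it is arbitrary when the logarithm is undefined.
\<close>
definition is_intensity_estimate :: "real \<Rightarrow> real \<Rightarrow> real \<Rightarrow> bool" where
  "is_intensity_estimate \<Delta> g l \<longleftrightarrow> (g * \<Delta> < 1 \<longrightarrow> l = - (1 / \<Delta>) * ln (1 - g * \<Delta>))"

end

theory Submission
  imports Defs
begin

text \<open>
  Between two observations without a switch the particle covers the maximal distance
  \<open>v * \<Delta>\<close>, and almost surely it covers less as soon as it switches. Hence, up to a null set,
  the observed variables \<open>Y\<^sub>i\<close> are independent, take the values \<open>0\<close> and \<open>1 / \<Delta>\<close>, have mean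
  \<open>\<gamma>\<^sub>1\<close> up to the change index \<open>k\<^sub>0\<close> and \<open>\<gamma>\<^sub>2\<close> after it, and have variance of order \<open>1 / \<Delta>\<close>
  (\<open>AE_telegraph_switch_var\<close>, \<open>switch_indicator_moments\<close>). Everything else is about the least
  squares split of such a sample.

  If \<open>k\<^sub>0\<close> were known, the two means would be taken over fixed disjoint segments. With the norming
  \<open>q = sqrt (n * \<Delta>)\<close> each is asymptotically normal by a central limit theorem for bounded
  triangular arrays (\<open>central_limit_bounded_array\<close>), and independence makes the convergence joint
  (\<open>weak_conv_indep_pair\<close>). The means, multiplied by \<open>\<Delta>\<close>, tend to \<open>0\<close>, where
  \<open>g \<mapsto> - ln (1 - g * \<Delta>) / \<Delta>\<close> has slope close to \<open>1\<close>; so the estimates of the intensities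
  inherit the limit (\<open>log_transform_negligible\<close>).

  The core is that estimating \<open>k\<^sub>0\<close> costs nothing at the scale \<open>1 / q\<close>. Let \<open>g = \<bar>\<gamma>\<^sub>2 - \<gamma>\<^sub>1\<bar>\<close>
  and \<open>A = q * g\<close>, which tends to infinity. A split \<open>k > k\<^sub>0\<close> beats \<open>k\<^sub>0\<close> only if the mean over
  the segment between \<open>k\<^sub>0\<close> and \<open>k\<close> lies, in a weighted sense, nearer to the mean of the segment
  on its left than to that of the segment on its right (\<open>least_squares_later_split\<close>). The true
  distances are \<open>g\<close> and \<open>0\<close>, so one of three averages of centred variables must be of order \<open>g\<close>.
  The Hajek-Renyi inequality controls these averages for all \<open>k\<close> at once and shows that the error
  of the split exceeds \<open>r\<close> with probability of order \<open>n / (A\<^sup>2 * r) + ln n / A\<^sup>2\<close>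
  (\<open>prob_late_estimate\<close>). The logarithm is due to the segment on the right, which may be as short
  as one observation; this is where the rate assumption on \<open>\<gamma>\<^sub>2 - \<gamma>\<^sub>1\<close> is needed.

  Choose \<open>r = n * A powr (- 3 / 2)\<close>. The first term above then is of order \<open>A powr (- 1 / 2)\<close>, and so is
  the bias \<open>q * g * r / n\<close> caused by the \<open>r\<close> misattributed observations. Their noise is controlled
  by Kolmogorov's inequality, again at the order \<open>A powr (- 1 / 2)\<close> (\<open>shift_tail\<close>). The cases
  \<open>k < k\<^sub>0\<close> and the mean of the second segment follow by reading the sample backwards.
\<close>

section \<open>Weak convergence of sums, pairs and perturbed vectors\<close>

lemma real_distribution_normal:
  assumes "\<sigma> > 0"
  shows "real_distribution (density lborel (normal_density m \<sigma>))"
  using prob_space_normal_density[OF assms] by (auto simp: real_distribution_def real_distribution_axioms_def)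

lemma char_centered_normal:
  assumes "\<sigma> > 0"
  shows "char (density lborel (normal_density 0 \<sigma>)) t = complex_of_real (exp (- (t\<^sup>2 * \<sigma>\<^sup>2) / 2))"
proof -
  interpret S: real_distribution std_normal_distribution by (rule real_dist_normal_dist)
  have "distributed std_normal_distribution lborel (\<lambda>x. x) std_normal_density"
    unfolding distributed_def by (auto simp: distr_id2)
  from S.normal_density_affine[OF this, of \<sigma> 0]
  have "distr std_normal_distribution lborel (\<lambda>x. \<sigma> * x) = density lborel (normal_density 0 \<sigma>)"
    using assms by (simp add: distributed_def)
  then have "density lborel (normal_density 0 \<sigma>) = distr std_normal_distribution borel (\<lambda>x. \<sigma> * x)"
    by (simp cong: distr_cong)
  then have "char (density lborel (normal_density 0 \<sigma>)) t = char std_normal_distribution (t * \<sigma>)"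
    unfolding char_def by (simp add: integral_distr mult.assoc)
  then show ?thesis
    by (simp add: char_std_normal_distribution power_mult_distrib)
qed

lemma exp_neg_quadratic_bound:
  assumes "0 \<le> (x::real)"
  shows "\<bar>exp (- x) - (1 - x)\<bar> \<le> x\<^sup>2"
proof -
  have "1 - x \<le> exp (- x)" using exp_ge_add_one_self[of "-x"] by simp
  moreover have "exp (- x) \<le> 1 - x + x\<^sup>2"
  proof -
    have "exp (-x) * exp x = 1" by (simp add: exp_minus)
    moreover have "1 \<le> (1 - x + x\<^sup>2) * (1 + x)"
      using assms by (simp add: algebra_simps power2_eq_square)
    moreover have "(1 - x + x\<^sup>2) * (1 + x) \<le> (1 - x + x\<^sup>2) * exp x"
    proof (rule mult_left_mono[OF exp_ge_add_one_self])
      have "1 - x + x\<^sup>2 = (x - 1/2)\<^sup>2 + 3/4" by (simp add: power2_eq_square algebra_simps)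
      then show "0 \<le> 1 - x + x\<^sup>2" by simp
    qed
    ultimately have "exp (-x) * exp x \<le> (1 - x + x\<^sup>2) * exp x" by linarith
    then show ?thesis by simp
  qed
  ultimately show ?thesis by (simp add: abs_le_iff)
qed

text \<open>
  The quantitative core of the central limit theorem: each factor of the characteristic function is
  compared with the Gaussian one of the same variance through the common second order expansion
  \<open>1 - t\<^sup>2 * \<sigma>\<^sup>2 / 2\<close>. Bounding third moments by \<open>b\<close> times the variance makes the errors add up
  to a multiple of the total variance.
\<close>
lemma (in prob_space) char_sum_bounded_approx:
  fixes X :: "'i \<Rightarrow> 'a \<Rightarrow> real"
  assumes "finite I" and indep: "indep_vars (\<lambda>_. borel) X I"
    and mean: "\<And>i. i \<in> I \<Longrightarrow> expectation (X i) = 0"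
    and bound: "\<And>i \<omega>. i \<in> I \<Longrightarrow> \<omega> \<in> space M \<Longrightarrow> \<bar>X i \<omega>\<bar> \<le> b"
  defines "V \<equiv> \<Sum>i\<in>I. variance (X i)"
  shows "cmod (char (distr M borel (\<lambda>\<omega>. \<Sum>i\<in>I. X i \<omega>)) t - complex_of_real (exp (- (t\<^sup>2 * V) / 2)))
           \<le> V * (\<bar>t\<bar> ^ 3 * b / 6 + t ^ 4 * b\<^sup>2 / 4)"
proof -
  define s where "s i = variance (X i)" for i
  have rv[measurable]: "i \<in> I \<Longrightarrow> random_variable borel (X i)" for i
    using indep unfolding indep_vars_def2 by simp
  have int: "integrable M (\<lambda>\<omega>. (X i \<omega>) ^ k)" if "i \<in> I" for i k
  proof (rule integrable_const_bound[where B = "b ^ k"])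
    show "AE \<omega> in M. norm ((X i \<omega>) ^ k) \<le> b ^ k"
      using bound[OF that] by (auto simp: power_abs intro!: power_mono)
  qed (use that in measurable)
  have s_eq: "s i = expectation (\<lambda>\<omega>. (X i \<omega>)\<^sup>2)" if "i \<in> I" for i
    using mean[OF that] by (simp add: s_def)
  have s_nonneg: "0 \<le> s i" for i unfolding s_def by (rule integral_nonneg_AE) auto
  have factor: "cmod (char (distr M borel (X i)) t - complex_of_real (exp (- (t\<^sup>2 * s i) / 2)))
               \<le> s i * (\<bar>t\<bar> ^ 3 * b / 6 + t ^ 4 * b\<^sup>2 / 4)" if i: "i \<in> I" for i
  proof -
    have s_le: "s i \<le> b\<^sup>2"
    proof -
      have "s i \<le> expectation (\<lambda>\<omega>. b\<^sup>2)"
        unfolding s_eq[OF i] using bound[OF i] int[OF i]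
        by (intro integral_mono) (auto simp: abs_le_square_iff[symmetric] intro: order_trans[OF _ abs_ge_self])
      then show ?thesis by (simp add: prob_space)
    qed
    have cube: "\<bar>x\<bar> ^ 3 = \<bar>x\<bar> * x\<^sup>2" for x :: real
      by (simp add: power3_eq_cube power2_eq_square mult.assoc)
    have "cmod (char (distr M borel (X i)) t - (1 - t\<^sup>2 * s i / 2))
            \<le> (t\<^sup>2 / 6) * expectation (\<lambda>\<omega>. min (6 * (X i \<omega>)\<^sup>2) (\<bar>t\<bar> * \<bar>X i \<omega>\<bar> ^ 3))"
      using int[OF i, of 1] int[OF i, of 2] mean[OF i] i
      by (intro char_approx3') (auto simp: s_def)
    also have "\<dots> \<le> (t\<^sup>2 / 6) * expectation (\<lambda>\<omega>. \<bar>t\<bar> * b * (X i \<omega>)\<^sup>2)"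
    proof (intro mult_left_mono integral_mono)
      show "integrable M (\<lambda>\<omega>. min (6 * (X i \<omega>)\<^sup>2) (\<bar>t\<bar> * \<bar>X i \<omega>\<bar> ^ 3))"
      proof (rule Bochner_Integration.integrable_bound[where f = "\<lambda>\<omega>. 6 * (X i \<omega>)\<^sup>2"])
        have "norm (min (6 * x\<^sup>2) (\<bar>t\<bar> * \<bar>x\<bar> ^ 3)) \<le> norm (6 * x\<^sup>2)" for x :: real
          by (auto simp: min_def)
        then show "AE \<omega> in M. norm (min (6 * (X i \<omega>)\<^sup>2) (\<bar>t\<bar> * \<bar>X i \<omega>\<bar> ^ 3)) \<le> norm (6 * (X i \<omega>)\<^sup>2)"
          by (intro AE_I2)
      qed (use int[OF i, of 2] i in auto)
      fix \<omega> assume "\<omega> \<in> space M"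
      then have "\<bar>t\<bar> * \<bar>X i \<omega>\<bar> * (X i \<omega>)\<^sup>2 \<le> \<bar>t\<bar> * b * (X i \<omega>)\<^sup>2"
        using bound[OF i] by (intro mult_right_mono mult_left_mono) auto
      then show "min (6 * (X i \<omega>)\<^sup>2) (\<bar>t\<bar> * \<bar>X i \<omega>\<bar> ^ 3) \<le> \<bar>t\<bar> * b * (X i \<omega>)\<^sup>2"
        by (simp add: cube mult.assoc)
    qed (use int[OF i, of 2] in auto)
    also have "\<dots> = s i * (\<bar>t\<bar> ^ 3 * b / 6)"
      by (simp add: s_eq[OF i] cube mult_ac)
    finally have 1: "cmod (char (distr M borel (X i)) t - (1 - t\<^sup>2 * s i / 2)) \<le> s i * (\<bar>t\<bar> ^ 3 * b / 6)" .
    have "\<bar>exp (- (t\<^sup>2 * s i / 2)) - (1 - t\<^sup>2 * s i / 2)\<bar> \<le> (t\<^sup>2 * s i / 2)\<^sup>2"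
      by (rule exp_neg_quadratic_bound) (use s_nonneg in auto)
    also have "\<dots> = s i * (t ^ 4 * s i / 4)" by (simp add: power2_eq_square power4_eq_xxxx)
    also have "\<dots> \<le> s i * (t ^ 4 * b\<^sup>2 / 4)"
      using s_le s_nonneg[of i] by (intro mult_left_mono divide_right_mono) auto
    finally have "cmod (complex_of_real (exp (- (t\<^sup>2 * s i) / 2) - (1 - t\<^sup>2 * s i / 2))) \<le> s i * (t ^ 4 * b\<^sup>2 / 4)"
      unfolding norm_of_real by simp
    then have 2: "cmod ((1 - t\<^sup>2 * s i / 2) - complex_of_real (exp (- (t\<^sup>2 * s i) / 2))) \<le> s i * (t ^ 4 * b\<^sup>2 / 4)"
      by (simp add: norm_minus_commute)
    show ?thesis using norm_triangle_le[OF add_mono[OF 1 2]] by (simp add: algebra_simps)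
  qed
  have "char (distr M borel (\<lambda>\<omega>. \<Sum>i\<in>I. X i \<omega>)) t = (\<Prod>i\<in>I. char (distr M borel (X i)) t)"
    by (rule char_distr_sum[OF indep])
  moreover have "complex_of_real (exp (- (t\<^sup>2 * V) / 2)) = (\<Prod>i\<in>I. complex_of_real (exp (- (t\<^sup>2 * s i) / 2)))"
    by (simp add: V_def s_def sum_distrib_left sum_negf sum_divide_distrib assms(1)
        flip: of_real_prod exp_sum)
  moreover have "cmod ((\<Prod>i\<in>I. char (distr M borel (X i)) t) - (\<Prod>i\<in>I. complex_of_real (exp (- (t\<^sup>2 * s i) / 2))))
       \<le> (\<Sum>i\<in>I. cmod (char (distr M borel (X i)) t - complex_of_real (exp (- (t\<^sup>2 * s i) / 2))))"
    using s_nonneg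
    by (intro norm_prod_diff) (auto intro!: real_distribution.cmod_char_le_1 real_distribution_distr)
  moreover have "\<dots> \<le> (\<Sum>i\<in>I. s i * (\<bar>t\<bar> ^ 3 * b / 6 + t ^ 4 * b\<^sup>2 / 4))"
    by (intro sum_mono factor)
  ultimately show ?thesis by (simp add: V_def s_def sum_distrib_right)
qed

text \<open>
  With the row bounds tending to \<open>0\<close>, Lindeberg's condition is automatic.
\<close>
lemma central_limit_bounded_array:
  fixes X :: "nat \<Rightarrow> 'i \<Rightarrow> 'a \<Rightarrow> real" and M :: "nat \<Rightarrow> 'a measure"
  assumes prob: "\<And>n. prob_space (M n)" and fin: "\<And>n. finite (I n)"
    and indep: "\<And>n. prob_space.indep_vars (M n) (\<lambda>_. borel) (X n) (I n)"
    and mean: "\<And>n i. i \<in> I n \<Longrightarrow> integral\<^sup>L (M n) (X n i) = 0"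
    and bound: "\<And>n i \<omega>. i \<in> I n \<Longrightarrow> \<omega> \<in> space (M n) \<Longrightarrow> \<bar>X n i \<omega>\<bar> \<le> b n"
    and b: "b \<longlonglongrightarrow> 0"
    and var: "(\<lambda>n. \<Sum>i\<in>I n. prob_space.variance (M n) (X n i)) \<longlonglongrightarrow> \<sigma>\<^sup>2" and "\<sigma> > 0"
  shows "weak_conv_m (\<lambda>n. distr (M n) borel (\<lambda>\<omega>. \<Sum>i\<in>I n. X n i \<omega>))
           (density lborel (normal_density 0 \<sigma>))"
proof (rule levy_continuity)
  interpret prob_space "M n" for n by (rule prob)
  let ?V = "\<lambda>n. \<Sum>i\<in>I n. prob_space.variance (M n) (X n i)"
  have [measurable]: "i \<in> I n \<Longrightarrow> random_variable n borel (X n i)" for i n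
    using indep[of n] unfolding indep_vars_def2 by simp
  show "real_distribution (distr (M n) borel (\<lambda>\<omega>. \<Sum>i\<in>I n. X n i \<omega>))" for n
    by (rule real_distribution_distr) measurable
  show "real_distribution (density lborel (normal_density 0 \<sigma>))"
    by (rule real_distribution_normal[OF \<open>\<sigma> > 0\<close>])
  fix t
  have lim: "(\<lambda>n. complex_of_real (exp (- (t\<^sup>2 * ?V n) / 2))) \<longlonglongrightarrow> complex_of_real (exp (- (t\<^sup>2 * \<sigma>\<^sup>2) / 2))"
    by (intro tendsto_intros var) auto
  have "(\<lambda>n. char (distr (M n) borel (\<lambda>\<omega>. \<Sum>i\<in>I n. X n i \<omega>)) t - complex_of_real (exp (- (t\<^sup>2 * ?V n) / 2))) \<longlonglongrightarrow> 0"
  proof (rule Lim_null_comparison)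
    show "\<forall>\<^sub>F n in sequentially. norm (char (distr (M n) borel (\<lambda>\<omega>. \<Sum>i\<in>I n. X n i \<omega>)) t
        - complex_of_real (exp (- (t\<^sup>2 * ?V n) / 2))) \<le> ?V n * (\<bar>t\<bar> ^ 3 * b n / 6 + t ^ 4 * (b n)\<^sup>2 / 4)"
      by (intro always_eventually allI char_sum_bounded_approx fin indep mean bound) auto
    have "(\<lambda>n. ?V n * (\<bar>t\<bar> ^ 3 * b n / 6 + t ^ 4 * (b n)\<^sup>2 / 4)) \<longlonglongrightarrow> \<sigma>\<^sup>2 * (\<bar>t\<bar> ^ 3 * 0 / 6 + t ^ 4 * 0\<^sup>2 / 4)"
      by (intro tendsto_intros var b) auto
    then show "(\<lambda>n. ?V n * (\<bar>t\<bar> ^ 3 * b n / 6 + t ^ 4 * (b n)\<^sup>2 / 4)) \<longlonglongrightarrow> 0" by simp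
  qed
  from tendsto_add[OF this lim] show "(\<lambda>n. char (distr (M n) borel (\<lambda>\<omega>. \<Sum>i\<in>I n. X n i \<omega>)) t)
      \<longlonglongrightarrow> char (density lborel (normal_density 0 \<sigma>)) t"
    by (simp only: char_centered_normal[OF \<open>\<sigma> > 0\<close>] diff_add_cancel add_0)
qed

text \<open>
  Skorohod's theorem turns both marginal convergences into pointwise ones. Because the components are
  independent, the two Skorohod spaces may simply be multiplied, and dominated convergence applies.
\<close>
lemma weak_conv_indep_pair:
  fixes X Y :: "nat \<Rightarrow> 'a \<Rightarrow> real" and M :: "nat \<Rightarrow> 'a measure" and f :: "real \<times> real \<Rightarrow> real"
  assumes prob: "\<And>n. prob_space (M n)"
    and indep: "\<And>n. prob_space.indep_var (M n) borel (X n) borel (Y n)"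
    and \<mu>: "real_distribution \<mu>" and \<nu>: "real_distribution \<nu>"
    and X: "weak_conv_m (\<lambda>n. distr (M n) borel (X n)) \<mu>"
    and Y: "weak_conv_m (\<lambda>n. distr (M n) borel (Y n)) \<nu>"
    and f: "continuous_on UNIV f" "\<And>z. \<bar>f z\<bar> \<le> B"
  shows "(\<lambda>n. integral\<^sup>L (M n) (\<lambda>\<omega>. f (X n \<omega>, Y n \<omega>))) \<longlonglongrightarrow> integral\<^sup>L (\<mu> \<Otimes>\<^sub>M \<nu>) f"
proof -
  interpret prob_space "M n" for n by (rule prob)
  have f_meas[measurable]: "f \<in> borel_measurable (borel \<Otimes>\<^sub>M borel)"
    unfolding borel_prod by (rule borel_measurable_continuous_onI[OF f(1)])
  have rv[measurable]: "random_variable n borel (X n)" "random_variable n borel (Y n)" for n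
    using indep[of n] by (auto dest: indep_var_rv1 indep_var_rv2)
  have "real_distribution (distr (M n) borel (X n))" "real_distribution (distr (M n) borel (Y n))" for n
    by (auto intro: real_distribution_distr)
  note distr_XY = this
  from Skorohod[OF distr_XY(1) \<mu> X]
  obtain \<Omega>1 :: "real measure" and X' X0 where
    X': "prob_space \<Omega>1" "\<And>n. X' n \<in> borel_measurable \<Omega>1"
      "\<And>n. distr \<Omega>1 borel (X' n) = distr (M n) borel (X n)" "X0 \<in> borel_measurable \<Omega>1"
      "distr \<Omega>1 borel X0 = \<mu>" "\<And>x. x \<in> space \<Omega>1 \<Longrightarrow> (\<lambda>n. X' n x) \<longlonglongrightarrow> X0 x"
    by force
  from Skorohod[OF distr_XY(2) \<nu> Y]
  obtain \<Omega>2 :: "real measure" and Y' Y0 where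
    Y': "prob_space \<Omega>2" "\<And>n. Y' n \<in> borel_measurable \<Omega>2"
      "\<And>n. distr \<Omega>2 borel (Y' n) = distr (M n) borel (Y n)" "Y0 \<in> borel_measurable \<Omega>2"
      "distr \<Omega>2 borel Y0 = \<nu>" "\<And>x. x \<in> space \<Omega>2 \<Longrightarrow> (\<lambda>n. Y' n x) \<longlonglongrightarrow> Y0 x"
    by force
  note [measurable] = X'(2,4) Y'(2,4)
  interpret P1: prob_space \<Omega>1 by fact
  interpret P2: prob_space \<Omega>2 by fact
  interpret P: pair_prob_space \<Omega>1 \<Omega>2 ..
  have transfer: "integral\<^sup>L (distr \<Omega>1 borel U \<Otimes>\<^sub>M distr \<Omega>2 borel W) f = integral\<^sup>L (\<Omega>1 \<Otimes>\<^sub>M \<Omega>2) (\<lambda>z. f (U (fst z), W (snd z)))"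
    if [measurable]: "U \<in> borel_measurable \<Omega>1" "W \<in> borel_measurable \<Omega>2" for U W
  proof -
    have "sigma_finite_measure (distr \<Omega>2 borel W)"
      by (intro prob_space_imp_sigma_finite P2.prob_space_distr) simp
    then show ?thesis
      by (subst pair_measure_distr) (auto simp: integral_distr case_prod_beta)
  qed
  have "integral\<^sup>L (M n) (\<lambda>\<omega>. f (X n \<omega>, Y n \<omega>)) = integral\<^sup>L (\<Omega>1 \<Otimes>\<^sub>M \<Omega>2) (\<lambda>z. f (X' n (fst z), Y' n (snd z)))" for n
  proof -
    have "integral\<^sup>L (M n) (\<lambda>\<omega>. f (X n \<omega>, Y n \<omega>)) = integral\<^sup>L (distr (M n) (borel \<Otimes>\<^sub>M borel) (\<lambda>\<omega>. (X n \<omega>, Y n \<omega>))) f"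
      by (simp add: integral_distr)
    also have "distr (M n) (borel \<Otimes>\<^sub>M borel) (\<lambda>\<omega>. (X n \<omega>, Y n \<omega>)) = distr \<Omega>1 borel (X' n) \<Otimes>\<^sub>M distr \<Omega>2 borel (Y' n)"
      using indep[of n] unfolding indep_var_distribution_eq X'(3) Y'(3) by simp
    finally show ?thesis by (simp add: transfer)
  qed
  moreover have "(\<lambda>n. integral\<^sup>L (\<Omega>1 \<Otimes>\<^sub>M \<Omega>2) (\<lambda>z. f (X' n (fst z), Y' n (snd z))))
      \<longlonglongrightarrow> integral\<^sup>L (\<Omega>1 \<Otimes>\<^sub>M \<Omega>2) (\<lambda>z. f (X0 (fst z), Y0 (snd z)))"
  proof (rule integral_dominated_convergence[where w = "\<lambda>_. B"])
    show "AE z in \<Omega>1 \<Otimes>\<^sub>M \<Omega>2. (\<lambda>n. f (X' n (fst z), Y' n (snd z))) \<longlonglongrightarrow> f (X0 (fst z), Y0 (snd z))"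
    proof (rule AE_I2)
      fix z assume "z \<in> space (\<Omega>1 \<Otimes>\<^sub>M \<Omega>2)"
      then have "(\<lambda>n. (X' n (fst z), Y' n (snd z))) \<longlonglongrightarrow> (X0 (fst z), Y0 (snd z))"
        by (intro tendsto_Pair X'(6) Y'(6)) (auto simp: space_pair_measure)
      moreover have "isCont f (X0 (fst z), Y0 (snd z))" using f(1) by (simp add: continuous_on_eq_continuous_at)
      ultimately show "(\<lambda>n. f (X' n (fst z), Y' n (snd z))) \<longlonglongrightarrow> f (X0 (fst z), Y0 (snd z))"
        by (metis isCont_tendsto_compose)
    qed
  qed (use f(2) in \<open>auto intro!: P.integrable_const\<close>)
  moreover have "integral\<^sup>L (\<Omega>1 \<Otimes>\<^sub>M \<Omega>2) (\<lambda>z. f (X0 (fst z), Y0 (snd z))) = integral\<^sup>L (\<mu> \<Otimes>\<^sub>M \<nu>) f"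
    by (subst transfer[symmetric]) (auto simp: X'(5) Y'(5))
  ultimately show ?thesis by simp
qed

lemma vector_2_expand: "vector [x, y] = x *\<^sub>R axis 1 1 + y *\<^sub>R (axis 2 1 :: real ^ 2)" for x y :: real
  by (simp add: vec_eq_iff forall_2 axis_def)

lemma norm_vector_2_le: "norm (vector [x, y] :: real ^ 2) \<le> \<bar>x\<bar> + \<bar>y\<bar>" for x y :: real
  using norm_le_l1_cart[of "vector [x, y] :: real ^ 2"] by (simp add: sum_2)

lemma lborel_real2: "(lborel :: (real ^ 2) measure) = distr (lborel \<Otimes>\<^sub>M lborel) borel (\<lambda>(x, y). vector [x, y])"
  (is "_ = distr _ _ ?v")
proof (rule lborel_eqI)
  have [measurable]: "?v \<in> borel_measurable (borel \<Otimes>\<^sub>M borel)"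
    unfolding vector_2_expand by measurable
  fix l u :: "real ^ 2"
  assume le: "\<And>b. b \<in> Basis \<Longrightarrow> l \<bullet> b \<le> u \<bullet> b"
  have Basis2: "Basis = {axis 1 1, axis 2 1 :: real ^ 2}"
    by (auto simp: Basis_vec_def UNIV_2)
  have ne: "axis 1 1 \<noteq> (axis 2 1 :: real ^ 2)"
    by (simp add: axis_eq_axis)
  have le': "l $ 1 \<le> u $ 1" "l $ 2 \<le> u $ 2"
    using le[of "axis 1 1"] le[of "axis 2 1"] by (auto simp: Basis2 inner_axis)
  have "?v -` box l u \<inter> space (lborel \<Otimes>\<^sub>M lborel) = {l $ 1 <..< u $ 1} \<times> {l $ 2 <..< u $ 2}"
    by (auto simp: mem_box_cart forall_2 space_pair_measure)
  then have "emeasure (distr (lborel \<Otimes>\<^sub>M lborel) borel ?v) (box l u)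
      = emeasure (lborel \<Otimes>\<^sub>M lborel) ({l $ 1 <..< u $ 1} \<times> {l $ 2 <..< u $ 2})"
    by (subst emeasure_distr) auto
  also have "\<dots> = ennreal (u $ 1 - l $ 1) * ennreal (u $ 2 - l $ 2)"
    by (subst lborel.emeasure_pair_measure_Times) (auto simp: le')
  also have "\<dots> = ennreal (\<Prod>b\<in>Basis. (u - l) \<bullet> b)"
    using le' ne by (simp add: Basis2 inner_axis flip: ennreal_mult)
  finally show "emeasure (distr (lborel \<Otimes>\<^sub>M lborel) borel ?v) (box l u) = (\<Prod>b\<in>Basis. (u - l) \<bullet> b)" .
qed auto

lemma multivariate_normal_diag2:
  assumes "\<sigma>1 > 0" "\<sigma>2 > 0"
  shows "multivariate_normal 0 (vector [vector [\<sigma>1\<^sup>2, 0], vector [0, \<sigma>2\<^sup>2]] :: real ^ 2 ^ 2)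
     = distr (density lborel (normal_density 0 \<sigma>1) \<Otimes>\<^sub>M density lborel (normal_density 0 \<sigma>2)) borel (\<lambda>(x, y). vector [x, y])"
proof -
  let ?v = "\<lambda>(x, y). vector [x, y] :: real ^ 2"
  let ?S = "vector [vector [\<sigma>1\<^sup>2, 0], vector [0, \<sigma>2\<^sup>2]] :: real ^ 2 ^ 2"
  let ?R = "vector [vector [inverse (\<sigma>1\<^sup>2), 0], vector [0, inverse (\<sigma>2\<^sup>2)]] :: real ^ 2 ^ 2"
  have [measurable]: "?v \<in> borel_measurable (borel \<Otimes>\<^sub>M borel)"
    unfolding vector_2_expand by measurable
  have "?S ** ?R = mat 1" "?R ** ?S = mat 1"
    using assms by (auto simp: vec_eq_iff forall_2 matrix_matrix_mult_def sum_2 mat_def)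
  note SR = this
  have inv: "matrix_inv ?S = ?R"
    unfolding matrix_inv_def
  proof (rule some_equality)
    fix B assume "?S ** B = mat 1 \<and> B ** ?S = mat 1"
    then have "B = (?R ** ?S) ** B" and "?R = ?R ** (?S ** B)"
      using SR by (simp_all only: matrix_mul_lid matrix_mul_rid)
    then show "B = ?R" by (simp only: matrix_mul_assoc)
  qed (use SR in simp)
  define d where "d x = exp (- ((x - 0) \<bullet> (matrix_inv ?S *v (x - 0))) / 2) / sqrt ((2 * pi) ^ CARD(2) * det ?S)"
    for x :: "real ^ 2"
  have d_eq: "d (vector [x, y]) = normal_density 0 \<sigma>1 x * normal_density 0 \<sigma>2 y" for x y
  proof -
    have "sqrt ((2 * pi) ^ 2 * (\<sigma>1\<^sup>2 * \<sigma>2\<^sup>2)) = sqrt (2 * pi * \<sigma>1\<^sup>2) * sqrt (2 * pi * \<sigma>2\<^sup>2)"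
      by (simp add: power2_eq_square mult_ac flip: real_sqrt_mult)
    moreover have "vector [x, y] \<bullet> (?R *v vector [x, y]) = x\<^sup>2 / \<sigma>1\<^sup>2 + y\<^sup>2 / \<sigma>2\<^sup>2"
      by (simp add: inner_vec_def sum_2 matrix_vector_mult_def power2_eq_square divide_inverse)
    then have "exp (- (vector [x, y] \<bullet> (?R *v vector [x, y])) / 2) = exp (- x\<^sup>2 / (2 * \<sigma>1\<^sup>2)) * exp (- y\<^sup>2 / (2 * \<sigma>2\<^sup>2))"
      by (simp add: add_divide_distrib flip: exp_add)
    ultimately show ?thesis
      unfolding d_def inv by (simp add: det_2 normal_density_def)
  qed
  have [measurable]: "d \<in> borel_measurable borel"
    unfolding d_def inv
    by (intro borel_measurable_continuous_onI) (auto intro!: continuous_intros simp: assms det_2 less_imp_neq[symmetric])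
  have "multivariate_normal 0 ?S = density (distr (lborel \<Otimes>\<^sub>M lborel) borel ?v) (\<lambda>x. ennreal (d x))"
    unfolding multivariate_normal_def d_def lborel_real2 ..
  also have "\<dots> = distr (density (lborel \<Otimes>\<^sub>M lborel) (\<lambda>z. ennreal (d (?v z)))) borel ?v"
    by (subst density_distr) auto
  also have "density (lborel \<Otimes>\<^sub>M lborel) (\<lambda>z. ennreal (d (?v z)))
     = density (lborel \<Otimes>\<^sub>M lborel) (\<lambda>(x, y). ennreal (normal_density 0 \<sigma>1 x) * ennreal (normal_density 0 \<sigma>2 y))"
    by (intro density_cong) (auto simp: d_eq ennreal_mult)
  also have "\<dots> = density lborel (normal_density 0 \<sigma>1) \<Otimes>\<^sub>M density lborel (normal_density 0 \<sigma>2)"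
    using prob_space_normal_density[OF assms(2)]
    by (intro pair_measure_density[symmetric] lborel.sigma_finite_measure_axioms)
       (auto intro: prob_space_imp_sigma_finite)
  finally show ?thesis .
qed

lemma (in prob_space) prob_le_add:
  assumes Q: "{\<omega>\<in>space M. Q \<omega>} \<in> events" and R: "{\<omega>\<in>space M. R \<omega>} \<in> events"
    and P: "AE \<omega> in M. P \<omega> \<longrightarrow> Q \<omega> \<or> R \<omega>"
  shows "\<P>(\<omega> in M. P \<omega>) \<le> \<P>(\<omega> in M. Q \<omega>) + \<P>(\<omega> in M. R \<omega>)"
proof -
  have "\<P>(\<omega> in M. P \<omega>) \<le> prob ({\<omega>\<in>space M. Q \<omega>} \<union> {\<omega>\<in>space M. R \<omega>})"
  proof (rule finite_measure_mono_AE)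
    show "AE \<omega> in M. \<omega> \<in> {\<omega>\<in>space M. P \<omega>} \<longrightarrow> \<omega> \<in> {\<omega>\<in>space M. Q \<omega>} \<union> {\<omega>\<in>space M. R \<omega>}"
      using P by eventually_elim auto
  qed (rule sets.Un[OF Q R])
  also have "\<dots> \<le> \<P>(\<omega> in M. Q \<omega>) + \<P>(\<omega> in M. R \<omega>)" by (rule measure_Un_le[OF Q R])
  finally show ?thesis .
qed

definition vanishes_in_prob :: "(nat \<Rightarrow> 'a measure) \<Rightarrow> (nat \<Rightarrow> 'a \<Rightarrow> real) \<Rightarrow> bool" where
  "vanishes_in_prob M R \<longleftrightarrow> (\<forall>\<epsilon>>0. (\<lambda>n. \<P>(\<omega> in M n. \<epsilon> < \<bar>R n \<omega>\<bar>)) \<longlonglongrightarrow> 0)"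

lemma vanishes_in_probD:
  "vanishes_in_prob M R \<Longrightarrow> 0 < \<epsilon> \<Longrightarrow> (\<lambda>n. \<P>(\<omega> in M n. \<epsilon> < \<bar>R n \<omega>\<bar>)) \<longlonglongrightarrow> 0"
  by (simp add: vanishes_in_prob_def)

text \<open>
  Slutsky's theorem in the form needed here: on a large ball, which carries almost all of the mass
  by tightness, a continuous test function is uniformly continuous.
\<close>
lemma expectation_diff_tendsto_0:
  fixes X X' :: "nat \<Rightarrow> 'a \<Rightarrow> 'b::euclidean_space" and f :: "'b \<Rightarrow> real"
  assumes prob: "\<And>n. prob_space (M n)"
    and [measurable]: "\<And>n. X n \<in> borel_measurable (M n)" "\<And>n. X' n \<in> borel_measurable (M n)"
    and tight: "\<And>\<epsilon>. \<epsilon> > 0 \<Longrightarrow> \<exists>K. \<forall>\<^sub>F n in sequentially. \<P>(\<omega> in M n. norm (X n \<omega>) > K) \<le> \<epsilon>"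
    and close: "vanishes_in_prob M (\<lambda>n \<omega>. dist (X' n \<omega>) (X n \<omega>))"
    and cont: "continuous_on UNIV f" and B: "\<And>x. \<bar>f x\<bar> \<le> B"
  shows "(\<lambda>n. integral\<^sup>L (M n) (\<lambda>\<omega>. f (X' n \<omega>)) - integral\<^sup>L (M n) (\<lambda>\<omega>. f (X n \<omega>))) \<longlonglongrightarrow> 0"
proof (rule tendstoI)
  interpret prob_space "M n" for n by (rule prob)
  fix e :: real assume "e > 0"
  have "B \<ge> 0" using B[of 0] by linarith
  define d where "d = e / (2 * (1 + 4 * B))"
  have d: "d > 0" "d + 2 * B * (d + d) < e"
  proof -
    show "d > 0" using \<open>e > 0\<close> \<open>B \<ge> 0\<close> by (simp add: d_def)
    have "d + 2 * B * (d + d) = e / 2" unfolding d_def using \<open>B \<ge> 0\<close> by (simp add: divide_simps) (simp add: algebra_simps)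
    then show "d + 2 * B * (d + d) < e" using \<open>e > 0\<close> by simp
  qed
  have [measurable]: "f \<in> borel_measurable borel" by (rule borel_measurable_continuous_onI[OF cont])
  obtain K where K: "\<forall>\<^sub>F n in sequentially. prob n {\<omega>\<in>space (M n). norm (X n \<omega>) > K} \<le> d"
    using tight[OF \<open>d > 0\<close>] by blast
  have "uniformly_continuous_on (cball 0 (K + 1)) f"
    by (intro compact_uniformly_continuous continuous_on_subset[OF cont]) auto
  then obtain \<delta> where \<delta>: "\<delta> > 0"
    "\<And>x y. norm x \<le> K + 1 \<Longrightarrow> norm y \<le> K + 1 \<Longrightarrow> dist y x < \<delta> \<Longrightarrow> dist (f y) (f x) < d"
    unfolding uniformly_continuous_on_def using \<open>d > 0\<close> by (auto simp: dist_norm)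
  define r where "r = min (\<delta> / 2) 1"
  have r: "r > 0" "r < \<delta>" "r \<le> 1" using \<open>\<delta> > 0\<close> by (auto simp: r_def)
  have "\<forall>\<^sub>F n in sequentially. prob n {\<omega>\<in>space (M n). dist (X' n \<omega>) (X n \<omega>) > r} < d"
  proof (rule order_tendstoD(2)[OF _ \<open>d > 0\<close>])
    show "(\<lambda>n. \<P>(\<omega> in M n. dist (X' n \<omega>) (X n \<omega>) > r)) \<longlonglongrightarrow> 0"
      using vanishes_in_probD[OF close \<open>r > 0\<close>] by simp
  qed
  with K show "\<forall>\<^sub>F n in sequentially.
      dist (integral\<^sup>L (M n) (\<lambda>\<omega>. f (X' n \<omega>)) - integral\<^sup>L (M n) (\<lambda>\<omega>. f (X n \<omega>))) 0 < e"
  proof eventually_elim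
    case (elim n)
    let ?T = "{\<omega>\<in>space (M n). norm (X n \<omega>) > K}" and ?D = "{\<omega>\<in>space (M n). dist (X' n \<omega>) (X n \<omega>) > r}"
    have int: "integrable (M n) (\<lambda>\<omega>. f (X n \<omega>))" "integrable (M n) (\<lambda>\<omega>. f (X' n \<omega>))"
      by (auto intro!: integrable_const_bound[where B = B] AE_I2 simp: B)
    have TD: "?T \<in> events n" "?D \<in> events n" by measurable
    then have int_ind: "integrable (M n) (indicator ?T :: _ \<Rightarrow> real)" "integrable (M n) (indicator ?D :: _ \<Rightarrow> real)"
      by (simp_all add: emeasure_eq_measure)
    then have int_bd: "integrable (M n) (\<lambda>\<omega>. d + 2 * B * (indicator ?T \<omega> + indicator ?D \<omega>))"
      by (intro Bochner_Integration.integrable_add integrable_mult_right) auto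
    have pw: "\<bar>f (X' n \<omega>) - f (X n \<omega>)\<bar> \<le> d + 2 * B * (indicator ?T \<omega> + indicator ?D \<omega>)"
      if \<omega>: "\<omega> \<in> space (M n)" for \<omega>
    proof (cases "norm (X n \<omega>) \<le> K \<and> dist (X' n \<omega>) (X n \<omega>) \<le> r")
      case True
      then have "norm (X' n \<omega>) \<le> K + 1"
        using norm_triangle_sub[of "X' n \<omega>" "X n \<omega>"] r by (simp add: dist_norm)
      then have "dist (f (X' n \<omega>)) (f (X n \<omega>)) < d" using True r by (intro \<delta>(2)) auto
      then show ?thesis using True by (simp add: dist_real_def indicator_def)
    next
      case False
      then have "1 \<le> (indicator ?T \<omega> + indicator ?D \<omega> :: real)" using \<omega> by (auto simp: indicator_def)
      then have "2 * B * 1 \<le> 2 * B * (indicator ?T \<omega> + indicator ?D \<omega>)"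
        using \<open>B \<ge> 0\<close> by (intro mult_left_mono) auto
      then show ?thesis using B[of "X' n \<omega>"] B[of "X n \<omega>"] \<open>d > 0\<close> by linarith
    qed
    have "\<bar>integral\<^sup>L (M n) (\<lambda>\<omega>. f (X' n \<omega>)) - integral\<^sup>L (M n) (\<lambda>\<omega>. f (X n \<omega>))\<bar>
        = \<bar>integral\<^sup>L (M n) (\<lambda>\<omega>. f (X' n \<omega>) - f (X n \<omega>))\<bar>" by (simp add: int)
    also have "\<dots> \<le> integral\<^sup>L (M n) (\<lambda>\<omega>. \<bar>f (X' n \<omega>) - f (X n \<omega>)\<bar>)"
      by (rule integral_abs_bound)
    also have "\<dots> \<le> integral\<^sup>L (M n) (\<lambda>\<omega>. d + 2 * B * (indicator ?T \<omega> + indicator ?D \<omega>))"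
      using int int_bd pw by (intro integral_mono) auto
    also have "\<dots> = d + 2 * B * (prob n ?T + prob n ?D)"
      using int_ind TD by (simp add: prob_space)
    also have "\<dots> \<le> d + 2 * B * (d + d)"
      using elim \<open>B \<ge> 0\<close> by (intro add_left_mono mult_left_mono add_mono) auto
    also have "\<dots> < e" by (rule d)
    finally show ?case by simp
  qed
qed

section \<open>A maximal inequality for weighted partial sums\<close>

lemma (in prob_space) indep_vars_reindex:
  assumes indep: "indep_vars M' X (f ` I)" and inj: "inj_on f I"
  shows "indep_vars (\<lambda>i. M' (f i)) (\<lambda>i. X (f i)) I"
  unfolding indep_vars_def2
proof
  show "\<forall>i\<in>I. random_variable (M' (f i)) (X (f i))" using indep by (auto simp: indep_vars_def2)
  let ?F = "\<lambda>i. {X i -` A \<inter> space M |A. A \<in> sets (M' i)}"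
  have F: "indep_sets ?F (f ` I)" using indep by (simp add: indep_vars_def2)
  show "indep_sets (\<lambda>i. ?F (f i)) I"
    unfolding indep_sets_def
  proof (intro conjI ballI allI impI)
    show "?F (f i) \<subseteq> events" if "i \<in> I" for i using F that unfolding indep_sets_def by blast
    fix J A assume J: "J \<subseteq> I" "J \<noteq> {}" "finite J" and A: "A \<in> (\<Pi> j\<in>J. ?F (f j))"
    define g where "g = the_inv_into J f"
    have inj_J: "inj_on f J" using inj J(1) by (rule inj_on_subset)
    have g: "g (f j) = j" if "j \<in> J" for j unfolding g_def by (rule the_inv_into_f_f[OF inj_J that])
    have "prob (\<Inter>k\<in>f ` J. A (g k)) = (\<Prod>k\<in>f ` J. prob (A (g k)))"
    proof -
      have "(\<lambda>k. A (g k)) \<in> Pi (f ` J) ?F"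
      proof
        fix k assume "k \<in> f ` J"
        then obtain j where "j \<in> J" "k = f j" by blast
        then show "A (g k) \<in> ?F k" using A g by auto
      qed
      moreover have "f ` J \<subseteq> f ` I" "f ` J \<noteq> {}" "finite (f ` J)" using J by auto
      ultimately show ?thesis using F unfolding indep_sets_def by blast
    qed
    then show "prob (\<Inter>j\<in>J. A j) = (\<Prod>j\<in>J. prob (A j))"
      by (simp add: prod.reindex[OF inj_J] g cong: INF_cong_simp prod.cong)
  qed
qed

text \<open>
  Instead of decomposing by the time of first passage, one proves by induction on \<open>k\<close> the bound
  \<open>e\<^sup>2 * P(crossing by time k) + c\<^sub>k\<^sup>2 * E[S\<^sub>k\<^sup>2; no crossing by time k] \<le> (\<Sum>i\<le>k. c\<^sub>i\<^sup>2 * s\<^sub>i)\<close>.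
  In the step, \<open>X\<^sub>k\<^sub>+\<^sub>1\<close> is independent of \<open>S\<^sub>k\<close> and of the event, so that the mixed term vanishes, and
  monotonicity of the weights allows one to replace \<open>c\<^sub>k\<^sub>+\<^sub>1\<close> by \<open>c\<^sub>k\<close>.
\<close>
lemma (in prob_space) hajek_renyi_inequality:
  fixes X :: "nat \<Rightarrow> 'a \<Rightarrow> real"
  assumes indep: "indep_vars (\<lambda>_. borel) X {1..n}"
    and sq: "\<And>i. i \<in> {1..n} \<Longrightarrow> integrable M (\<lambda>\<omega>. (X i \<omega>)\<^sup>2)"
    and mean: "\<And>i. i \<in> {1..n} \<Longrightarrow> expectation (X i) = 0"
    and var: "\<And>i. i \<in> {1..n} \<Longrightarrow> expectation (\<lambda>\<omega>. (X i \<omega>)\<^sup>2) \<le> s i"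
    and c_nonneg: "\<And>i. i \<in> {1..n} \<Longrightarrow> 0 \<le> c i"
    and c_mono: "\<And>i. 1 \<le> i \<Longrightarrow> i < n \<Longrightarrow> c (Suc i) \<le> c i"
    and "e > 0"
  shows "prob {\<omega>\<in>space M. \<exists>k\<in>{1..n}. e \<le> c k * \<bar>\<Sum>i=1..k. X i \<omega>\<bar>} \<le> (\<Sum>i=1..n. (c i)\<^sup>2 * s i) / e\<^sup>2"
proof -
  define S where "S k \<omega> = (\<Sum>i=1..k. X i \<omega>)" for k \<omega>
  define A where "A k = {\<omega>\<in>space M. \<forall>j\<in>{1..k}. c j * \<bar>S j \<omega>\<bar> < e}" for k
  have rv[measurable]: "i \<in> {1..n} \<Longrightarrow> random_variable borel (X i)" for i
    using indep unfolding indep_vars_def2 by simp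
  have S_meas: "random_variable borel (S k)" if "k \<le> n" for k
    unfolding S_def[abs_def] using that by (intro borel_measurable_sum rv) auto
  have A_sets: "A k \<in> events" if "k \<le> n" for k
  proof -
    have "A k = space M \<inter> (\<Inter>j\<in>{1..k}. {\<omega>\<in>space M. c j * \<bar>S j \<omega>\<bar> < e})" by (auto simp: A_def)
    also have "\<dots> \<in> events"
    proof (cases "k = 0")
      case False
      have "{\<omega>\<in>space M. c j * \<bar>S j \<omega>\<bar> < e} \<in> events" if "j \<in> {1..k}" for j
      proof -
        have [measurable]: "random_variable borel (S j)" using that \<open>k \<le> n\<close> by (intro S_meas) auto
        show ?thesis by measurable
      qed
      then show ?thesis using False by (intro sets.Int sets.finite_INT) auto
    qed simp
    finally show ?thesis .
  qed
  have X_int: "integrable M (X i)" if "i \<in> {1..n}" for i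
    using square_integrable_imp_integrable[OF rv sq] that by blast
  have S_sq: "integrable M (\<lambda>\<omega>. (S k \<omega>)\<^sup>2)" if "k \<le> n" for k
    using that
  proof (induction k)
    case 0 then show ?case by (simp add: S_def)
  next
    case (Suc k)
    have [measurable]: "random_variable borel (S (Suc k))" using S_meas Suc.prems by simp
    have "(S (Suc k) \<omega>)\<^sup>2 \<le> 2 * (S k \<omega>)\<^sup>2 + 2 * (X (Suc k) \<omega>)\<^sup>2" for \<omega>
      using sum_squares_bound[of "S k \<omega>" "X (Suc k) \<omega>"] by (simp add: S_def power2_sum)
    then have ae: "AE \<omega> in M. norm ((S (Suc k) \<omega>)\<^sup>2) \<le> norm (2 * (S k \<omega>)\<^sup>2 + 2 * (X (Suc k) \<omega>)\<^sup>2)"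
      by (intro AE_I2) (simp add: order_trans[OF _ abs_ge_self])
    have int: "integrable M (\<lambda>\<omega>. 2 * (S k \<omega>)\<^sup>2 + 2 * (X (Suc k) \<omega>)\<^sup>2)"
      using Suc sq[of "Suc k"] by (intro Bochner_Integration.integrable_add integrable_mult_right) auto
    have "(\<lambda>\<omega>. (S (Suc k) \<omega>)\<^sup>2) \<in> borel_measurable M" by measurable
    then show ?case by (rule Bochner_Integration.integrable_bound[OF int _ ae])
  qed
  have "e\<^sup>2 * prob (space M - A k) + (c k)\<^sup>2 * expectation (\<lambda>\<omega>. (S k \<omega>)\<^sup>2 * indicator (A k) \<omega>)
          \<le> (\<Sum>i=1..k. (c i)\<^sup>2 * s i)" if "k \<le> n" for k
    using that
  proof (induction k)
    case 0 then show ?case by (simp add: S_def A_def)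
  next
    case (Suc k)
    let ?k = "Suc k"
    have k: "k \<le> n" "?k \<in> {1..n}" "?k \<le> n" using Suc.prems by auto
    note [measurable] = S_meas[OF k(1)] S_meas[OF k(3)] A_sets[OF k(1)] A_sets[OF k(3)] rv[OF k(2)]
    have AA: "A ?k \<subseteq> A k" by (auto simp: A_def)
    have S_Suc: "S ?k \<omega> = S k \<omega> + X ?k \<omega>" for \<omega> by (simp add: S_def)
    have S_int: "integrable M (S k)" using square_integrable_imp_integrable[OF _ S_sq[OF k(1)]] by simp
    have cross: "integrable M (\<lambda>\<omega>. S k \<omega> * indicator (A k) \<omega> * X ?k \<omega>)"
      "expectation (\<lambda>\<omega>. S k \<omega> * indicator (A k) \<omega> * X ?k \<omega>) = 0"
    proof -
      define g where "g x = (\<Sum>i=1..k. x i) * (if \<forall>j\<in>{1..k}. c j * \<bar>\<Sum>i=1..j. x i\<bar> < e then 1 else 0)"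
        for x :: "nat \<Rightarrow> real"
      have comp: "(\<lambda>x :: nat \<Rightarrow> real. \<Sum>i=1..j. x i) \<in> borel_measurable (PiM {1..k} (\<lambda>_. borel :: real measure))" if "j \<le> k" for j
        using that by (intro borel_measurable_sum[where f = "\<lambda>i x. x i"] measurable_component_singleton) auto
      have g_meas: "g \<in> borel_measurable (PiM {1..k} (\<lambda>_. borel :: real measure))"
      proof -
        note [measurable] = comp[OF order_refl]
        have "Measurable.pred (PiM {1..k} (\<lambda>_. borel :: real measure)) (\<lambda>x. \<forall>j\<in>{1..k}. c j * \<bar>\<Sum>i=1..j. x i\<bar> < e)"
        proof (rule pred_intros_finite)
          fix j assume "j \<in> {1..k}"
          then have [measurable]: "(\<lambda>x. \<Sum>i=1..j. x i) \<in> borel_measurable (PiM {1..k} (\<lambda>_. borel :: real measure))"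
            by (intro comp) auto
          show "Measurable.pred (PiM {1..k} (\<lambda>_. borel :: real measure)) (\<lambda>x. c j * \<bar>\<Sum>i=1..j. x i\<bar> < e)" by measurable
        qed simp
        note [measurable] = this
        show ?thesis unfolding g_def by measurable
      qed
      have "indep_var borel (g \<circ> (\<lambda>\<omega>. restrict (\<lambda>i. X i \<omega>) {1..k})) borel ((\<lambda>x. x ?k) \<circ> (\<lambda>\<omega>. restrict (\<lambda>i. X i \<omega>) {?k}))"
        using k by (intro indep_var_compose[OF indep_var_restrict[OF indep]] g_meas) auto
      then have "indep_var borel (\<lambda>\<omega>. g (restrict (\<lambda>i. X i \<omega>) {1..k})) borel (X ?k)"
        by (simp add: comp_def)
      moreover have g_eq: "g (restrict (\<lambda>i. X i \<omega>) {1..k}) = S k \<omega> * indicator (A k) \<omega>" if "\<omega> \<in> space M" for \<omega>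
      proof -
        have "(\<Sum>i=1..j. restrict (\<lambda>i. X i \<omega>) {1..k} i) = S j \<omega>" if "j \<le> k" for j
          using that by (auto simp: S_def intro!: sum.cong)
        then show ?thesis using that by (auto simp: g_def A_def indicator_def)
      qed
      moreover have int: "integrable M (\<lambda>\<omega>. S k \<omega> * indicator (A k) \<omega>)"
        using S_int integrable_real_mult_indicator[OF A_sets[OF k(1)]] by (simp add: mult.commute)
      ultimately have ind: "indep_var borel (\<lambda>\<omega>. g (restrict (\<lambda>i. X i \<omega>) {1..k})) borel (X ?k)"
        and "integrable M (\<lambda>\<omega>. g (restrict (\<lambda>i. X i \<omega>) {1..k}))"
        by (simp_all cong: Bochner_Integration.integrable_cong)
      from indep_var_integrable[OF this X_int[OF k(2)]] indep_var_lebesgue_integral[OF this X_int[OF k(2)]]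
      show "integrable M (\<lambda>\<omega>. S k \<omega> * indicator (A k) \<omega> * X ?k \<omega>)"
        "expectation (\<lambda>\<omega>. S k \<omega> * indicator (A k) \<omega> * X ?k \<omega>) = 0"
        using mean[OF k(2)]
        by (simp_all add: g_eq[unfolded One_nat_def] cong: Bochner_Integration.integrable_cong Bochner_Integration.integral_cong)
    qed
    have int1: "integrable M (\<lambda>\<omega>. (S k \<omega>)\<^sup>2 * indicator (A k) \<omega>)"
      and int2: "integrable M (\<lambda>\<omega>. (X ?k \<omega>)\<^sup>2 * indicator (A k) \<omega>)"
      and int3: "integrable M (\<lambda>\<omega>. (S ?k \<omega>)\<^sup>2 * indicator (A k) \<omega>)"
      and int4: "integrable M (\<lambda>\<omega>. (S ?k \<omega>)\<^sup>2 * indicator (A ?k) \<omega>)"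
      using S_sq[OF k(1)] S_sq[OF k(3)] sq[OF k(2)] A_sets[OF k(1)] A_sets[OF k(3)]
      by (simp_all add: integrable_real_mult_indicator)
    have D: "A k - A ?k \<in> events" by measurable
    then have int5: "integrable M (\<lambda>\<omega>. e\<^sup>2 * indicator (A k - A ?k) \<omega>)" by (simp add: emeasure_eq_measure)
    have int6: "integrable M (\<lambda>\<omega>. (c ?k)\<^sup>2 * ((S ?k \<omega>)\<^sup>2 * indicator (A ?k) \<omega>))"
      using int4 by (rule integrable_mult_right)
    have "e\<^sup>2 * prob (A k - A ?k) + (c ?k)\<^sup>2 * expectation (\<lambda>\<omega>. (S ?k \<omega>)\<^sup>2 * indicator (A ?k) \<omega>)
        = expectation (\<lambda>\<omega>. e\<^sup>2 * indicator (A k - A ?k) \<omega> + (c ?k)\<^sup>2 * ((S ?k \<omega>)\<^sup>2 * indicator (A ?k) \<omega>))"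
    proof -
      have "expectation (\<lambda>\<omega>. e\<^sup>2 * indicator (A k - A ?k) \<omega> + (c ?k)\<^sup>2 * ((S ?k \<omega>)\<^sup>2 * indicator (A ?k) \<omega>))
         = expectation (\<lambda>\<omega>. e\<^sup>2 * indicator (A k - A ?k) \<omega>)
           + expectation (\<lambda>\<omega>. (c ?k)\<^sup>2 * ((S ?k \<omega>)\<^sup>2 * indicator (A ?k) \<omega>))"
        by (rule Bochner_Integration.integral_add[OF int5 int6])
      then show ?thesis using D by simp
    qed
    also have "\<dots> \<le> expectation (\<lambda>\<omega>. (c ?k)\<^sup>2 * ((S ?k \<omega>)\<^sup>2 * indicator (A k) \<omega>))"
    proof (rule integral_mono)
      fix \<omega> assume \<omega>: "\<omega> \<in> space M"
      show "e\<^sup>2 * indicator (A k - A ?k) \<omega> + (c ?k)\<^sup>2 * ((S ?k \<omega>)\<^sup>2 * indicator (A ?k) \<omega>)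
          \<le> (c ?k)\<^sup>2 * ((S ?k \<omega>)\<^sup>2 * indicator (A k) \<omega>)"
      proof (cases "\<omega> \<in> A k - A ?k")
        case True
        then have "e \<le> c ?k * \<bar>S ?k \<omega>\<bar>"
          using \<omega> by (auto simp: A_def atLeastAtMostSuc_conv not_less)
        then have "e\<^sup>2 \<le> (c ?k * \<bar>S ?k \<omega>\<bar>)\<^sup>2" using \<open>e > 0\<close> by (intro power_mono) auto
        then show ?thesis using True by (simp add: power_mult_distrib)
      qed (use AA in \<open>auto simp: indicator_def\<close>)
    next
      show "integrable M (\<lambda>\<omega>. e\<^sup>2 * indicator (A k - A ?k) \<omega> + (c ?k)\<^sup>2 * ((S ?k \<omega>)\<^sup>2 * indicator (A ?k) \<omega>))"
        by (rule Bochner_Integration.integrable_add[OF int5 int6])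
      show "integrable M (\<lambda>\<omega>. (c ?k)\<^sup>2 * ((S ?k \<omega>)\<^sup>2 * indicator (A k) \<omega>))"
        using int3 by (rule integrable_mult_right)
    qed
    also have "\<dots> = (c ?k)\<^sup>2 * expectation (\<lambda>\<omega>. (S k \<omega>)\<^sup>2 * indicator (A k) \<omega>
        + (2 * (S k \<omega> * indicator (A k) \<omega> * X ?k \<omega>) + (X ?k \<omega>)\<^sup>2 * indicator (A k) \<omega>))"
    proof -
      have "(S ?k \<omega>)\<^sup>2 * indicator (A k) \<omega> = (S k \<omega>)\<^sup>2 * indicator (A k) \<omega>
        + (2 * (S k \<omega> * indicator (A k) \<omega> * X ?k \<omega>) + (X ?k \<omega>)\<^sup>2 * indicator (A k) \<omega>)" for \<omega>
        by (simp add: S_Suc power2_sum algebra_simps)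
      then show ?thesis by simp
    qed
    also have "\<dots> = (c ?k)\<^sup>2 * expectation (\<lambda>\<omega>. (S k \<omega>)\<^sup>2 * indicator (A k) \<omega>)
        + (c ?k)\<^sup>2 * expectation (\<lambda>\<omega>. (X ?k \<omega>)\<^sup>2 * indicator (A k) \<omega>)"
      using int1 int2 cross by (simp add: distrib_left)
    also have "\<dots> \<le> (c k)\<^sup>2 * expectation (\<lambda>\<omega>. (S k \<omega>)\<^sup>2 * indicator (A k) \<omega>) + (c ?k)\<^sup>2 * s ?k"
    proof (intro add_mono mult_left_mono)
      show "(c ?k)\<^sup>2 * expectation (\<lambda>\<omega>. (S k \<omega>)\<^sup>2 * indicator (A k) \<omega>)
          \<le> (c k)\<^sup>2 * expectation (\<lambda>\<omega>. (S k \<omega>)\<^sup>2 * indicator (A k) \<omega>)"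
      proof (cases "k = 0")
        case False
        then have "(c ?k)\<^sup>2 \<le> (c k)\<^sup>2" using k c_mono[of k] c_nonneg[of ?k] by (intro power_mono) auto
        then show ?thesis by (intro mult_right_mono) auto
      qed (simp add: S_def)
      have "expectation (\<lambda>\<omega>. (X ?k \<omega>)\<^sup>2 * indicator (A k) \<omega>) \<le> expectation (\<lambda>\<omega>. (X ?k \<omega>)\<^sup>2)"
        using int2 sq[OF k(2)] by (intro integral_mono) (auto simp: indicator_def)
      then show "expectation (\<lambda>\<omega>. (X ?k \<omega>)\<^sup>2 * indicator (A k) \<omega>) \<le> s ?k" using var[OF k(2)] by linarith
    qed auto
    finally have step: "e\<^sup>2 * prob (A k - A ?k) + (c ?k)\<^sup>2 * expectation (\<lambda>\<omega>. (S ?k \<omega>)\<^sup>2 * indicator (A ?k) \<omega>)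
      \<le> (c k)\<^sup>2 * expectation (\<lambda>\<omega>. (S k \<omega>)\<^sup>2 * indicator (A k) \<omega>) + (c ?k)\<^sup>2 * s ?k" .
    have "space M - A ?k = (space M - A k) \<union> (A k - A ?k)" using AA by (auto simp: A_def)
    then have "prob (space M - A ?k) = prob (space M - A k) + prob (A k - A ?k)"
      by (simp add: finite_measure_Union Int_Diff Diff_Int_distrib2 disjoint_iff)
    then show ?case using step Suc.IH k by (simp add: algebra_simps)
  qed
  from this[OF order_refl]
  have "e\<^sup>2 * prob (space M - A n) \<le> (\<Sum>i=1..n. (c i)\<^sup>2 * s i)"
  proof (rule order_trans[rotated])
    have "0 \<le> expectation (\<lambda>\<omega>. (S n \<omega>)\<^sup>2 * indicator (A n) \<omega>)" by (rule integral_nonneg_AE) auto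
    then show "e\<^sup>2 * prob (space M - A n) \<le> e\<^sup>2 * prob (space M - A n)
       + (c n)\<^sup>2 * expectation (\<lambda>\<omega>. (S n \<omega>)\<^sup>2 * indicator (A n) \<omega>)" by simp
  qed
  moreover have "{\<omega>\<in>space M. \<exists>k\<in>{1..n}. e \<le> c k * \<bar>\<Sum>i=1..k. X i \<omega>\<bar>} = space M - A n"
    by (auto simp: A_def S_def not_less)
  ultimately show ?thesis using \<open>e > 0\<close> by (simp add: field_simps)
qed

text \<open>
  The weights \<open>1 / max r i\<close> are constant up to \<open>r\<close> and equal to \<open>1 / i\<close> from there on. In
  the Hajek-Renyi inequality they control all averages over at least \<open>r\<close> terms.
\<close>
lemma sum_weights_le:
  assumes "1 \<le> r"
  shows "(\<Sum>i=1..m. (1 / real (max r i))\<^sup>2) \<le> 2 / real r"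
proof -
  have "(\<Sum>i=1..m. (1 / real (max r i))\<^sup>2) \<le> (if m \<le> r then real m / (real r)\<^sup>2 else 2 / r - 1 / m)"
  proof (induction m)
    case (Suc m)
    have rr: "real r > 0" using assms by simp
    show ?case
    proof (cases "Suc m \<le> r")
      case True
      then show ?thesis using Suc.IH by (simp add: max_absorb1 power_divide add_divide_distrib)
    next
      case False
      then have m: "real m \<ge> real r" "m \<ge> 1" using assms by auto
      have IH: "(\<Sum>i=1..m. (1 / real (max r i))\<^sup>2) \<le> 2 / r - 1 / m"
      proof (cases "m \<le> r")
        case True
        then have "m = r" using False by simp
        then show ?thesis using Suc.IH rr by (simp add: power2_eq_square)
      qed (use Suc.IH in simp)
      have "(1 / real (Suc m))\<^sup>2 \<le> 1 / real m - 1 / real (Suc m)"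
      proof -
        have "1 / ((real m + 1) * (real m + 1)) \<le> 1 / (real m * (real m + 1))"
          using m(2) by (intro frac_le mult_right_mono mult_pos_pos) auto
        also have "\<dots> = 1 / real m - 1 / (real m + 1)" using m(2) by (simp add: field_simps)
        finally show ?thesis by (simp add: power2_eq_square add.commute)
      qed
      then show ?thesis using IH False by (simp add: max_absorb2)
    qed
  qed simp
  also have "\<dots> \<le> 2 / r"
  proof (cases "m \<le> r")
    case True
    then have "real m / (real r)\<^sup>2 \<le> real r / (real r)\<^sup>2" by (intro divide_right_mono) auto
    also have "\<dots> \<le> 2 / r" using assms by (simp add: power2_eq_square field_simps)
    finally show ?thesis using True by simp
  qed simp
  finally show ?thesis .
qed

lemma sum_inverse_le_ln:
  assumes "1 \<le> m"
  shows "(\<Sum>i=1..m. 1 / real i) \<le> 1 + ln (real m)"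
  using assms
proof (induction m rule: dec_induct)
  case (step m)
  have "ln (real m / real (Suc m)) \<le> real m / real (Suc m) - 1"
    using step by (intro ln_le_minus_one) auto
  then have "1 / real (Suc m) \<le> ln (real (Suc m)) - ln (real m)"
    using step by (simp add: ln_div field_simps)
  then show ?case using step by simp
qed simp

section \<open>Least squares splitting of a finite sequence\<close>

lemma least_squares_cong:
  assumes "\<And>i. i \<in> {1..n} \<Longrightarrow> y i = z i" "k \<le> n"
  shows "least_squares n y k = least_squares n z k"
proof -
  have "mean_first y k = mean_first z k" "mean_last n y k = mean_last n z k"
    using assms by (auto simp: mean_first_def mean_last_def intro!: sum.cong arg_cong2[where f = "(/)"])
  then show ?thesis using assms by (auto simp: least_squares_def intro!: arg_cong2[where f = "(+)"] sum.cong)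
qed

lemma sum_reverse:
  fixes f :: "nat \<Rightarrow> real"
  assumes "b \<le> n"
  shows "(\<Sum>i=a..b. f (Suc n - i)) = (\<Sum>i=Suc n - b..Suc n - a. f i)"
  by (rule sum.reindex_bij_witness[where i = "\<lambda>i. Suc n - i" and j = "\<lambda>i. Suc n - i"]) (use assms in auto)

lemma mean_first_reverse:
  assumes "k \<le> n"
  shows "mean_first (\<lambda>i. y (Suc n - i)) (n - k) = mean_last n y k"
  using assms sum_reverse[of "n - k" n y 1] by (simp add: mean_first_def mean_last_def Suc_diff_le)

lemma mean_last_reverse:
  assumes "k \<le> n"
  shows "mean_last n (\<lambda>i. y (Suc n - i)) (n - k) = mean_first y k"
proof -
  have "{Suc n - n..Suc n - (n - k + 1)} = {1..k}" using assms by auto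
  then show ?thesis using assms sum_reverse[of n n y "n - k + 1"] by (simp add: mean_first_def mean_last_def)
qed

text \<open>
  Reading the sequence backwards exchanges the roles of the two segments. This symmetry reduces
  every statement about early splits, and about the second mean, to one about late splits, and about
  the first mean.
\<close>
lemma least_squares_reverse:
  assumes "k \<le> n"
  shows "least_squares n (\<lambda>i. y (Suc n - i)) (n - k) = least_squares n y k"
proof -
  have "{Suc n - (n - k)..Suc n - 1} = {k+1..n}" "{Suc n - n..Suc n - (n - k + 1)} = {1..k}"
    using assms by auto
  then show ?thesis
    unfolding least_squares_def mean_first_reverse[OF assms] mean_last_reverse[OF assms]
    using assms sum_reverse[of "n - k" n "\<lambda>i. (y i - mean_last n y k)\<^sup>2" 1]
      sum_reverse[of n n "\<lambda>i. (y i - mean_first y k)\<^sup>2" "n - k + 1"]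
    by simp
qed

lemma change_point_estimate_reverse:
  assumes "is_change_point_estimate n y k"
  shows "is_change_point_estimate n (\<lambda>i. y (Suc n - i)) (n - k)"
  unfolding is_change_point_estimate_def is_arg_min_def
proof safe
  have k: "k \<in> {1..n-1}" and min: "\<And>j. j \<in> {1..n-1} \<Longrightarrow> \<not> least_squares n y j < least_squares n y k"
    using assms by (auto simp: is_change_point_estimate_def is_arg_min_def)
  show "n - k \<in> {1..n - 1}" using k by auto
  fix j assume j: "j \<in> {1..n-1}" and less: "least_squares n (\<lambda>i. y (Suc n - i)) j < least_squares n (\<lambda>i. y (Suc n - i)) (n - k)"
  have "least_squares n (\<lambda>i. y (Suc n - i)) (n - (n - j)) = least_squares n y (n - j)"
    using j by (intro least_squares_reverse) auto
  with less have "least_squares n y (n - j) < least_squares n y k"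
    using j k least_squares_reverse[of k n y] by auto
  moreover have "n - j \<in> {1..n-1}" using j by auto
  ultimately show False using min by blast
qed

lemma sum_squared_deviations:
  fixes y :: "'i \<Rightarrow> real"
  assumes "finite A" "A \<noteq> {}"
  shows "(\<Sum>i\<in>A. (y i - sum y A / card A)\<^sup>2) = (\<Sum>i\<in>A. (y i)\<^sup>2) - (sum y A)\<^sup>2 / card A"
proof -
  let ?c = "real (card A)" and ?S = "sum y A"
  have c: "?c > 0" using assms by (simp add: card_gt_0_iff)
  have "(\<Sum>i\<in>A. (y i - ?S / ?c)\<^sup>2) = (\<Sum>i\<in>A. (y i)\<^sup>2 - 2 * (?S / ?c) * y i + (?S / ?c)\<^sup>2)"
    by (intro sum.cong) (auto simp: power2_diff)
  also have "\<dots> = (\<Sum>i\<in>A. (y i)\<^sup>2) - 2 * (?S / ?c) * ?S + ?c * (?S / ?c)\<^sup>2"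
    by (simp only: sum.distrib sum_subtractf sum_constant flip: sum_distrib_left)
  also have "\<dots> = (\<Sum>i\<in>A. (y i)\<^sup>2) - ?S\<^sup>2 / ?c"
    using c by (simp add: power2_eq_square field_simps)
  finally show ?thesis .
qed

lemma least_squares_eq:
  assumes "1 \<le> k" "k < n"
  shows "least_squares n y k = (\<Sum>i=1..n. (y i)\<^sup>2) - (\<Sum>i=1..k. y i)\<^sup>2 / real k - (\<Sum>i=k+1..n. y i)\<^sup>2 / real (n - k)"
proof -
  have "(\<Sum>i=1..n. (y i)\<^sup>2) = (\<Sum>i=1..k. (y i)\<^sup>2) + (\<Sum>i=k+1..n. (y i)\<^sup>2)"
    using assms sum.ub_add_nat[of 1 k "\<lambda>i. (y i)\<^sup>2" "n - k"] by simp
  then show ?thesis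
    using sum_squared_deviations[of "{1..k}" y] sum_squared_deviations[of "{k+1..n}" y] assms
    by (simp add: least_squares_def mean_first_def mean_last_def)
qed

text \<open>
  Joining two segments of lengths \<open>a\<close> and \<open>b\<close> increases the residual sum of squares by
  \<open>a * b / (a + b)\<close> times the squared difference of their means. The left-hand side is the
  difference of the gains when the middle segment is joined to the right and to the left one.
\<close>
lemma three_segment_identity:
  fixes p m q A J K :: real
  assumes "p > 0" "m > 0" "q > 0"
  shows "(A\<^sup>2 / p + (J + K)\<^sup>2 / (m + q)) - ((A + J)\<^sup>2 / (p + m) + K\<^sup>2 / q)
    = m * (p / (p + m) * (A / p - J / m)\<^sup>2 - q / (m + q) * (J / m - K / q)\<^sup>2)"
proof -
  have merge: "x\<^sup>2 / a + y\<^sup>2 / b - (x + y)\<^sup>2 / (a + b) = a * b / (a + b) * (x / a - y / b)\<^sup>2"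
    if "a > 0" "b > 0" for x y a b :: real
  proof -
    have "(x / a - y / b)\<^sup>2 = (x * b - y * a)\<^sup>2 / (a\<^sup>2 * b\<^sup>2)"
      using that by (simp add: field_simps power_divide power_mult_distrib)
    then have "a * b / (a + b) * (x / a - y / b)\<^sup>2 = (x * b - y * a)\<^sup>2 / (a * b * (a + b))"
      using that by (simp add: power2_eq_square)
    also have "\<dots> = x\<^sup>2 / a + y\<^sup>2 / b - (x + y)\<^sup>2 / (a + b)"
    proof -
      have "a + b \<noteq> 0" "a \<noteq> 0" "b \<noteq> 0" using that by auto
      then show ?thesis
        by (simp add: divide_simps) (simp add: power2_eq_square algebra_simps)
    qed
    finally show ?thesis by simp
  qed
  show ?thesis
    using merge[of p m A J] merge[of m q J K] assms by (simp add: algebra_simps)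
qed

lemma least_squares_later_split:
  assumes "1 \<le> k0" "k0 < k" "k < n" "least_squares n y k \<le> least_squares n y k0"
  shows "sqrt (k0 / k) * \<bar>(\<Sum>i=1..k0. y i) / k0 - (\<Sum>i=k0+1..k. y i) / (real k - real k0)\<bar>
     \<le> sqrt ((real n - real k) / (real n - real k0)) * \<bar>(\<Sum>i=k0+1..k. y i) / (real k - real k0) - (\<Sum>i=k+1..n. y i) / (real n - real k)\<bar>"
proof -
  define A J K where "A = (\<Sum>i=1..k0. y i)" and "J = (\<Sum>i=k0+1..k. y i)" and "K = (\<Sum>i=k+1..n. y i)"
  have AJ: "(\<Sum>i=1..k. y i) = A + J"
    unfolding A_def J_def using assms sum.ub_add_nat[of 1 k0 y "k - k0"] by simp
  have JK: "(\<Sum>i=k0+1..n. y i) = J + K"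
    unfolding J_def K_def using assms sum.ub_add_nat[of "k0 + 1" k y "n - k"] by simp
  let ?p = "real k0" and ?m = "real k - real k0" and ?q = "real n - real k"
  have pos: "?p > 0" "?m > 0" "?q > 0" using assms by auto
  have "A\<^sup>2 / ?p + (J + K)\<^sup>2 / (?m + ?q) \<le> (A + J)\<^sup>2 / (?p + ?m) + K\<^sup>2 / ?q"
    using assms(4) assms(1-3) least_squares_eq[of k n y] least_squares_eq[of k0 n y]
    by (simp add: AJ[simplified] JK[simplified] A_def[symmetric, simplified] K_def[symmetric, simplified] of_nat_diff)
  then have "?m * (?p / (?p + ?m) * (A / ?p - J / ?m)\<^sup>2 - ?q / (?m + ?q) * (J / ?m - K / ?q)\<^sup>2) \<le> 0"
    by (subst three_segment_identity[OF pos, symmetric]) simp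
  then have "?p / k * (A / ?p - J / ?m)\<^sup>2 \<le> ?q / (real n - real k0) * (J / ?m - K / ?q)\<^sup>2"
    using pos by (simp add: mult_le_0_iff)
  then have "sqrt (?p / k * (A / ?p - J / ?m)\<^sup>2) \<le> sqrt (?q / (real n - real k0) * (J / ?m - K / ?q)\<^sup>2)"
    by (rule real_sqrt_le_mono)
  then show ?thesis
    unfolding real_sqrt_mult real_sqrt_abs A_def J_def K_def .
qed

text \<open>
  The mean over the middle segment differs from the mean over the first one by \<open>g\<close> up to noise, and
  from the mean over the last one by noise only. Dividing \<open>sqrt (k0 / n) * g\<close> among the noise terms,
  of which the middle one occurs twice, gives the threshold with its factor \<open>1 / 4\<close>. The noise in the
  last segment is divided by \<open>sqrt (n - k)\<close> instead of \<open>n - k\<close>, as the weight in the optimality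
  condition becomes small for short last segments.
\<close>
lemma later_split_needs_large_noise:
  fixes y z :: "nat \<Rightarrow> real"
  assumes "1 \<le> k0" "k0 < k" "k < n" "least_squares n y k \<le> least_squares n y k0"
    and first: "\<And>i. i \<in> {1..k0} \<Longrightarrow> y i = a + z i" and last: "\<And>i. i \<in> {k0+1..n} \<Longrightarrow> y i = b + z i"
    and g: "g = \<bar>b - a\<bar>" and "g > 0"
  defines "c \<equiv> sqrt (k0 / n) * g / 4"
  shows "c \<le> \<bar>\<Sum>i=1..k0. z i\<bar> / k0 \<or> c \<le> \<bar>\<Sum>i=k0+1..k. z i\<bar> / (real k - real k0)
     \<or> c \<le> \<bar>\<Sum>i=k+1..n. z i\<bar> / (sqrt (real n - real k) * sqrt (real n - real k0))"
proof -
  define I J K where "I = (\<Sum>i=1..k0. z i) / k0" and "J = (\<Sum>i=k0+1..k. z i) / (real k - real k0)" and "K = (\<Sum>i=k+1..n. z i) / (real n - real k)"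
  have "(\<Sum>i=1..k0. y i) / k0 = a + I"
  proof -
    have "(\<Sum>i=1..k0. y i) = (\<Sum>i=1..k0. a + z i)" by (intro sum.cong first) auto
    then show ?thesis using assms(1) by (simp add: I_def sum.distrib add_divide_distrib)
  qed
  moreover have "(\<Sum>i=k0+1..k. y i) / (real k - real k0) = b + J"
  proof -
    have "(\<Sum>i=k0+1..k. y i) = (\<Sum>i=k0+1..k. b + z i)" using assms(3) by (intro sum.cong last) auto
    then show ?thesis using assms(2) by (simp add: J_def sum.distrib add_divide_distrib of_nat_diff)
  qed
  moreover have "(\<Sum>i=k+1..n. y i) / (real n - real k) = b + K"
  proof -
    have "(\<Sum>i=k+1..n. y i) = (\<Sum>i=k+1..n. b + z i)" using assms(2) by (intro sum.cong last) auto
    then show ?thesis using assms(3) by (simp add: K_def sum.distrib add_divide_distrib of_nat_diff)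
  qed
  ultimately have ineq: "sqrt (k0 / k) * \<bar>a + I - (b + J)\<bar> \<le> sqrt ((real n - real k) / (real n - real k0)) * \<bar>J - K\<bar>"
    using least_squares_later_split[OF assms(1-4)] by simp
  define u where "u = sqrt (k0 / n)"
  have u: "0 \<le> u" "u \<le> 1" "u \<le> sqrt (k0 / k)"
    using assms(1-3) by (auto simp: u_def real_sqrt_le_iff intro!: frac_le)
  define w where "w = sqrt ((real n - k) / (real n - k0))"
  have w: "0 \<le> w" "w \<le> 1"
    using assms(1-3) by (auto simp: w_def)
  have wK: "w * \<bar>K\<bar> = \<bar>\<Sum>i=k+1..n. z i\<bar> / (sqrt (real n - real k) * sqrt (real n - real k0))"
  proof -
    have q: "real n - k > 0" using assms by simp
    have "w * \<bar>K\<bar> = \<bar>\<Sum>i=k+1..n. z i\<bar> * (sqrt (real n - k) / (real n - k)) / sqrt (real n - k0)"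
      using q by (simp add: w_def K_def real_sqrt_divide mult_ac)
    also have "sqrt (real n - k) / (real n - k) = 1 / sqrt (real n - k)"
      using q by (simp add: field_simps)
    finally show ?thesis by simp
  qed
  have "u * (g - \<bar>I\<bar> - \<bar>J\<bar>) \<le> u * \<bar>a + I - (b + J)\<bar>"
    using g u by (intro mult_left_mono) auto
  also have "\<dots> \<le> sqrt (k0 / k) * \<bar>a + I - (b + J)\<bar>" using u by (intro mult_right_mono) auto
  also have "\<dots> \<le> w * \<bar>J - K\<bar>" using ineq by (simp add: w_def)
  also have "\<dots> \<le> w * (\<bar>J\<bar> + \<bar>K\<bar>)" using w by (intro mult_left_mono) auto
  also have "\<dots> \<le> \<bar>J\<bar> + w * \<bar>K\<bar>" using w by (simp add: distrib_left mult_left_le_one_le)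
  finally have "u * g \<le> u * \<bar>I\<bar> + u * \<bar>J\<bar> + \<bar>J\<bar> + w * \<bar>K\<bar>" by (simp add: algebra_simps)
  also have "\<dots> \<le> \<bar>I\<bar> + \<bar>J\<bar> + \<bar>J\<bar> + w * \<bar>K\<bar>"
    using u by (intro add_mono) (auto intro: mult_left_le_one_le)
  finally have "4 * c \<le> \<bar>I\<bar> + 2 * \<bar>J\<bar> + w * \<bar>K\<bar>" by (simp add: c_def u_def)
  then have "c \<le> \<bar>I\<bar> \<or> c \<le> \<bar>J\<bar> \<or> c \<le> w * \<bar>K\<bar>" by linarith
  then show ?thesis unfolding wK using assms(1-3) by (simp add: I_def J_def)
qed

text \<open>
  At most one of the last two sums is nonempty; it collects the noise of the misattributed
  observations.
\<close>
lemma mean_first_shift_bound: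
  fixes y z :: "nat \<Rightarrow> real"
  assumes "1 \<le> k0" "k0 < n" "1 \<le> k" "k < n"
    and first: "\<And>i. i \<in> {1..k0} \<Longrightarrow> y i = a + z i" and last: "\<And>i. i \<in> {k0+1..n} \<Longrightarrow> y i = b + z i"
  shows "\<bar>mean_first y k - mean_first y k0\<bar>
     \<le> (\<bar>real k - real k0\<bar> * (\<bar>b - a\<bar> + \<bar>mean_first y k0 - a\<bar>) + \<bar>\<Sum>i=k0+1..k. z i\<bar> + \<bar>\<Sum>i=k+1..k0. z i\<bar>) / k"
proof -
  define S where "S = (\<Sum>i=1..k0. z i)"
  have m0: "mean_first y k0 = a + S / k0"
  proof -
    have "(\<Sum>i=1..k0. y i) = (\<Sum>i=1..k0. a + z i)" by (intro sum.cong first) auto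
    then show ?thesis using assms(1) by (simp add: mean_first_def S_def sum.distrib add_divide_distrib)
  qed
  have k_pos: "real k > 0" "real k0 > 0" using assms by auto
  have "\<exists>d R. k * (mean_first y k - mean_first y k0) = d + R - (real k - k0) * (S / k0)
     \<and> \<bar>d\<bar> \<le> \<bar>real k - k0\<bar> * \<bar>b - a\<bar> \<and> \<bar>R\<bar> \<le> \<bar>\<Sum>i=k0+1..k. z i\<bar> + \<bar>\<Sum>i=k+1..k0. z i\<bar>"
  proof (cases "k0 \<le> k")
    case True
    have "(\<Sum>i=1..k. y i) = (\<Sum>i=1..k0. y i) + (\<Sum>i=k0+1..k. y i)"
      using True assms sum.ub_add_nat[of 1 k0 y "k - k0"] by simp
    also have "(\<Sum>i=1..k0. y i) = (\<Sum>i=1..k0. a + z i)" by (intro sum.cong first) auto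
    also have "\<dots> = k0 * a + S" by (simp add: S_def sum.distrib)
    also have "(\<Sum>i=k0+1..k. y i) = (\<Sum>i=k0+1..k. b + z i)" using assms by (intro sum.cong last) auto
    also have "\<dots> = (real k - k0) * b + (\<Sum>i=k0+1..k. z i)" using True by (simp add: sum.distrib of_nat_diff)
    finally have "k * mean_first y k = k0 * a + S + ((real k - k0) * b + (\<Sum>i=k0+1..k. z i))"
      using k_pos by (simp add: mean_first_def)
    then have "k * (mean_first y k - mean_first y k0) = (real k - k0) * (b - a) + (\<Sum>i=k0+1..k. z i) - (real k - k0) * (S / k0)"
      using k_pos by (simp add: m0 algebra_simps)
    then show ?thesis by (intro exI[of _ "(real k - k0) * (b - a)"] exI[of _ "\<Sum>i=k0+1..k. z i"]) (auto simp: abs_mult)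
  next
    case False
    have "S = (\<Sum>i=1..k. z i) + (\<Sum>i=k+1..k0. z i)"
      unfolding S_def using False assms sum.ub_add_nat[of 1 k z "k0 - k"] by simp
    moreover have "(\<Sum>i=1..k. y i) = (\<Sum>i=1..k. a + z i)" using False by (intro sum.cong first) auto
    ultimately have "k * mean_first y k = k * a + S - (\<Sum>i=k+1..k0. z i)"
      using k_pos by (simp add: mean_first_def sum.distrib)
    then have "k * (mean_first y k - mean_first y k0) = 0 + - (\<Sum>i=k+1..k0. z i) - (real k - k0) * (S / k0)"
      using k_pos by (simp add: m0 algebra_simps)
    then show ?thesis by (intro exI[of _ 0] exI[of _ "- (\<Sum>i=k+1..k0. z i)"]) auto
  qed
  then obtain d R where dR: "k * (mean_first y k - mean_first y k0) = d + R - (real k - k0) * (S / k0)"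
     "\<bar>d\<bar> \<le> \<bar>real k - k0\<bar> * \<bar>b - a\<bar>" "\<bar>R\<bar> \<le> \<bar>\<Sum>i=k0+1..k. z i\<bar> + \<bar>\<Sum>i=k+1..k0. z i\<bar>" by blast
  have "k * \<bar>mean_first y k - mean_first y k0\<bar> = \<bar>d + R - (real k - k0) * (S / k0)\<bar>"
    using k_pos unfolding dR(1)[symmetric] by (simp add: abs_mult)
  also have "\<dots> \<le> \<bar>d\<bar> + \<bar>R\<bar> + \<bar>real k - k0\<bar> * \<bar>S / k0\<bar>"
  proof -
    have "\<bar>d + R - x\<bar> \<le> \<bar>d\<bar> + \<bar>R\<bar> + \<bar>x\<bar>" for x by linarith
    then show ?thesis unfolding abs_mult[symmetric] .
  qed
  also have "\<dots> \<le> \<bar>real k - real k0\<bar> * \<bar>b - a\<bar> + (\<bar>\<Sum>i=k0+1..k. z i\<bar> + \<bar>\<Sum>i=k+1..k0. z i\<bar>)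
      + \<bar>real k - real k0\<bar> * \<bar>mean_first y k0 - a\<bar>"
    using dR(2,3) by (simp add: m0)
  finally show ?thesis using k_pos by (simp add: pos_le_divide_eq algebra_simps)
qed

lemma change_point_estimate_cong:
  assumes "\<And>i. i \<in> {1..n} \<Longrightarrow> x i = z i" "is_change_point_estimate n x k"
  shows "is_change_point_estimate n z k"
proof -
  have "least_squares n x j = least_squares n z j" if "j \<in> {1..n-1}" for j
    using that by (intro least_squares_cong assms(1)) auto
  then show ?thesis using assms(2) by (auto simp: is_change_point_estimate_def is_arg_min_def)
qed

section \<open>The distance of the estimated from the true change point\<close>

locale change_point_sample = prob_space M for M :: "'a measure" +
  fixes n k0 :: nat and y :: "nat \<Rightarrow> 'a \<Rightarrow> real" and a b s :: real
  assumes indep: "indep_vars (\<lambda>_. borel) y {1..n}"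
    and square_integrable: "\<And>i. i \<in> {1..n} \<Longrightarrow> integrable M (\<lambda>\<omega>. (y i \<omega>)\<^sup>2)"
    and mean_before: "\<And>i. i \<in> {1..k0} \<Longrightarrow> expectation (y i) = a"
    and mean_after: "\<And>i. i \<in> {k0+1..n} \<Longrightarrow> expectation (y i) = b"
    and variance_le: "\<And>i. i \<in> {1..n} \<Longrightarrow> variance (y i) \<le> s"
    and k0: "1 \<le> k0" "k0 < n"
begin

definition noise :: "nat \<Rightarrow> 'a \<Rightarrow> real" where
  "noise i \<omega> = y i \<omega> - expectation (y i)"

lemma y_measurable: "i \<in> {1..n} \<Longrightarrow> random_variable borel (y i)"
  using indep unfolding indep_vars_def2 by simp

lemma y_integrable: "i \<in> {1..n} \<Longrightarrow> integrable M (y i)"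
  by (rule square_integrable_imp_integrable[OF y_measurable square_integrable])

lemma noise_measurable: "i \<in> {1..n} \<Longrightarrow> random_variable borel (noise i)"
  unfolding noise_def[abs_def] using y_measurable by auto

lemma noise_square_integrable: "i \<in> {1..n} \<Longrightarrow> integrable M (\<lambda>\<omega>. (noise i \<omega>)\<^sup>2)"
  unfolding noise_def power2_diff using square_integrable y_integrable by auto

lemma noise_mean: "i \<in> {1..n} \<Longrightarrow> expectation (noise i) = 0"
  unfolding noise_def[abs_def] using y_integrable by (simp add: prob_space)

lemma noise_indep: "indep_vars (\<lambda>_. borel) noise {1..n}"
  unfolding noise_def[abs_def] using indep by (rule indep_vars_compose2) auto

lemma y_before: "i \<in> {1..k0} \<Longrightarrow> y i \<omega> = a + noise i \<omega>"
  by (simp add: noise_def mean_before[simplified])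

lemma y_after: "i \<in> {k0+1..n} \<Longrightarrow> y i \<omega> = b + noise i \<omega>"
  by (simp add: noise_def mean_after[simplified])

lemma variance_bound_nonneg: "0 \<le> s"
proof -
  have "0 \<le> variance (y 1)" by (rule integral_nonneg_AE) auto
  also have "\<dots> \<le> s" using k0 by (intro variance_le) auto
  finally show ?thesis .
qed

lemma reverse: "change_point_sample M n (n - k0) (\<lambda>i. y (Suc n - i)) b a s"
proof
  have image: "(\<lambda>i. Suc n - i) ` {1..n} = {1..n}"
  proof (intro set_eqI iffI)
    fix i assume "i \<in> {1..n}"
    then have "i = Suc n - (Suc n - i)" "Suc n - i \<in> {1..n}" by auto
    then show "i \<in> (\<lambda>i. Suc n - i) ` {1..n}" by (rule image_eqI)
  qed auto
  show "indep_vars (\<lambda>_. borel) (\<lambda>i. y (Suc n - i)) {1..n}"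
  proof (rule indep_vars_reindex)
    show "indep_vars (\<lambda>_. borel) y ((\<lambda>i. Suc n - i) ` {1..n})" unfolding image by (rule indep)
  qed (auto simp: inj_on_def)
qed (use k0 in \<open>auto intro!: square_integrable mean_before mean_after variance_le simp: Suc_diff_le\<close>)

lemma hajek_renyi_noise:
  assumes f: "inj_on f {1..m}" "f ` {1..m} \<subseteq> {1..n}"
    and c_nonneg: "\<And>i. i \<in> {1..m} \<Longrightarrow> 0 \<le> c i"
    and c_mono: "\<And>i. 1 \<le> i \<Longrightarrow> i < m \<Longrightarrow> c (Suc i) \<le> c i"
    and "e > 0"
  shows "prob {\<omega>\<in>space M. \<exists>k\<in>{1..m}. e \<le> c k * \<bar>\<Sum>i=1..k. noise (f i) \<omega>\<bar>} \<le> s * (\<Sum>i=1..m. (c i)\<^sup>2) / e\<^sup>2"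
proof -
  have fi: "f i \<in> {1..n}" if "i \<in> {1..m}" for i using f(2) imageI[OF that, of f] by blast
  have "prob {\<omega>\<in>space M. \<exists>k\<in>{1..m}. e \<le> c k * \<bar>\<Sum>i=1..k. noise (f i) \<omega>\<bar>} \<le> (\<Sum>i=1..m. (c i)\<^sup>2 * s) / e\<^sup>2"
  proof (rule hajek_renyi_inequality)
    show "indep_vars (\<lambda>_. borel) (\<lambda>i. noise (f i)) {1..m}"
      using indep_vars_reindex[OF indep_vars_subset[OF noise_indep f(2)] f(1)] .
    show "expectation (\<lambda>\<omega>. (noise (f i) \<omega>)\<^sup>2) \<le> s" if "i \<in> {1..m}" for i
      using variance_le[OF fi[OF that]] by (simp add: noise_def)
  qed (use fi noise_square_integrable noise_mean c_nonneg c_mono \<open>e > 0\<close> in blast)+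
  then show ?thesis by (simp add: sum_distrib_left mult.commute)
qed

lemma crossing_event_sets:
  fixes f :: "nat \<Rightarrow> nat" and w :: "nat \<Rightarrow> real"
  assumes "f ` {1..m} \<subseteq> {1..n}"
  shows "{\<omega>\<in>space M. \<exists>k\<in>{1..m}. e \<le> w k * \<bar>\<Sum>i=1..k. noise (f i) \<omega>\<bar>} \<in> events"
proof -
  have "{\<omega>\<in>space M. e \<le> w k * \<bar>\<Sum>i=1..k. noise (f i) \<omega>\<bar>} \<in> events" if "k \<in> {1..m}" for k
  proof -
    have [measurable]: "random_variable borel (\<lambda>\<omega>. \<Sum>i=1..k. noise (f i) \<omega>)"
    proof (intro borel_measurable_sum noise_measurable)
      fix i assume "i \<in> {1..k}"
      then have "i \<in> {1..m}" using that by auto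
      then show "f i \<in> {1..n}" using assms by blast
    qed
    show ?thesis by measurable
  qed
  then have "(\<Union>k\<in>{1..m}. {\<omega>\<in>space M. e \<le> w k * \<bar>\<Sum>i=1..k. noise (f i) \<omega>\<bar>}) \<in> events"
    by (intro sets.finite_UN) auto
  also have "(\<Union>k\<in>{1..m}. {\<omega>\<in>space M. e \<le> w k * \<bar>\<Sum>i=1..k. noise (f i) \<omega>\<bar>})
    = {\<omega>\<in>space M. \<exists>k\<in>{1..m}. e \<le> w k * \<bar>\<Sum>i=1..k. noise (f i) \<omega>\<bar>}" by auto
  finally show ?thesis .
qed

text \<open>
  The three contributions come from the three averages of \<open>later_split_needs_large_noise\<close>. For a
  split at \<open>k\<close> the middle segment has length \<open>k - k0 \<ge> r\<close>, so its average is covered by the weights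
  \<open>1 / max r i\<close>. The last segment is summed backwards from \<open>n\<close> with weights proportional to
  \<open>1 / sqrt i\<close>, whose squares have a logarithmic sum.
\<close>
lemma prob_late_estimate:
  fixes \<kappa> g :: real
  assumes khat: "AE \<omega> in M. is_change_point_estimate n (\<lambda>i. y i \<omega>) (khat \<omega>)"
    and g: "g = \<bar>b - a\<bar>" "g > 0" and "1 \<le> r"
    and \<kappa>: "0 < \<kappa>" "\<kappa> * n \<le> k0" "\<kappa> * n \<le> n - k0"
  shows "\<P>(\<omega> in M. k0 + r \<le> khat \<omega>) \<le> 16 * s / (\<kappa> * g\<^sup>2) * (2 / real r + (2 + ln n) / (\<kappa> * n))"
proof -
  define c where "c = sqrt (k0 / n) * g / 4"
  have n: "real n > 0" "real k0 > 0" using k0 by auto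
  have c_pos: "c > 0" using n g by (simp add: c_def)
  have s0: "0 \<le> s" by (rule variance_bound_nonneg)
  have c_sq: "1 / c\<^sup>2 \<le> 16 / (\<kappa> * g\<^sup>2)"
  proof -
    have "\<kappa> \<le> k0 / n" using \<kappa>(2) n by (simp add: pos_le_divide_eq)
    then have "\<kappa> * g\<^sup>2 / 16 \<le> k0 / n * g\<^sup>2 / 16" by (intro divide_right_mono mult_right_mono) auto
    also have "\<dots> = c\<^sup>2" using n by (simp add: c_def power_mult_distrib power_divide)
    finally have "inverse (c\<^sup>2) \<le> inverse (\<kappa> * g\<^sup>2 / 16)" using \<kappa>(1) g(2) by (intro le_imp_inverse_le) auto
    then show ?thesis by (simp add: inverse_eq_divide)
  qed
  define m where "m = n - k0"
  have m: "1 \<le> m" "real m = real n - real k0" using k0 by (auto simp: m_def)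
  define E1 where "E1 = {\<omega>\<in>space M. \<exists>k\<in>{1..k0}. c \<le> (1 / k0) * \<bar>\<Sum>i=1..k. noise i \<omega>\<bar>}"
  define E2 where "E2 = {\<omega>\<in>space M. \<exists>k\<in>{1..m}. c \<le> (1 / real (max r k)) * \<bar>\<Sum>i=1..k. noise (k0 + i) \<omega>\<bar>}"
  define E3 where "E3 = {\<omega>\<in>space M. \<exists>k\<in>{1..m}. c \<le> (1 / (sqrt k * sqrt m)) * \<bar>\<Sum>i=1..k. noise (Suc n - i) \<omega>\<bar>}"
  have P1: "prob E1 \<le> s * (1 / k0) / c\<^sup>2"
  proof -
    have "prob E1 \<le> s * (\<Sum>i=1..k0. (1 / real k0)\<^sup>2) / c\<^sup>2"
      unfolding E1_def using hajek_renyi_noise[of "\<lambda>i. i" k0 "\<lambda>_. 1 / k0" c] c_pos k0 by simp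
    also have "(\<Sum>i=1..k0. (1 / real k0)\<^sup>2) = 1 / k0" using n by (simp add: power2_eq_square)
    finally show ?thesis .
  qed
  have P2: "prob E2 \<le> s * (2 / r) / c\<^sup>2"
  proof -
    have "prob E2 \<le> s * (\<Sum>i=1..m. (1 / real (max r i))\<^sup>2) / c\<^sup>2"
      unfolding E2_def using c_pos k0 \<open>1 \<le> r\<close>
      by (intro hajek_renyi_noise) (auto simp: inj_on_def m_def intro!: frac_le)
    also have "\<dots> \<le> s * (2 / r) / c\<^sup>2"
      using s0 sum_weights_le[OF \<open>1 \<le> r\<close>] by (intro divide_right_mono mult_left_mono) auto
    finally show ?thesis .
  qed
  have P3: "prob E3 \<le> s * ((1 + ln n) / m) / c\<^sup>2"
  proof -
    have "prob E3 \<le> s * (\<Sum>i=1..m. (1 / (sqrt i * sqrt m))\<^sup>2) / c\<^sup>2"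
      unfolding E3_def using c_pos k0 m
      by (intro hajek_renyi_noise) (auto simp: inj_on_def m_def intro!: frac_le mult_right_mono)
    also have "(\<Sum>i=1..m. (1 / (sqrt i * sqrt m))\<^sup>2) = (\<Sum>i=1..m. 1 / real i) / m"
      by (simp add: power_divide power_mult_distrib sum_divide_distrib)
    also have "s * (\<dots>) / c\<^sup>2 \<le> s * ((1 + ln m) / m) / c\<^sup>2"
      using s0 sum_inverse_le_ln[OF m(1)] by (intro divide_right_mono mult_left_mono) auto
    also have "\<dots> \<le> s * ((1 + ln n) / m) / c\<^sup>2"
      using s0 m k0 by (intro divide_right_mono mult_left_mono) (auto simp: m_def)
    finally show ?thesis .
  qed
  have E_sets: "E1 \<in> events" "E2 \<in> events" "E3 \<in> events"
  proof -
    show "E1 \<in> events" unfolding E1_def using k0 by (intro crossing_event_sets[of "\<lambda>i. i"]) auto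
    show "E2 \<in> events" unfolding E2_def using k0 by (intro crossing_event_sets) (auto simp: m_def)
    show "E3 \<in> events" unfolding E3_def using k0 by (intro crossing_event_sets) (auto simp: m_def)
  qed
  have "AE \<omega> in M. \<omega> \<in> {\<omega>\<in>space M. k0 + r \<le> khat \<omega>} \<longrightarrow> \<omega> \<in> E1 \<union> E2 \<union> E3"
    using khat AE_space
  proof eventually_elim
    case (elim \<omega>)
    show ?case
    proof
      assume "\<omega> \<in> {\<omega>\<in>space M. k0 + r \<le> khat \<omega>}"
      then have late: "k0 + r \<le> khat \<omega>" by simp
      define k where "k = khat \<omega>"
      have k: "k \<in> {1..n-1}" and min: "\<And>j. j \<in> {1..n-1} \<Longrightarrow> \<not> least_squares n (\<lambda>i. y i \<omega>) j < least_squares n (\<lambda>i. y i \<omega>) k"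
        using elim by (auto simp: is_change_point_estimate_def is_arg_min_def k_def)
      have kk: "k0 < k" "k < n" "r \<le> k - k0" using late k \<open>1 \<le> r\<close> k0 by (auto simp: k_def)
      have "least_squares n (\<lambda>i. y i \<omega>) k \<le> least_squares n (\<lambda>i. y i \<omega>) k0"
      proof -
        have "k0 \<in> {1..n-1}" using k0 by auto
        from min[OF this] show ?thesis by simp
      qed
      from later_split_needs_large_noise[OF k0(1) kk(1,2) this y_before y_after g]
      have "c \<le> \<bar>\<Sum>i=1..k0. noise i \<omega>\<bar> / k0 \<or> c \<le> \<bar>\<Sum>i=k0+1..k. noise i \<omega>\<bar> / (real k - real k0)
         \<or> c \<le> \<bar>\<Sum>i=k+1..n. noise i \<omega>\<bar> / (sqrt (real n - real k) * sqrt (real n - real k0))"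
        unfolding c_def by simp
      moreover have "\<omega> \<in> E1" if "c \<le> \<bar>\<Sum>i=1..k0. noise i \<omega>\<bar> / k0"
        using that elim k0 by (auto simp: E1_def intro!: bexI[of _ k0])
      moreover have "\<omega> \<in> E2" if "c \<le> \<bar>\<Sum>i=k0+1..k. noise i \<omega>\<bar> / (real k - real k0)"
      proof -
        have "(\<Sum>i=1..k - k0. noise (k0 + i) \<omega>) = (\<Sum>i=k0+1..k. noise i \<omega>)"
          using kk by (intro sum.reindex_bij_witness[where i = "\<lambda>i. i - k0" and j = "\<lambda>i. k0 + i"]) auto
        moreover have "real (max r (k - k0)) = real k - real k0" using kk by (simp add: max_absorb2)
        ultimately show ?thesis
          using that elim kk \<open>1 \<le> r\<close> unfolding E2_def m_def by (auto intro!: bexI[of _ "k - k0"])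
      qed
      moreover have "\<omega> \<in> E3" if "c \<le> \<bar>\<Sum>i=k+1..n. noise i \<omega>\<bar> / (sqrt (real n - real k) * sqrt (real n - real k0))"
      proof -
        have "(\<Sum>i=1..n - k. noise (Suc n - i) \<omega>) = (\<Sum>i=k+1..n. noise i \<omega>)"
          using kk by (intro sum.reindex_bij_witness[where i = "\<lambda>i. Suc n - i" and j = "\<lambda>i. Suc n - i"]) auto
        moreover have "real (n - k) = real n - real k" using kk by simp
        ultimately show ?thesis
          using that elim kk m unfolding E3_def by (auto intro!: bexI[of _ "n - k"] simp: m_def)
      qed
      ultimately show "\<omega> \<in> E1 \<union> E2 \<union> E3" by blast
    qed
  qed
  then have "\<P>(\<omega> in M. k0 + r \<le> khat \<omega>) \<le> prob (E1 \<union> E2 \<union> E3)"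
    using E_sets by (intro finite_measure_mono_AE) auto
  also have "\<dots> \<le> prob E1 + prob E2 + prob E3"
    using E_sets measure_Un_le[of "E1 \<union> E2" M E3] measure_Un_le[of E1 M E2] by auto
  also have "\<dots> \<le> s * (1 / k0) / c\<^sup>2 + s * (2 / r) / c\<^sup>2 + s * ((1 + ln n) / m) / c\<^sup>2"
    by (intro add_mono P1 P2 P3)
  also have "\<dots> = s * (1 / k0 + 2 / r + (1 + ln n) / m) * (1 / c\<^sup>2)"
    by (simp add: algebra_simps add_divide_distrib)
  also have "\<dots> \<le> s * (2 / r + (2 + ln n) / (\<kappa> * n)) * (16 / (\<kappa> * g\<^sup>2))"
  proof (intro mult_mono c_sq mult_left_mono s0)
    have "\<kappa> * n > 0" using \<kappa>(1) n by simp
    then have "1 / k0 \<le> 1 / (\<kappa> * n)" "(1 + ln n) / m \<le> (1 + ln n) / (\<kappa> * n)"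
      using \<kappa> m n k0 by (auto intro!: divide_left_mono add_nonneg_nonneg)
    moreover have "(2 + ln n) / (\<kappa> * n) = 1 / (\<kappa> * n) + (1 + ln n) / (\<kappa> * n)" by (simp add: add_divide_distrib)
    ultimately show "1 / k0 + 2 / r + (1 + ln n) / m \<le> 2 / r + (2 + ln n) / (\<kappa> * n)" by linarith
    show "0 \<le> s * (2 / r + (2 + ln n) / (\<kappa> * n))"
      using s0 \<kappa>(1) n k0 by (intro mult_nonneg_nonneg add_nonneg_nonneg divide_nonneg_nonneg) auto
    show "0 \<le> 1 / k0 + 2 / r + (1 + ln n) / m"
      using k0 by (intro add_nonneg_nonneg divide_nonneg_nonneg) auto
  qed auto
  finally show ?thesis by (simp add: mult_ac)
qed

lemma prob_early_estimate:
  fixes \<kappa> g :: real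
  assumes khat_meas[measurable]: "khat \<in> measurable M (count_space UNIV)"
    and khat: "AE \<omega> in M. is_change_point_estimate n (\<lambda>i. y i \<omega>) (khat \<omega>)"
    and g: "g = \<bar>b - a\<bar>" "g > 0" and "1 \<le> r"
    and \<kappa>: "0 < \<kappa>" "\<kappa> * n \<le> k0" "\<kappa> * n \<le> n - k0"
  shows "\<P>(\<omega> in M. khat \<omega> + r \<le> k0) \<le> 16 * s / (\<kappa> * g\<^sup>2) * (2 / real r + (2 + ln n) / (\<kappa> * n))"
proof -
  interpret rev: change_point_sample M n "n - k0" "\<lambda>i. y (Suc n - i)" b a s by (rule reverse)
  have [measurable]: "(\<lambda>\<omega>. n - khat \<omega>) \<in> measurable M (count_space UNIV)"
    by (rule measurable_compose[OF khat_meas]) simp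
  have "\<P>(\<omega> in M. khat \<omega> + r \<le> k0) \<le> \<P>(\<omega> in M. n - k0 + r \<le> n - khat \<omega>)"
    using k0 by (intro finite_measure_mono) auto
  also have "\<dots> \<le> 16 * s / (\<kappa> * g\<^sup>2) * (2 / real r + (2 + ln n) / (\<kappa> * n))"
  proof (rule rev.prob_late_estimate)
    show "AE \<omega> in M. is_change_point_estimate n (\<lambda>i. y (Suc n - i) \<omega>) (n - khat \<omega>)"
      using khat by eventually_elim (rule change_point_estimate_reverse)
    show "g = \<bar>a - b\<bar>" using g by simp
  qed (use g \<kappa> k0 \<open>1 \<le> r\<close> in auto)
  finally show ?thesis .
qed

lemma prob_window_noise:
  fixes m :: nat and x :: real
  assumes f: "inj_on f {1..m}" "f ` {1..m} \<subseteq> {1..n}" and "x > 0"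
  shows "prob {\<omega>\<in>space M. \<exists>k\<in>{1..m}. x \<le> \<bar>\<Sum>i=1..k. noise (f i) \<omega>\<bar>} \<le> s * m / x\<^sup>2"
  using hajek_renyi_noise[OF f, of "\<lambda>_. 1" x] \<open>x > 0\<close> by simp

lemma mean_first_measurable:
  assumes "k \<le> n"
  shows "random_variable borel (\<lambda>\<omega>. mean_first (\<lambda>i. y i \<omega>) k)"
  unfolding mean_first_def using assms by (intro borel_measurable_divide borel_measurable_sum y_measurable) auto

lemma mean_first_estimate_measurable:
  assumes khat: "khat \<in> measurable M (count_space UNIV)" and le: "\<And>\<omega>. \<omega> \<in> space M \<Longrightarrow> khat \<omega> \<le> n"
  shows "random_variable borel (\<lambda>\<omega>. mean_first (\<lambda>i. y i \<omega>) (khat \<omega>))"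
proof (rule measurable_compose_countable'[where I = "{..n}" and g = khat])
  show "khat \<in> measurable M (count_space {..n})"
    using le measurable_sets[OF khat] by (subst measurable_count_space_eq2) auto
qed (auto intro: mean_first_measurable)

lemma mean_first_centered: "mean_first (\<lambda>i. y i \<omega>) k0 - a = (\<Sum>i=1..k0. noise i \<omega>) / k0"
proof -
  have "(\<Sum>i=1..k0. y i \<omega>) = (\<Sum>i=1..k0. a + noise i \<omega>)" by (intro sum.cong y_before) auto
  then show ?thesis using k0 by (simp add: mean_first_def sum.distrib add_divide_distrib)
qed

lemma chebyshev_mean_first:
  fixes x :: real
  assumes "x > 0"
  shows "\<P>(\<omega> in M. \<bar>mean_first (\<lambda>i. y i \<omega>) k0 - a\<bar> > x) \<le> s / (k0 * x\<^sup>2)"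
proof -
  have "\<P>(\<omega> in M. \<bar>mean_first (\<lambda>i. y i \<omega>) k0 - a\<bar> > x)
      \<le> prob {\<omega>\<in>space M. \<exists>k\<in>{1..k0}. x * k0 \<le> \<bar>\<Sum>i=1..k. noise i \<omega>\<bar>}"
  proof (rule finite_measure_mono)
    show "{\<omega>\<in>space M. \<bar>mean_first (\<lambda>i. y i \<omega>) k0 - a\<bar> > x} \<subseteq> {\<omega>\<in>space M. \<exists>k\<in>{1..k0}. x * k0 \<le> \<bar>\<Sum>i=1..k. noise i \<omega>\<bar>}"
      unfolding mean_first_centered using k0 by (auto simp: field_simps intro!: bexI[of _ k0])
    show "{\<omega>\<in>space M. \<exists>k\<in>{1..k0}. x * k0 \<le> \<bar>\<Sum>i=1..k. noise i \<omega>\<bar>} \<in> events"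
      using k0 crossing_event_sets[of "\<lambda>i. i" k0 "x * k0" "\<lambda>_. 1"] by simp
  qed
  also have "\<dots> \<le> s * k0 / (x * k0)\<^sup>2"
    using k0 assms prob_window_noise[of "\<lambda>i. i" k0 "x * k0"] by simp
  also have "\<dots> = s / (k0 * x\<^sup>2)" using k0 by (simp add: power2_eq_square)
  finally show ?thesis .
qed

text \<open>
  Either the estimate misses \<open>k0\<close> by more than \<open>m\<close>, or the noise in one of the two windows of
  length \<open>m\<close> next to \<open>k0\<close> exceeds \<open>x\<close>; otherwise \<open>mean_first_shift_bound\<close> applies with a segment
  of at least \<open>k0 - m\<close> observations.
\<close>
lemma prob_mean_first_shift:
  fixes \<kappa> g x :: real and m :: nat
  assumes khat_meas[measurable]: "khat \<in> measurable M (count_space UNIV)"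
    and khat: "AE \<omega> in M. is_change_point_estimate n (\<lambda>i. y i \<omega>) (khat \<omega>)"
    and g: "g = \<bar>b - a\<bar>" "g > 0" and "x > 0" and m: "m < k0"
    and \<kappa>: "0 < \<kappa>" "\<kappa> * n \<le> k0" "\<kappa> * n \<le> n - k0"
  defines "d \<equiv> (\<lambda>\<omega>. \<bar>mean_first (\<lambda>i. y i \<omega>) (khat \<omega>) - mean_first (\<lambda>i. y i \<omega>) k0\<bar>)"
  shows "\<P>(\<omega> in M. d \<omega> > (m * (g + \<bar>mean_first (\<lambda>i. y i \<omega>) k0 - a\<bar>) + x) / (real k0 - m))
     \<le> 2 * (16 * s / (\<kappa> * g\<^sup>2) * (2 / real (Suc m) + (2 + ln n) / (\<kappa> * n))) + 2 * (s * m / x\<^sup>2)" (is "prob ?B \<le> _")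
proof -
  define q where "q = min m (n - k0)"
  define E1 where "E1 = {\<omega>\<in>space M. k0 + Suc m \<le> khat \<omega>}"
  define E2 where "E2 = {\<omega>\<in>space M. khat \<omega> + Suc m \<le> k0}"
  define E3 where "E3 = {\<omega>\<in>space M. \<exists>k\<in>{1..q}. x \<le> \<bar>\<Sum>i=1..k. noise (k0 + i) \<omega>\<bar>}"
  define E4 where "E4 = {\<omega>\<in>space M. \<exists>k\<in>{1..m}. x \<le> \<bar>\<Sum>i=1..k. noise (Suc k0 - i) \<omega>\<bar>}"
  have fR: "inj_on (\<lambda>i. k0 + i) {1..q}" "(\<lambda>i. k0 + i) ` {1..q} \<subseteq> {1..n}"
    using k0 by (auto simp: q_def inj_on_def)
  have fL: "inj_on (\<lambda>i. Suc k0 - i) {1..m}" "(\<lambda>i. Suc k0 - i) ` {1..m} \<subseteq> {1..n}"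
    using k0 m by (auto simp: inj_on_def)
  have s0: "0 \<le> s" by (rule variance_bound_nonneg)
  have sets: "E1 \<in> events" "E2 \<in> events" "E3 \<in> events" "E4 \<in> events"
    using crossing_event_sets[OF fR(2), of x "\<lambda>_. 1"] crossing_event_sets[OF fL(2), of x "\<lambda>_. 1"]
    by (simp_all add: E1_def E2_def E3_def E4_def)
  have P3: "prob E3 \<le> s * m / x\<^sup>2"
  proof -
    have "prob E3 \<le> s * q / x\<^sup>2" unfolding E3_def by (rule prob_window_noise[OF fR \<open>x > 0\<close>])
    also have "\<dots> \<le> s * m / x\<^sup>2" using s0 by (intro divide_right_mono mult_left_mono) (auto simp: q_def)
    finally show ?thesis .
  qed
  have P4: "prob E4 \<le> s * m / x\<^sup>2" unfolding E4_def by (rule prob_window_noise[OF fL \<open>x > 0\<close>])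
  have P12: "prob E1 \<le> 16 * s / (\<kappa> * g\<^sup>2) * (2 / real (Suc m) + (2 + ln n) / (\<kappa> * n))"
     "prob E2 \<le> 16 * s / (\<kappa> * g\<^sup>2) * (2 / real (Suc m) + (2 + ln n) / (\<kappa> * n))"
    unfolding E1_def E2_def
    using prob_late_estimate[OF khat g _ \<kappa>, of "Suc m"] prob_early_estimate[OF khat_meas khat g _ \<kappa>, of "Suc m"] by simp_all
  have "AE \<omega> in M. \<omega> \<in> ?B \<longrightarrow> \<omega> \<in> E1 \<union> E2 \<union> (E3 \<union> E4)"
    using khat AE_space
  proof eventually_elim
    case (elim \<omega>)
    show ?case
    proof (rule impI, rule ccontr)
      assume B: "\<omega> \<in> ?B" and nE: "\<omega> \<notin> E1 \<union> E2 \<union> (E3 \<union> E4)"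
      define k where "k = khat \<omega>"
      have k: "1 \<le> k" "k < n"
        using elim(1) k0 by (auto simp: is_change_point_estimate_def is_arg_min_def k_def)
      have near: "k \<le> k0 + m" "k0 \<le> k + m" using nE elim by (auto simp: E1_def E2_def k_def)
      have "\<bar>\<Sum>i=k0+1..k. noise i \<omega>\<bar> + \<bar>\<Sum>i=k+1..k0. noise i \<omega>\<bar> \<le> x"
      proof (cases k k0 rule: linorder_cases)
        case greater
        have "(\<Sum>i=1..k - k0. noise (k0 + i) \<omega>) = (\<Sum>i=k0+1..k. noise i \<omega>)"
          using greater by (intro sum.reindex_bij_witness[where i = "\<lambda>i. i - k0" and j = "\<lambda>i. k0 + i"]) auto
        moreover have "k - k0 \<in> {1..q}" using greater near k by (auto simp: q_def)
        then have "\<not> x \<le> \<bar>\<Sum>i=1..k - k0. noise (k0 + i) \<omega>\<bar>" using nE elim by (auto simp: E3_def)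
        ultimately show ?thesis using greater by simp
      next
        case less
        have "(\<Sum>i=1..k0 - k. noise (Suc k0 - i) \<omega>) = (\<Sum>i=k+1..k0. noise i \<omega>)"
          using less by (intro sum.reindex_bij_witness[where i = "\<lambda>i. Suc k0 - i" and j = "\<lambda>i. Suc k0 - i"]) auto
        moreover have "k0 - k \<in> {1..m}" using less near k by auto
        then have "\<not> x \<le> \<bar>\<Sum>i=1..k0 - k. noise (Suc k0 - i) \<omega>\<bar>" using nE elim by (auto simp: E4_def)
        ultimately show ?thesis using less by simp
      qed (use \<open>x > 0\<close> in simp)
      moreover have "\<bar>real k - real k0\<bar> \<le> m" using near by linarith
      then have "\<bar>real k - real k0\<bar> * (g + \<bar>mean_first (\<lambda>i. y i \<omega>) k0 - a\<bar>) \<le> m * (g + \<bar>mean_first (\<lambda>i. y i \<omega>) k0 - a\<bar>)"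
        using g by (intro mult_right_mono) auto
      moreover have "d \<omega> \<le> (\<bar>real k - real k0\<bar> * (g + \<bar>mean_first (\<lambda>i. y i \<omega>) k0 - a\<bar>)
          + \<bar>\<Sum>i=k0+1..k. noise i \<omega>\<bar> + \<bar>\<Sum>i=k+1..k0. noise i \<omega>\<bar>) / k"
        unfolding d_def k_def[symmetric] g(1)
        by (rule mean_first_shift_bound[OF k0 k y_before y_after])
      ultimately have "d \<omega> \<le> (m * (g + \<bar>mean_first (\<lambda>i. y i \<omega>) k0 - a\<bar>) + x) / k"
        by (elim order_trans) (intro divide_right_mono, auto)
      also have "\<dots> \<le> (m * (g + \<bar>mean_first (\<lambda>i. y i \<omega>) k0 - a\<bar>) + x) / (real k0 - m)"
        using near m g \<open>x > 0\<close> by (intro divide_left_mono) auto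
      finally show False using B by simp
    qed
  qed
  then have "prob ?B \<le> prob (E1 \<union> E2 \<union> (E3 \<union> E4))"
    using sets by (intro finite_measure_mono_AE) auto
  also have "\<dots> \<le> (prob E1 + prob E2) + (prob E3 + prob E4)"
    using sets measure_Un_le[of "E1 \<union> E2" M "E3 \<union> E4"] measure_Un_le[of E1 M E2] measure_Un_le[of E3 M E4] by auto
  also have "\<dots> \<le> (16 * s / (\<kappa> * g\<^sup>2) * (2 / real (Suc m) + (2 + ln n) / (\<kappa> * n))
     + 16 * s / (\<kappa> * g\<^sup>2) * (2 / real (Suc m) + (2 + ln n) / (\<kappa> * n))) + (s * m / x\<^sup>2 + s * m / x\<^sup>2)"
    by (intro add_mono P12 P3 P4)
  finally show ?thesis by linarith
qed

end

section \<open>Means of estimated segments along a sequence of samples\<close>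

text \<open>
  The bound on \<open>s n * (q n)\<^sup>2\<close> says that a mean over a positive proportion of the sample, multiplied
  by \<open>q n\<close>, has bounded variance. The signal \<open>q n * \<bar>b n - a n\<bar>\<close> is the size of the change in the same
  unit.
\<close>
locale change_point_array =
  fixes M :: "nat \<Rightarrow> 'a measure" and sz k0 :: "nat \<Rightarrow> nat" and y :: "nat \<Rightarrow> nat \<Rightarrow> 'a \<Rightarrow> real"
    and a b s q :: "nat \<Rightarrow> real" and khat :: "nat \<Rightarrow> 'a \<Rightarrow> nat" and \<kappa> C :: real
  assumes sample: "\<And>n. change_point_sample (M n) (sz n) (k0 n) (y n) (a n) (b n) (s n)"
    and khat_meas: "\<And>n. khat n \<in> measurable (M n) (count_space UNIV)"
    and khat_le: "\<And>n \<omega>. \<omega> \<in> space (M n) \<Longrightarrow> khat n \<omega> \<le> sz n"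
    and khat: "\<And>n. AE \<omega> in M n. is_change_point_estimate (sz n) (\<lambda>i. y n i \<omega>) (khat n \<omega>)"
    and \<kappa>: "0 < \<kappa>" "\<And>n. \<kappa> * real (sz n) \<le> real (k0 n)" "\<And>n. \<kappa> * real (sz n) \<le> real (sz n) - real (k0 n)"
    and q: "\<And>n. 0 < q n"
    and s: "\<And>n. s n * (q n)\<^sup>2 \<le> C * sz n"
    and signal: "filterlim (\<lambda>n. q n * \<bar>b n - a n\<bar>) at_top sequentially"
    and log_signal: "(\<lambda>n. ln (real (sz n)) / (q n * \<bar>b n - a n\<bar>)\<^sup>2) \<longlonglongrightarrow> 0"
begin

sublocale samp: change_point_sample "M n" "sz n" "k0 n" "y n" "a n" "b n" "s n" for n
  by (rule sample)

text \<open>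
  The normalized error of the first mean if the sample is split at the true change point.
\<close>
definition U :: "nat \<Rightarrow> 'a \<Rightarrow> real" where
  "U n \<omega> = q n * (mean_first (\<lambda>i. y n i \<omega>) (k0 n) - a n)"

text \<open>
  The same error for the split at the estimated change point.
\<close>
definition Uhat :: "nat \<Rightarrow> 'a \<Rightarrow> real" where
  "Uhat n \<omega> = q n * (mean_first (\<lambda>i. y n i \<omega>) (khat n \<omega>) - a n)"

lemma reverse_array:
  "change_point_array M sz (\<lambda>n. sz n - k0 n) (\<lambda>n i. y n (Suc (sz n) - i)) b a s q (\<lambda>n \<omega>. sz n - khat n \<omega>) \<kappa> C"
proof (rule change_point_array.intro)
  show "change_point_sample (M n) (sz n) (sz n - k0 n) (\<lambda>i. y n (Suc (sz n) - i)) (b n) (a n) (s n)" for n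
    by (rule samp.reverse)
  show "(\<lambda>\<omega>. sz n - khat n \<omega>) \<in> measurable (M n) (count_space UNIV)" for n
    by (rule measurable_compose[OF khat_meas]) simp
  show "AE \<omega> in M n. is_change_point_estimate (sz n) (\<lambda>i. y n (Suc (sz n) - i) \<omega>) (sz n - khat n \<omega>)" for n
    using khat[of n] by eventually_elim (rule change_point_estimate_reverse)
  show "\<kappa> * real (sz n) \<le> real (sz n - k0 n)" "\<kappa> * real (sz n) \<le> real (sz n) - real (sz n - k0 n)" for n
    using \<kappa>(2,3)[of n] samp.k0(2)[of n] by (simp_all add: of_nat_diff)
qed (use \<kappa>(1) q s signal log_signal in \<open>simp_all add: abs_minus_commute\<close>)

lemma U_measurable: "U n \<in> borel_measurable (M n)"
proof -
  have [measurable]: "(\<lambda>\<omega>. mean_first (\<lambda>i. y n i \<omega>) (k0 n)) \<in> borel_measurable (M n)"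
    using samp.k0(2)[of n] by (intro samp.mean_first_measurable) simp
  show ?thesis unfolding U_def[abs_def] by measurable
qed

lemma Uhat_measurable: "Uhat n \<in> borel_measurable (M n)"
proof -
  have [measurable]: "(\<lambda>\<omega>. mean_first (\<lambda>i. y n i \<omega>) (khat n \<omega>)) \<in> borel_measurable (M n)"
    by (rule samp.mean_first_estimate_measurable[OF khat_meas khat_le])
  show ?thesis unfolding Uhat_def[abs_def] by measurable
qed

lemma abs_U: "\<bar>U n \<omega>\<bar> = q n * \<bar>mean_first (\<lambda>i. y n i \<omega>) (k0 n) - a n\<bar>"
  using q[of n] by (simp add: U_def abs_mult)

lemma U_tail:
  assumes "K > 0"
  shows "\<P>(\<omega> in M n. \<bar>U n \<omega>\<bar> > K) \<le> C / (\<kappa> * K\<^sup>2)"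
proof -
  have k0: "real (k0 n) > 0" and sz: "real (sz n) > 0" using samp.k0[of n] by auto
  have "{\<omega>\<in>space (M n). \<bar>U n \<omega>\<bar> > K} = {\<omega>\<in>space (M n). \<bar>mean_first (\<lambda>i. y n i \<omega>) (k0 n) - a n\<bar> > K / q n}"
    using q[of n] by (simp add: abs_U pos_divide_less_eq mult.commute)
  then have "\<P>(\<omega> in M n. \<bar>U n \<omega>\<bar> > K) \<le> s n / (real (k0 n) * (K / q n)\<^sup>2)"
    using samp.chebyshev_mean_first[of "K / q n" n] q[of n] assms by simp
  also have "\<dots> = s n * (q n)\<^sup>2 / (real (k0 n) * K\<^sup>2)" using q[of n] by (simp add: power_divide)
  also have "\<dots> \<le> C * real (sz n) / (real (k0 n) * K\<^sup>2)" using s[of n] k0 by (intro divide_right_mono) auto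
  also have "\<dots> \<le> C * real (sz n) / (\<kappa> * real (sz n) * K\<^sup>2)"
  proof (intro divide_left_mono mult_right_mono \<kappa>(2))
    have "0 \<le> s n * (q n)\<^sup>2" using samp.variance_bound_nonneg[of n] by simp
    then show "0 \<le> C * real (sz n)" using s[of n] by linarith
  qed (use \<kappa>(1) k0 sz assms in auto)
  also have "\<dots> = C / (\<kappa> * K\<^sup>2)" using sz by simp
  finally show ?thesis .
qed

lemma C_nonneg: "0 \<le> C"
proof -
  have "0 \<le> s 0 * (q 0)\<^sup>2" using samp.variance_bound_nonneg[of 0] by simp
  also have "\<dots> \<le> C * sz 0" by (rule s)
  finally show ?thesis using samp.k0[of 0] by (simp add: zero_le_mult_iff)
qed

text \<open>
  Here \<open>p\<close> is the signal to the power \<open>- 1 / 2\<close>. The tolerated error of the split is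
  \<open>sz n * p ^ 3\<close> and the tolerated noise in the windows is \<open>sz n * p / q n\<close>. These choices make the
  bias, the noise and, up to the logarithmic term, the probability of a larger error all of order \<open>p\<close>.
\<close>
lemma shift_tail:
  fixes p :: real
  assumes p: "0 < p" "p\<^sup>2 * (q n * \<bar>b n - a n\<bar>) = 1" and small: "p ^ 3 \<le> \<kappa> / 2" "6 / \<kappa> * p < \<epsilon>"
  shows "\<P>(\<omega> in M n. \<bar>Uhat n \<omega> - U n \<omega>\<bar> > \<epsilon>)
    \<le> 32 / \<kappa> * (2 * C * p + C / \<kappa> * ((2 + ln (sz n)) / (q n * \<bar>b n - a n\<bar>)\<^sup>2)) + 2 * C * p + C / \<kappa> * p ^ 4"
proof -
  define A where "A = q n * \<bar>b n - a n\<bar>"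
  have pA: "p\<^sup>2 * A = 1" using p by (simp add: A_def)
  have A_eq: "A = 1 / p\<^sup>2" using pA p(1) by (simp add: field_simps)
  have A: "A > 0" using p(1) by (simp add: A_eq)
  define g where "g = \<bar>b n - a n\<bar>"
  have g: "g > 0" "A = q n * g" using A q[of n] by (auto simp: A_def g_def zero_less_mult_iff)
  have sz: "real (sz n) > 0" using samp.k0[of n] by simp
  define m where "m = nat \<lfloor>real (sz n) * p ^ 3\<rfloor>"
  have m: "real m \<le> real (sz n) * p ^ 3" "real (sz n) * p ^ 3 \<le> real (Suc m)"
    using p(1) by (auto simp: m_def of_nat_nat) linarith
  have m_le: "real m \<le> \<kappa> / 2 * real (sz n)"
  proof -
    have "real (sz n) * p ^ 3 \<le> real (sz n) * (\<kappa> / 2)" using small sz by (intro mult_left_mono) auto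
    then show ?thesis using m(1) by (simp add: mult.commute)
  qed
  have gap: "real (k0 n) - real m \<ge> \<kappa> / 2 * real (sz n)" using m_le \<kappa>(2)[of n] by linarith
  have \<kappa>sz: "\<kappa> / 2 * real (sz n) > 0" using \<kappa>(1) sz by simp
  then have mk: "m < k0 n" using gap by linarith
  define x where "x = real (sz n) * p / q n"
  have x: "x > 0" using sz p q[of n] by (simp add: x_def)
  define d where "d \<omega> = \<bar>mean_first (\<lambda>i. y n i \<omega>) (khat n \<omega>) - mean_first (\<lambda>i. y n i \<omega>) (k0 n)\<bar>" for \<omega>
  define R where "R \<omega> = (m * (g + \<bar>mean_first (\<lambda>i. y n i \<omega>) (k0 n) - a n\<bar>) + x) / (real (k0 n) - m)" for \<omega>
  have [measurable]: "(\<lambda>\<omega>. mean_first (\<lambda>i. y n i \<omega>) (k0 n)) \<in> borel_measurable (M n)"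
    using samp.k0(2)[of n] by (intro samp.mean_first_measurable) simp
  have [measurable]: "(\<lambda>\<omega>. mean_first (\<lambda>i. y n i \<omega>) (khat n \<omega>)) \<in> borel_measurable (M n)"
    by (rule samp.mean_first_estimate_measurable[OF khat_meas khat_le])
  note [measurable] = U_measurable[of n]
  have sets: "{\<omega>\<in>space (M n). d \<omega> > R \<omega>} \<in> sets (M n)" "{\<omega>\<in>space (M n). \<bar>U n \<omega>\<bar> > A} \<in> sets (M n)"
    unfolding d_def R_def by measurable
  have "\<P>(\<omega> in M n. \<bar>Uhat n \<omega> - U n \<omega>\<bar> > \<epsilon>) \<le> \<P>(\<omega> in M n. d \<omega> > R \<omega>) + \<P>(\<omega> in M n. \<bar>U n \<omega>\<bar> > A)"
  proof (rule samp.prob_le_add[OF sets], intro AE_I2 impI, rule ccontr)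
    fix \<omega> assume far: "\<bar>Uhat n \<omega> - U n \<omega>\<bar> > \<epsilon>" and "\<not> (d \<omega> > R \<omega> \<or> \<bar>U n \<omega>\<bar> > A)"
    then have dR: "d \<omega> \<le> R \<omega>" and UA: "\<bar>U n \<omega>\<bar> \<le> A" by auto
    have "\<bar>Uhat n \<omega> - U n \<omega>\<bar> = q n * d \<omega>"
      using q[of n] by (simp add: Uhat_def U_def d_def abs_mult flip: right_diff_distrib)
    also have "\<dots> \<le> q n * R \<omega>" using dR q[of n] by simp
    also have "\<dots> = (m * (A + \<bar>U n \<omega>\<bar>) + q n * x) / (real (k0 n) - m)"
      by (simp add: R_def abs_U g(2) algebra_simps)
    also have "\<dots> \<le> (real (sz n) * p ^ 3 * (A + A) + real (sz n) * p) / (\<kappa> / 2 * real (sz n))"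
    proof (rule frac_le)
      have "m * (A + \<bar>U n \<omega>\<bar>) \<le> real (sz n) * p ^ 3 * (A + A)"
        using m(1) UA A p(1) by (intro mult_mono) auto
      moreover have "q n * x = real (sz n) * p" using q[of n] by (simp add: x_def)
      ultimately show "m * (A + \<bar>U n \<omega>\<bar>) + q n * x \<le> real (sz n) * p ^ 3 * (A + A) + real (sz n) * p" by linarith
      show "0 \<le> real (sz n) * p ^ 3 * (A + A) + real (sz n) * p" using A p(1) by simp
    qed (use gap \<kappa>sz in auto)
    also have "real (sz n) * p ^ 3 * (A + A) + real (sz n) * p = 3 * real (sz n) * p"
      using p(1) by (simp add: A_eq power3_eq_cube power2_eq_square)
    also have "3 * real (sz n) * p / (\<kappa> / 2 * real (sz n)) = 6 / \<kappa> * p" using sz by simp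
    finally show False using far small(2) by simp
  qed
  also have "\<dots> \<le> (2 * (16 * s n / (\<kappa> * g\<^sup>2) * (2 / real (Suc m) + (2 + ln (sz n)) / (\<kappa> * sz n))) + 2 * (s n * m / x\<^sup>2)) + C / (\<kappa> * A\<^sup>2)"
  proof (rule add_mono)
    show "\<P>(\<omega> in M n. d \<omega> > R \<omega>)
      \<le> 2 * (16 * s n / (\<kappa> * g\<^sup>2) * (2 / real (Suc m) + (2 + ln (sz n)) / (\<kappa> * sz n))) + 2 * (s n * m / x\<^sup>2)"
      unfolding d_def R_def
      by (rule samp.prob_mean_first_shift[OF khat_meas khat g_def g(1) x mk \<kappa>(1) \<kappa>(2)])
         (use \<kappa>(3)[of n] samp.k0[of n] in simp)
    show "\<P>(\<omega> in M n. \<bar>U n \<omega>\<bar> > A) \<le> C / (\<kappa> * A\<^sup>2)" by (rule U_tail[OF A])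
  qed
  also have "\<dots> \<le> 32 / \<kappa> * (2 * C * p + C / \<kappa> * ((2 + ln (sz n)) / A\<^sup>2)) + 2 * C * p + C / \<kappa> * p ^ 4"
  proof (intro add_mono)
    have s_g: "s n / g\<^sup>2 \<le> C * real (sz n) / A\<^sup>2"
    proof -
      have "s n / g\<^sup>2 = s n * (q n)\<^sup>2 / A\<^sup>2" using q[of n] by (simp add: g(2) power_mult_distrib)
      also have "\<dots> \<le> C * real (sz n) / A\<^sup>2" using s[of n] by (intro divide_right_mono) auto
      finally show ?thesis .
    qed
    have ln_nonneg: "0 \<le> ln (real (sz n))" using samp.k0[of n] by simp
    have "s n / g\<^sup>2 * (2 / real (Suc m) + (2 + ln (sz n)) / (\<kappa> * sz n))
        \<le> C * real (sz n) / A\<^sup>2 * (2 / real (Suc m) + (2 + ln (sz n)) / (\<kappa> * sz n))"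
      using \<kappa>(1) ln_nonneg by (intro mult_right_mono s_g add_nonneg_nonneg divide_nonneg_nonneg) auto
    also have "\<dots> = 2 * C * (real (sz n) / (A\<^sup>2 * real (Suc m))) + C / \<kappa> * ((2 + ln (sz n)) / A\<^sup>2)"
    proof -
      have "C * z / B * (2 / S + L / (\<kappa> * z)) = 2 * C * (z / (B * S)) + C / \<kappa> * (L / B)" if "z > 0" for z B S L
        using that by (simp add: distrib_left mult_ac)
      then show ?thesis using sz by blast
    qed
    also have "\<dots> \<le> 2 * C * p + C / \<kappa> * ((2 + ln (sz n)) / A\<^sup>2)"
    proof (intro add_right_mono mult_left_mono)
      have "real (sz n) = real (sz n) * p ^ 3 * A\<^sup>2 * p"
        using p(1) by (simp add: A_eq power3_eq_cube power2_eq_square)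
      also have "\<dots> \<le> real (Suc m) * A\<^sup>2 * p" using m(2) p(1) by (intro mult_right_mono) auto
      finally show "real (sz n) / (A\<^sup>2 * real (Suc m)) \<le> p" using A by (simp add: pos_divide_le_eq mult_ac)
    qed (use C_nonneg in auto)
    finally show "2 * (16 * s n / (\<kappa> * g\<^sup>2) * (2 / real (Suc m) + (2 + ln (sz n)) / (\<kappa> * sz n)))
       \<le> 32 / \<kappa> * (2 * C * p + C / \<kappa> * ((2 + ln (sz n)) / A\<^sup>2))"
    proof -
      assume *: "s n / g\<^sup>2 * (2 / real (Suc m) + (2 + ln (sz n)) / (\<kappa> * sz n)) \<le> 2 * C * p + C / \<kappa> * ((2 + ln (sz n)) / A\<^sup>2)"
      have "2 * (16 * s n / (\<kappa> * g\<^sup>2) * t) = 32 / \<kappa> * (s n / g\<^sup>2 * t)" for t by simp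
      then show ?thesis using mult_left_mono[OF *, of "32 / \<kappa>"] \<kappa>(1) by simp
    qed
    have "s n * m / x\<^sup>2 = s n * (q n)\<^sup>2 * m / ((real (sz n))\<^sup>2 * p\<^sup>2)"
      by (simp add: x_def power_divide power_mult_distrib)
    also have "\<dots> \<le> C * real (sz n) * (real (sz n) * p ^ 3) / ((real (sz n))\<^sup>2 * p\<^sup>2)"
      by (rule divide_right_mono[OF mult_mono[OF s m(1)]]) (use C_nonneg in auto)
    also have "\<dots> = C * p" using p(1) sz by (simp add: power3_eq_cube power2_eq_square)
    finally show "2 * (s n * m / x\<^sup>2) \<le> 2 * C * p" by simp
    show "C / (\<kappa> * A\<^sup>2) \<le> C / \<kappa> * p ^ 4" using p(1) by (simp add: A_eq power4_eq_xxxx power2_eq_square)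
  qed
  finally show ?thesis by (simp add: A_def)
qed

lemma shift_negligible:
  "vanishes_in_prob M (\<lambda>n \<omega>. Uhat n \<omega> - U n \<omega>)"
  unfolding vanishes_in_prob_def
proof (intro allI impI)
  fix \<epsilon> :: real assume "\<epsilon> > 0"
  define A where "A n = q n * \<bar>b n - a n\<bar>" for n
  have A: "filterlim A at_top sequentially" using signal by (simp add: A_def[abs_def])
  define p where "p n = 1 / sqrt (A n)" for n
  have p0: "p \<longlonglongrightarrow> 0"
    unfolding p_def[abs_def]
    by (intro tendsto_divide_0[OF tendsto_const] filterlim_at_top_imp_at_infinity filterlim_compose[OF sqrt_at_top A])
  have "(\<lambda>n. 1 / (A n)\<^sup>2) \<longlonglongrightarrow> 0"
    by (intro tendsto_divide_0[OF tendsto_const] filterlim_at_top_imp_at_infinity filterlim_pow_at_top A) simp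
  then have "(\<lambda>n. 2 * (1 / (A n)\<^sup>2) + ln (real (sz n)) / (A n)\<^sup>2) \<longlonglongrightarrow> 2 * 0 + 0"
    using log_signal unfolding A_def by (intro tendsto_intros)
  then have l0: "(\<lambda>n. (2 + ln (real (sz n))) / (A n)\<^sup>2) \<longlonglongrightarrow> 0"
    by (simp add: add_divide_distrib)
  have "(\<lambda>n. p n ^ 3) \<longlonglongrightarrow> 0" using tendsto_power[OF p0, of 3] by simp
  then have e1: "\<forall>\<^sub>F n in sequentially. p n ^ 3 < \<kappa> / 2" using \<kappa>(1) by (intro order_tendstoD(2)[where y = 0]) auto
  have "(\<lambda>n. 6 / \<kappa> * p n) \<longlonglongrightarrow> 0" by (rule tendsto_mult_right_zero[OF p0])
  then have e2: "\<forall>\<^sub>F n in sequentially. 6 / \<kappa> * p n < \<epsilon>" using \<open>\<epsilon> > 0\<close> by (intro order_tendstoD(2)[where y = 0]) auto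
  have e3: "\<forall>\<^sub>F n in sequentially. A n > 0" using A by (simp add: filterlim_at_top_dense)
  show "(\<lambda>n. \<P>(\<omega> in M n. \<bar>Uhat n \<omega> - U n \<omega>\<bar> > \<epsilon>)) \<longlonglongrightarrow> 0"
  proof (rule tendsto_sandwich[OF _ _ tendsto_const])
    show "\<forall>\<^sub>F n in sequentially. \<P>(\<omega> in M n. \<bar>Uhat n \<omega> - U n \<omega>\<bar> > \<epsilon>)
      \<le> 32 / \<kappa> * (2 * C * p n + C / \<kappa> * ((2 + ln (sz n)) / (A n)\<^sup>2)) + 2 * C * p n + C / \<kappa> * p n ^ 4"
      using e1 e2 e3
    proof eventually_elim
      case (elim n)
      have "(p n)\<^sup>2 * A n = 1" using elim(3) by (simp add: p_def power_divide)
      then show ?case unfolding A_def using elim by (intro shift_tail) (auto simp: p_def A_def)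
    qed
    have "(\<lambda>n. 32 / \<kappa> * (2 * C * p n + C / \<kappa> * ((2 + ln (sz n)) / (A n)\<^sup>2)) + 2 * C * p n + C / \<kappa> * p n ^ 4)
       \<longlonglongrightarrow> 32 / \<kappa> * (2 * C * 0 + C / \<kappa> * 0) + 2 * C * 0 + C / \<kappa> * 0 ^ 4"
      by (intro tendsto_intros p0 l0)
    then show "(\<lambda>n. 32 / \<kappa> * (2 * C * p n + C / \<kappa> * ((2 + ln (sz n)) / (A n)\<^sup>2)) + 2 * C * p n + C / \<kappa> * p n ^ 4) \<longlonglongrightarrow> 0"
      by simp
  qed auto
qed

lemma U_asymptotically_normal:
  assumes bound: "\<And>n i \<omega>. i \<in> {1..k0 n} \<Longrightarrow> \<omega> \<in> space (M n) \<Longrightarrow> \<bar>y n i \<omega> - a n\<bar> \<le> \<beta> n"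
    and \<beta>: "(\<lambda>n. q n * \<beta> n / sz n) \<longlonglongrightarrow> 0"
    and var: "\<And>n i. i \<in> {1..k0 n} \<Longrightarrow> prob_space.variance (M n) (y n i) = v n"
    and v: "(\<lambda>n. (q n)\<^sup>2 * v n / k0 n) \<longlonglongrightarrow> \<sigma>\<^sup>2" and "\<sigma> > 0"
  shows "weak_conv_m (\<lambda>n. distr (M n) borel (U n)) (density lborel (normal_density 0 \<sigma>))"
proof -
  define X where "X n i \<omega> = q n / k0 n * samp.noise n i \<omega>" for n i \<omega>
  have k0: "real (k0 n) > 0" for n using samp.k0[of n] by simp
  have sub: "{1..k0 n} \<subseteq> {1..sz n}" for n using samp.k0[of n] by auto
  have U_eq: "U n = (\<lambda>\<omega>. \<Sum>i=1..k0 n. X n i \<omega>)" for n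
    by (rule ext) (simp add: U_def samp.mean_first_centered X_def sum_distrib_left sum_divide_distrib)
  have "weak_conv_m (\<lambda>n. distr (M n) borel (\<lambda>\<omega>. \<Sum>i\<in>{1..k0 n}. X n i \<omega>)) (density lborel (normal_density 0 \<sigma>))"
  proof (rule central_limit_bounded_array)
    show "prob_space (M n)" for n by (rule samp.prob_space_axioms)
    show "prob_space.indep_vars (M n) (\<lambda>_. borel) (X n) {1..k0 n}" for n
      unfolding X_def[abs_def]
      by (rule samp.indep_vars_compose2[OF samp.indep_vars_subset[OF samp.noise_indep sub]]) auto
    show "integral\<^sup>L (M n) (X n i) = 0" if "i \<in> {1..k0 n}" for n i
      using samp.noise_mean[of i n] that sub[of n] by (auto simp: X_def[abs_def])
    show "\<bar>X n i \<omega>\<bar> \<le> q n * \<beta> n / k0 n" if "i \<in> {1..k0 n}" "\<omega> \<in> space (M n)" for n i \<omega>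
    proof -
      have "samp.noise n i \<omega> = y n i \<omega> - a n" using samp.y_before[OF that(1), of \<omega>] by simp
      then have "\<bar>X n i \<omega>\<bar> = q n / k0 n * \<bar>y n i \<omega> - a n\<bar>" using q[of n] by (simp add: X_def abs_mult)
      also have "\<dots> \<le> q n / k0 n * \<beta> n" using bound[OF that] q[of n] by (intro mult_left_mono) auto
      finally show ?thesis by simp
    qed
    show "(\<lambda>n. q n * \<beta> n / k0 n) \<longlonglongrightarrow> 0"
    proof (rule Lim_null_comparison)
      have "(\<lambda>n. 1 / \<kappa> * \<bar>q n * \<beta> n / sz n\<bar>) \<longlonglongrightarrow> 1 / \<kappa> * \<bar>0\<bar>" by (intro tendsto_intros \<beta>)
      then show "(\<lambda>n. 1 / \<kappa> * \<bar>q n * \<beta> n / sz n\<bar>) \<longlonglongrightarrow> 0" by simp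
      have "\<bar>q n * \<beta> n / k0 n\<bar> \<le> 1 / \<kappa> * \<bar>q n * \<beta> n / sz n\<bar>" for n
      proof -
        have "\<kappa> * real (sz n) > 0" using \<kappa>(1) samp.k0[of n] by simp
        then have "\<bar>q n * \<beta> n\<bar> / k0 n \<le> \<bar>q n * \<beta> n\<bar> / (\<kappa> * sz n)"
          using \<kappa>(2)[of n] k0[of n] by (intro divide_left_mono) auto
        then show ?thesis by (simp add: abs_mult)
      qed
      then show "\<forall>\<^sub>F n in sequentially. norm (q n * \<beta> n / k0 n) \<le> 1 / \<kappa> * \<bar>q n * \<beta> n / sz n\<bar>"
        by simp
    qed
    have "(\<Sum>i\<in>{1..k0 n}. prob_space.variance (M n) (X n i)) = (q n)\<^sup>2 * v n / k0 n" for n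
    proof -
      have "prob_space.variance (M n) (X n i) = (q n / k0 n)\<^sup>2 * v n" if i: "i \<in> {1..k0 n}" for i
      proof -
        have "integral\<^sup>L (M n) (X n i) = 0"
          using samp.noise_mean[of i n] i sub[of n] by (auto simp: X_def[abs_def])
        then have "prob_space.variance (M n) (X n i) = integral\<^sup>L (M n) (\<lambda>\<omega>. (q n / k0 n)\<^sup>2 * (samp.noise n i \<omega>)\<^sup>2)"
          by (simp add: X_def power_mult_distrib power_divide)
        also have "\<dots> = (q n / k0 n)\<^sup>2 * v n"
          using var[OF i] by (simp add: samp.noise_def)
        finally show ?thesis .
      qed
      then have "(\<Sum>i\<in>{1..k0 n}. prob_space.variance (M n) (X n i)) = (\<Sum>i\<in>{1..k0 n}. (q n / k0 n)\<^sup>2 * v n)"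
        by (intro sum.cong) auto
      then show ?thesis using k0[of n] by (simp add: power2_eq_square)
    qed
    then show "(\<lambda>n. \<Sum>i\<in>{1..k0 n}. prob_space.variance (M n) (X n i)) \<longlonglongrightarrow> \<sigma>\<^sup>2"
      using v by simp
  qed (use \<open>\<sigma> > 0\<close> in auto)
  then show ?thesis by (simp only: U_eq)
qed

text \<open>
  The counterpart of \<open>U\<close> for the second segment.
\<close>
definition W :: "nat \<Rightarrow> 'a \<Rightarrow> real" where
  "W n \<omega> = q n * (mean_last (sz n) (\<lambda>i. y n i \<omega>) (k0 n) - b n)"

lemma U_W_indep: "prob_space.indep_var (M n) borel (U n) borel (W n)"
proof -
  have k0: "1 \<le> k0 n" "k0 n < sz n" by (rule samp.k0)+
  have comp: "(\<lambda>x. (\<Sum>i\<in>S. x i :: real)) \<in> borel_measurable (PiM S (\<lambda>_. borel))" for S :: "nat set"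
    by (intro borel_measurable_sum[where f = "\<lambda>i x. x i"] measurable_component_singleton)
  have "samp.indep_var n borel ((\<lambda>x. q n * ((\<Sum>i\<in>{1..k0 n}. x i) / k0 n - a n)) \<circ> (\<lambda>\<omega>. restrict (\<lambda>i. y n i \<omega>) {1..k0 n}))
      borel ((\<lambda>x. q n * ((\<Sum>i\<in>{k0 n+1..sz n}. x i) / real (sz n - k0 n) - b n)) \<circ> (\<lambda>\<omega>. restrict (\<lambda>i. y n i \<omega>) {k0 n+1..sz n}))"
  proof (rule samp.indep_var_compose[OF samp.indep_var_restrict[OF samp.indep]])
    note [measurable] = comp[of "{1..k0 n}"] comp[of "{k0 n+1..sz n}"]
    show "(\<lambda>x. q n * ((\<Sum>i\<in>{1..k0 n}. x i) / k0 n - a n)) \<in> borel_measurable (PiM {1..k0 n} (\<lambda>_. borel))"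
      "(\<lambda>x. q n * ((\<Sum>i\<in>{k0 n+1..sz n}. x i) / real (sz n - k0 n) - b n)) \<in> borel_measurable (PiM {k0 n+1..sz n} (\<lambda>_. borel))"
      by measurable
  qed (use k0 in auto)
  also have "(\<lambda>x. q n * ((\<Sum>i\<in>{1..k0 n}. x i) / k0 n - a n)) \<circ> (\<lambda>\<omega>. restrict (\<lambda>i. y n i \<omega>) {1..k0 n}) = U n"
    by (simp add: fun_eq_iff U_def mean_first_def)
  also have "(\<lambda>x. q n * ((\<Sum>i\<in>{k0 n+1..sz n}. x i) / real (sz n - k0 n) - b n)) \<circ> (\<lambda>\<omega>. restrict (\<lambda>i. y n i \<omega>) {k0 n+1..sz n}) = W n"
    by (simp add: fun_eq_iff W_def mean_last_def)
  finally show ?thesis .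
qed

end

lemma (in change_point_array) W_reverse: "change_point_array.U (\<lambda>n. sz n - k0 n) (\<lambda>n i. y n (Suc (sz n) - i)) b q = W"
proof -
  interpret rev: change_point_array M sz "\<lambda>n. sz n - k0 n" "\<lambda>n i. y n (Suc (sz n) - i)" b a s q
    "\<lambda>n \<omega>. sz n - khat n \<omega>" \<kappa> C by (rule reverse_array)
  show ?thesis
  proof (intro ext)
    fix n \<omega>
    have "k0 n \<le> sz n" using samp.k0(2)[of n] by simp
    from mean_first_reverse[OF this, of "\<lambda>i. y n i \<omega>"] show "rev.U n \<omega> = W n \<omega>"
      by (simp add: rev.U_def W_def)
  qed
qed

text \<open>
  The components of \<open>(U, W)\<close> are independent with normal limits. Chebyshev's inequality makes this
  pair tight, so the limit passes to any asymptotically equivalent pair \<open>(L1, L2)\<close>, such as the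
  statistics that use the estimated change point.
\<close>
lemma (in change_point_array) estimates_jointly_normal:
  fixes f :: "real ^ 2 \<Rightarrow> real"
  assumes bound: "\<And>n i \<omega>. i \<in> {1..k0 n} \<Longrightarrow> \<omega> \<in> space (M n) \<Longrightarrow> \<bar>y n i \<omega> - a n\<bar> \<le> \<beta> n"
      "\<And>n i \<omega>. i \<in> {k0 n+1..sz n} \<Longrightarrow> \<omega> \<in> space (M n) \<Longrightarrow> \<bar>y n i \<omega> - b n\<bar> \<le> \<beta> n"
    and \<beta>: "(\<lambda>n. q n * \<beta> n / sz n) \<longlonglongrightarrow> 0"
    and var: "\<And>n i. i \<in> {1..k0 n} \<Longrightarrow> prob_space.variance (M n) (y n i) = v1 n"
      "\<And>n i. i \<in> {k0 n+1..sz n} \<Longrightarrow> prob_space.variance (M n) (y n i) = v2 n"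
    and v: "(\<lambda>n. (q n)\<^sup>2 * v1 n / real (k0 n)) \<longlonglongrightarrow> \<sigma>1\<^sup>2" "(\<lambda>n. (q n)\<^sup>2 * v2 n / real (sz n - k0 n)) \<longlonglongrightarrow> \<sigma>2\<^sup>2"
    and \<sigma>: "\<sigma>1 > 0" "\<sigma>2 > 0"
    and L_meas[measurable]: "\<And>n. L1 n \<in> borel_measurable (M n)" "\<And>n. L2 n \<in> borel_measurable (M n)"
    and close1: "vanishes_in_prob M (\<lambda>n \<omega>. L1 n \<omega> - U n \<omega>)"
    and close2: "vanishes_in_prob M (\<lambda>n \<omega>. L2 n \<omega> - W n \<omega>)"
    and f: "continuous_on UNIV f" "bounded (range f)"
  shows "(\<lambda>n. integral\<^sup>L (distr (M n) borel (\<lambda>\<omega>. vector [L1 n \<omega>, L2 n \<omega>])) f)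
    \<longlonglongrightarrow> integral\<^sup>L (multivariate_normal 0 (vector [vector [\<sigma>1\<^sup>2, 0], vector [0, \<sigma>2\<^sup>2]])) f"
proof -
  interpret rev: change_point_array M sz "\<lambda>n. sz n - k0 n" "\<lambda>n i. y n (Suc (sz n) - i)" b a s q
    "\<lambda>n \<omega>. sz n - khat n \<omega>" \<kappa> C by (rule reverse_array)
  have W_eq: "rev.U = W" by (rule W_reverse)
  obtain B where B: "\<And>x. \<bar>f x\<bar> \<le> B" using f(2) unfolding bounded_iff by (auto simp: Ball_def)
  have [measurable]: "f \<in> borel_measurable borel" by (rule borel_measurable_continuous_onI[OF f(1)])
  note [measurable] = U_measurable rev.U_measurable[unfolded W_eq]
  have vec_meas: "(\<lambda>\<omega>. vector [X \<omega>, Y \<omega>] :: real ^ 2) \<in> borel_measurable N"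
    if [measurable]: "X \<in> borel_measurable N" "Y \<in> borel_measurable N" for X Y :: "'b \<Rightarrow> real" and N
    unfolding vector_2_expand by measurable
  have vec_meas2: "(\<lambda>\<omega>. vector [X \<omega>, Y \<omega>] :: real ^ 2) \<in> borel_measurable N"
    if [measurable]: "X \<in> borel_measurable N" "Y \<in> borel_measurable N" for X Y :: "real \<times> real \<Rightarrow> real" and N
    unfolding vector_2_expand by measurable
  let ?\<mu> = "density lborel (normal_density 0 \<sigma>1)" and ?\<nu> = "density lborel (normal_density 0 \<sigma>2)"
  have U_weak: "weak_conv_m (\<lambda>n. distr (M n) borel (U n)) ?\<mu>"
    using bound(1) \<beta> var(1) v(1) \<sigma>(1) by (rule U_asymptotically_normal)
  have W_weak: "weak_conv_m (\<lambda>n. distr (M n) borel (W n)) ?\<nu>"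
    unfolding W_eq[symmetric]
  proof (rule rev.U_asymptotically_normal[OF _ \<beta> _ v(2) \<sigma>(2)])
    fix n i \<omega> assume i: "i \<in> {1..sz n - k0 n}"
    then have i': "Suc (sz n) - i \<in> {k0 n+1..sz n}" by auto
    then show "prob_space.variance (M n) (y n (Suc (sz n) - i)) = v2 n" by (rule var(2))
    assume "\<omega> \<in> space (M n)"
    with i' show "\<bar>y n (Suc (sz n) - i) \<omega> - b n\<bar> \<le> \<beta> n" by (rule bound(2))
  qed
  define h where "h z = f (vector [fst z, snd z])" for z
  have "continuous_on UNIV h"
    unfolding h_def vector_2_expand
    by (rule continuous_on_compose2[OF f(1)]) (auto intro!: continuous_intros)
  then have lim: "(\<lambda>n. integral\<^sup>L (M n) (\<lambda>\<omega>. h (U n \<omega>, W n \<omega>))) \<longlonglongrightarrow> integral\<^sup>L (?\<mu> \<Otimes>\<^sub>M ?\<nu>) h"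
    using samp.prob_space_axioms U_W_indep real_distribution_normal[OF \<sigma>(1)] real_distribution_normal[OF \<sigma>(2)] U_weak W_weak B
    by (intro weak_conv_indep_pair) (auto simp: h_def)
  have limit_eq: "integral\<^sup>L (?\<mu> \<Otimes>\<^sub>M ?\<nu>) h
      = integral\<^sup>L (multivariate_normal 0 (vector [vector [\<sigma>1\<^sup>2, 0], vector [0, \<sigma>2\<^sup>2]])) f"
  proof -
    have m: "(\<lambda>(x, y). vector [x, y] :: real ^ 2) \<in> borel_measurable (?\<mu> \<Otimes>\<^sub>M ?\<nu>)"
      unfolding case_prod_beta by (rule vec_meas2) auto
    show ?thesis
      unfolding multivariate_normal_diag2[OF \<sigma>] by (subst integral_distr[OF m]) (auto simp: h_def[abs_def] case_prod_beta)
  qed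
  have diff: "(\<lambda>n. integral\<^sup>L (M n) (\<lambda>\<omega>. f (vector [L1 n \<omega>, L2 n \<omega>])) - integral\<^sup>L (M n) (\<lambda>\<omega>. f (vector [U n \<omega>, W n \<omega>]))) \<longlonglongrightarrow> 0"
  proof (rule expectation_diff_tendsto_0[OF samp.prob_space_axioms _ _ _ _ f(1) B])
    fix \<epsilon> :: real assume "\<epsilon> > 0"
    define K where "K = 1 + 2 * C / (\<kappa> * \<epsilon>)"
    have K: "K \<ge> 1" "2 * C / (\<kappa> * \<epsilon>) \<le> K" using C_nonneg \<kappa>(1) \<open>\<epsilon> > 0\<close> by (auto simp: K_def)
    have CK: "C / (\<kappa> * K\<^sup>2) \<le> \<epsilon> / 2"
    proof -
      have "2 * C \<le> K * (\<kappa> * \<epsilon>)" using K(2) \<kappa>(1) \<open>\<epsilon> > 0\<close> by (simp add: pos_divide_le_eq)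
      also have "\<dots> \<le> K\<^sup>2 * (\<kappa> * \<epsilon>)"
        using K(1) \<kappa>(1) \<open>\<epsilon> > 0\<close> by (intro mult_right_mono) (auto simp: power2_eq_square)
      finally show ?thesis using K(1) \<kappa>(1) by (simp add: pos_divide_le_eq mult_ac)
    qed
    have "\<P>(\<omega> in M n. norm (vector [U n \<omega>, W n \<omega>] :: real ^ 2) > 2 * K) \<le> \<epsilon>" for n
    proof -
      have "\<P>(\<omega> in M n. norm (vector [U n \<omega>, W n \<omega>] :: real ^ 2) > 2 * K)
          \<le> \<P>(\<omega> in M n. \<bar>U n \<omega>\<bar> > K) + \<P>(\<omega> in M n. \<bar>W n \<omega>\<bar> > K)"
      proof (rule samp.prob_le_add)
        show "AE \<omega> in M n. norm (vector [U n \<omega>, W n \<omega>] :: real ^ 2) > 2 * K \<longrightarrow> \<bar>U n \<omega>\<bar> > K \<or> \<bar>W n \<omega>\<bar> > K"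
        proof (intro AE_I2 impI, rule ccontr)
          fix \<omega> assume "norm (vector [U n \<omega>, W n \<omega>] :: real ^ 2) > 2 * K" "\<not> (\<bar>U n \<omega>\<bar> > K \<or> \<bar>W n \<omega>\<bar> > K)"
          then show False using norm_vector_2_le[of "U n \<omega>" "W n \<omega>"] by linarith
        qed
      qed measurable
      also have "\<dots> \<le> \<epsilon> / 2 + \<epsilon> / 2"
        using U_tail[of K n] rev.U_tail[of K n] CK K(1) unfolding W_eq by linarith
      finally show ?thesis by simp
    qed
    then show "\<exists>K. \<forall>\<^sub>F n in sequentially. \<P>(\<omega> in M n. norm (vector [U n \<omega>, W n \<omega>] :: real ^ 2) > K) \<le> \<epsilon>"
      by (intro exI[of _ "2 * K"]) simp
  next
    show "vanishes_in_prob M (\<lambda>n \<omega>. dist (vector [L1 n \<omega>, L2 n \<omega>] :: real ^ 2) (vector [U n \<omega>, W n \<omega>]))"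
      unfolding vanishes_in_prob_def abs_of_nonneg[OF zero_le_dist]
    proof (intro allI impI)
      fix \<epsilon> :: real assume "\<epsilon> > 0"
      let ?s = "\<lambda>n. \<P>(\<omega> in M n. \<epsilon> / 2 < \<bar>L1 n \<omega> - U n \<omega>\<bar>) + \<P>(\<omega> in M n. \<epsilon> / 2 < \<bar>L2 n \<omega> - W n \<omega>\<bar>)"
      have "?s \<longlonglongrightarrow> 0 + 0"
        using \<open>\<epsilon> > 0\<close> by (intro tendsto_add vanishes_in_probD[OF close1] vanishes_in_probD[OF close2] half_gt_zero)
      then have s0: "?s \<longlonglongrightarrow> 0" by simp
      have le: "\<P>(\<omega> in M n. \<epsilon> < dist (vector [L1 n \<omega>, L2 n \<omega>] :: real ^ 2) (vector [U n \<omega>, W n \<omega>])) \<le> ?s n" for n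
      proof (rule samp.prob_le_add)
        show "AE \<omega> in M n. \<epsilon> < dist (vector [L1 n \<omega>, L2 n \<omega>] :: real ^ 2) (vector [U n \<omega>, W n \<omega>])
          \<longrightarrow> \<epsilon> / 2 < \<bar>L1 n \<omega> - U n \<omega>\<bar> \<or> \<epsilon> / 2 < \<bar>L2 n \<omega> - W n \<omega>\<bar>"
        proof (intro AE_I2 impI, rule ccontr)
          fix \<omega>
          assume d: "\<epsilon> < dist (vector [L1 n \<omega>, L2 n \<omega>] :: real ^ 2) (vector [U n \<omega>, W n \<omega>])"
            "\<not> (\<epsilon> / 2 < \<bar>L1 n \<omega> - U n \<omega>\<bar> \<or> \<epsilon> / 2 < \<bar>L2 n \<omega> - W n \<omega>\<bar>)"
          have "vector [L1 n \<omega>, L2 n \<omega>] - vector [U n \<omega>, W n \<omega>] = (vector [L1 n \<omega> - U n \<omega>, L2 n \<omega> - W n \<omega>] :: real ^ 2)"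
            by (simp add: vec_eq_iff forall_2)
          then show False
            using d norm_vector_2_le[of "L1 n \<omega> - U n \<omega>" "L2 n \<omega> - W n \<omega>"] by (simp add: dist_norm)
        qed
      qed measurable
      show "(\<lambda>n. \<P>(\<omega> in M n. \<epsilon> < dist (vector [L1 n \<omega>, L2 n \<omega>] :: real ^ 2) (vector [U n \<omega>, W n \<omega>]))) \<longlonglongrightarrow> 0"
        by (rule tendsto_sandwich[OF _ _ tendsto_const s0]) (use le in simp_all)
    qed
  qed (auto intro: vec_meas)
  have "(\<lambda>n. integral\<^sup>L (M n) (\<lambda>\<omega>. f (vector [L1 n \<omega>, L2 n \<omega>])))
    \<longlonglongrightarrow> integral\<^sup>L (multivariate_normal 0 (vector [vector [\<sigma>1\<^sup>2, 0], vector [0, \<sigma>2\<^sup>2]])) f"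
    using tendsto_add[OF diff lim] by (simp add: h_def limit_eq)
  moreover have "integral\<^sup>L (distr (M n) borel (\<lambda>\<omega>. vector [L1 n \<omega>, L2 n \<omega>])) f = integral\<^sup>L (M n) (\<lambda>\<omega>. f (vector [L1 n \<omega>, L2 n \<omega>]))" for n
    by (intro integral_distr vec_meas) auto
  ultimately show ?thesis by simp
qed

section \<open>From means to intensities\<close>

lemma ln_diff_linearization:
  fixes x y r :: real
  assumes "0 \<le> x" "0 \<le> y" "x \<le> r" "y \<le> r" "r \<le> 1/2"
  shows "\<bar>(ln (1 - y) - ln (1 - x)) + (y - x)\<bar> \<le> 2 * r * \<bar>y - x\<bar>"
proof -
  have *: "ln (1 - u) - ln (1 - w) - (w - u) \<le> 2 * r * (w - u) \<and> 0 \<le> ln (1 - u) - ln (1 - w) - (w - u)"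
    if uw: "0 \<le> u" "u \<le> w" "w \<le> r" for u w
  proof -
    have pos: "1 - w > 0" "1 - u > 0" "1 - w \<ge> 1/2" using uw assms by auto
    have "ln (1 - u) - ln (1 - w) = ln ((1 - u) / (1 - w))" using pos by (simp add: ln_div)
    also have "\<dots> \<le> (1 - u) / (1 - w) - 1" using pos by (intro ln_le_minus_one) auto
    also have "\<dots> = (w - u) / (1 - w)" using pos by (simp add: field_simps)
    finally have 1: "ln (1 - u) - ln (1 - w) \<le> (w - u) / (1 - w)" .
    have "ln (1 - w) - ln (1 - u) = ln ((1 - w) / (1 - u))" using pos by (simp add: ln_div)
    also have "\<dots> \<le> (1 - w) / (1 - u) - 1" using pos by (intro ln_le_minus_one) auto
    also have "\<dots> = - ((w - u) / (1 - u))" using pos by (simp add: field_simps)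
    also have "\<dots> \<le> - (w - u)" using uw pos mult_left_mono[of u w u] by (simp add: field_simps)
    finally have 2: "0 \<le> ln (1 - u) - ln (1 - w) - (w - u)" by simp
    have "(w - u) / (1 - w) - (w - u) = (w - u) * (w / (1 - w))" using pos by (simp add: field_simps)
    also have "\<dots> \<le> (w - u) * (2 * r)"
    proof (intro mult_left_mono)
      have "w \<le> r * (2 * (1 - w))" using uw pos assms mult_left_mono[of 1 "2 * (1 - w)" r] by simp
      then show "w / (1 - w) \<le> 2 * r" using pos by (simp add: field_simps)
    qed (use uw in auto)
    finally show ?thesis using 1 2 by (simp add: mult_ac)
  qed
  show ?thesis
  proof (cases "x \<le> y")
    case True then show ?thesis using *[of x y] assms by auto
  next
    case False then show ?thesis using *[of y x] assms by (auto simp: abs_if)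
  qed
qed

lemma switch_mean_bounds:
  assumes "D > 0" "lam > 0"
  shows "0 < switch_mean D lam" "switch_mean D lam \<le> lam" "switch_mean D lam < 1 / D"
    "lam - lam\<^sup>2 * D \<le> switch_mean D lam"
proof -
  have e: "1 - lam * D \<le> exp (- lam * D)" using exp_ge_add_one_self[of "- lam * D"] by simp
  show "0 < switch_mean D lam" using assms by (simp add: switch_mean_def)
  show "switch_mean D lam \<le> lam" using e assms by (simp add: switch_mean_def pos_divide_le_eq)
  show "switch_mean D lam < 1 / D" using assms by (simp add: switch_mean_def divide_strict_right_mono)
  have "exp (- (lam * D)) \<le> 1 - lam * D + (lam * D)\<^sup>2"
    using exp_neg_quadratic_bound[of "lam * D"] assms by (simp add: abs_le_iff)
  then have "lam * D - (lam * D)\<^sup>2 \<le> 1 - exp (- lam * D)" by simp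
  then have "(lam * D - (lam * D)\<^sup>2) / D \<le> switch_mean D lam"
    using assms unfolding switch_mean_def by (intro divide_right_mono) auto
  also have "(lam * D - (lam * D)\<^sup>2) / D = lam - lam\<^sup>2 * D"
    using assms by (simp add: diff_divide_distrib power2_eq_square)
  finally show "lam - lam\<^sup>2 * D \<le> switch_mean D lam" .
qed

text \<open>
  The intensity is the image of \<open>switch_mean D lam\<close> under the same transformation that produces the
  estimate from \<open>g\<close>. Both arguments of the logarithm lie within \<open>r\<close> of \<open>1\<close>, so the error of the
  linear approximation is at most \<open>2 * r\<close> relative to the difference of the arguments.
\<close>
lemma intensity_estimate_linearization:
  assumes "D > 0" "q > 0" "lam > 0" "g \<ge> 0" and est: "is_intensity_estimate D g l"
    and K: "\<bar>q * (g - switch_mean D lam)\<bar> \<le> K" and r: "r = lam * D + K * D / q" "r \<le> 1 / 2"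
  shows "\<bar>q * (l - lam) - q * (g - switch_mean D lam)\<bar> \<le> 2 * r * K"
proof -
  define \<gamma> where "\<gamma> = switch_mean D lam"
  have \<gamma>: "0 < \<gamma>" "\<gamma> \<le> lam" using switch_mean_bounds[OF assms(1,3)] by (simp_all add: \<gamma>_def)
  have "K \<ge> 0" using K by linarith
  have \<gamma>_r: "\<gamma> * D \<le> r"
  proof -
    have "\<gamma> * D \<le> lam * D" using \<gamma> assms(1) by simp
    moreover have "0 \<le> K * D / q" using \<open>K \<ge> 0\<close> assms by simp
    ultimately show ?thesis using r(1) by linarith
  qed
  have "q * (g - \<gamma>) \<le> K" using K by (simp add: \<gamma>_def abs_le_iff)
  then have "g - \<gamma> \<le> K / q" using \<open>q > 0\<close> by (simp add: pos_le_divide_eq mult.commute)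
  then have "g * D \<le> (lam + K / q) * D" using \<gamma> assms(1) by (intro mult_right_mono) auto
  then have g_r: "g * D \<le> r" by (simp add: r(1) distrib_right)
  have l: "l = - (1 / D) * ln (1 - g * D)"
    using est g_r r(2) by (simp add: is_intensity_estimate_def)
  have "ln (1 - \<gamma> * D) = - lam * D" using assms(1) by (simp add: \<gamma>_def switch_mean_def)
  then have lam: "lam = - (1 / D) * ln (1 - \<gamma> * D)" using assms(1) by simp
  let ?x = "\<gamma> * D" and ?y = "g * D"
  have "q * (l - lam) - q * (g - \<gamma>) = - (q / D) * ((ln (1 - ?y) - ln (1 - ?x)) + (?y - ?x))"
    by (subst l, subst (1) lam) (use assms(1) in \<open>simp add: field_simps\<close>)
  then have "\<bar>q * (l - lam) - q * (g - \<gamma>)\<bar> = q / D * \<bar>(ln (1 - ?y) - ln (1 - ?x)) + (?y - ?x)\<bar>"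
    using assms(1,2) by (simp add: abs_mult)
  also have "\<dots> \<le> q / D * (2 * r * \<bar>?y - ?x\<bar>)"
    using assms(1,2,4) \<gamma> \<gamma>_r g_r r(2) by (intro mult_left_mono ln_diff_linearization) auto
  also have "\<bar>?y - ?x\<bar> = D * \<bar>g - \<gamma>\<bar>"
    using assms(1) by (simp add: abs_mult flip: left_diff_distrib)
  also have "q / D * (2 * r * (D * \<bar>g - \<gamma>\<bar>)) = 2 * r * \<bar>q * (g - \<gamma>)\<bar>"
    using assms(1,2) by (simp add: abs_mult)
  also have "\<dots> \<le> 2 * r * K"
    using K \<gamma>_r \<gamma>(1) assms(1) unfolding \<gamma>_def[symmetric] by (intro mult_left_mono) (auto intro: order_trans[rotated])
  finally show ?thesis by (simp add: \<gamma>_def)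
qed

text \<open>
  The linearization is applied on the event that \<open>U n\<close> is at most \<open>K n = D n powr (- 1 / 4)\<close> in
  absolute value. This bound tends to infinity, so that the event has probability tending to \<open>1\<close>, but slowly enough
  for \<open>D n * (K n)\<^sup>2\<close> to vanish.
\<close>
lemma (in change_point_array) log_transform_negligible:
  fixes D lam :: "nat \<Rightarrow> real"
  assumes D: "\<And>n. 0 < D n" "D \<longlonglongrightarrow> 0" and q_lim: "filterlim q at_top sequentially"
    and lam: "\<And>n. 0 < lam n" "lam \<longlonglongrightarrow> l0" and a: "\<And>n. a n = switch_mean (D n) (lam n)"
    and y_nonneg: "\<And>n i \<omega>. 0 \<le> y n i \<omega>"
    and L_meas[measurable]: "\<And>n. L n \<in> borel_measurable (M n)"
    and L: "\<And>n. AE \<omega> in M n. is_intensity_estimate (D n) (mean_first (\<lambda>i. y n i \<omega>) (khat n \<omega>)) (L n \<omega>)"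
  shows "vanishes_in_prob M (\<lambda>n \<omega>. q n * (L n \<omega> - lam n) - U n \<omega>)"
  unfolding vanishes_in_prob_def
proof (intro allI impI)
  fix \<epsilon> :: real assume "\<epsilon> > 0"
  define u where "u n = sqrt (sqrt (D n))" for n
  have u: "u n > 0" "u n ^ 4 = D n" for n
  proof -
    show "u n > 0" using D(1)[of n] by (simp add: u_def)
    have "u n ^ 4 = ((u n)\<^sup>2)\<^sup>2" by (simp flip: power_mult)
    also have "\<dots> = D n" using D(1)[of n] by (simp add: u_def)
    finally show "u n ^ 4 = D n" .
  qed
  have "(\<lambda>n. sqrt (sqrt (D n))) \<longlonglongrightarrow> sqrt (sqrt 0)" by (intro tendsto_intros D)
  then have u0: "u \<longlonglongrightarrow> 0" by (simp add: u_def[abs_def])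
  define K where "K n = 1 / u n" for n
  define r where "r n = lam n * D n + (K n + 1) * D n / q n" for n
  have iq: "(\<lambda>n. 1 / q n) \<longlonglongrightarrow> 0"
    by (intro tendsto_divide_0[OF tendsto_const] filterlim_at_top_imp_at_infinity q_lim)
  have KD: "(K n + 1) * D n = u n ^ 3 * (1 + u n)" for n
    using u(1)[of n] by (simp add: K_def u(2)[symmetric] power4_eq_xxxx power3_eq_cube field_simps)
  have KKD: "(K n + 1) * ((K n + 1) * D n) = u n ^ 2 * (1 + u n) ^ 2" for n
    unfolding KD using u(1)[of n] by (simp add: K_def power3_eq_cube power2_eq_square field_simps)
  have r_eq: "r n = lam n * u n ^ 4 + u n ^ 3 * (1 + u n) * (1 / q n)" for n
    unfolding r_def KD by (simp add: u(2))
  have "(\<lambda>n. lam n * u n ^ 4 + u n ^ 3 * (1 + u n) * (1 / q n)) \<longlonglongrightarrow> l0 * 0 ^ 4 + 0 ^ 3 * (1 + 0) * 0"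
    by (intro tendsto_intros lam u0 iq)
  then have r0: "r \<longlonglongrightarrow> 0" by (simp add: r_eq[abs_def])
  have rK_eq: "r n * (K n + 1) = lam n * (u n ^ 3 * (1 + u n)) + u n ^ 2 * (1 + u n) ^ 2 * (1 / q n)" for n
    unfolding KD[symmetric] KKD[symmetric] r_def by (simp add: algebra_simps add_divide_distrib)
  have "(\<lambda>n. lam n * (u n ^ 3 * (1 + u n)) + u n ^ 2 * (1 + u n) ^ 2 * (1 / q n)) \<longlonglongrightarrow> l0 * (0 ^ 3 * (1 + 0)) + 0 ^ 2 * (1 + 0) ^ 2 * 0"
    by (intro tendsto_intros lam u0 iq)
  then have rK0: "(\<lambda>n. r n * (K n + 1)) \<longlonglongrightarrow> 0" by (simp add: rK_eq)
  define \<delta> where "\<delta> = min (\<epsilon> / 2) 1"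
  have \<delta>: "\<delta> > 0" "\<delta> \<le> \<epsilon> / 2" "\<delta> \<le> 1" using \<open>\<epsilon> > 0\<close> by (auto simp: \<delta>_def)
  have e1: "\<forall>\<^sub>F n in sequentially. r n < 1 / 2" by (rule order_tendstoD(2)[OF r0]) simp
  have e2: "\<forall>\<^sub>F n in sequentially. r n * (K n + 1) < \<epsilon> / 4" by (rule order_tendstoD(2)[OF rK0]) (use \<open>\<epsilon> > 0\<close> in simp)
  note [measurable] = U_measurable Uhat_measurable
  show "(\<lambda>n. \<P>(\<omega> in M n. \<bar>q n * (L n \<omega> - lam n) - U n \<omega>\<bar> > \<epsilon>)) \<longlonglongrightarrow> 0"
  proof (rule tendsto_sandwich[OF _ _ tendsto_const])
    let ?s = "\<lambda>n. \<P>(\<omega> in M n. \<bar>Uhat n \<omega> - U n \<omega>\<bar> > \<delta>) + C / \<kappa> * u n ^ 2"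
    have "?s \<longlonglongrightarrow> 0 + C / \<kappa> * 0 ^ 2"
      by (intro tendsto_intros u0 vanishes_in_probD[OF shift_negligible] \<delta>(1))
    then show "?s \<longlonglongrightarrow> 0" by simp
    show "\<forall>\<^sub>F n in sequentially. \<P>(\<omega> in M n. \<bar>q n * (L n \<omega> - lam n) - U n \<omega>\<bar> > \<epsilon>) \<le> ?s n"
      using e1 e2
    proof eventually_elim
      case (elim n)
      have "\<P>(\<omega> in M n. \<bar>q n * (L n \<omega> - lam n) - U n \<omega>\<bar> > \<epsilon>)
        \<le> \<P>(\<omega> in M n. \<bar>Uhat n \<omega> - U n \<omega>\<bar> > \<delta>) + \<P>(\<omega> in M n. \<bar>U n \<omega>\<bar> > K n)"
      proof (rule samp.prob_le_add)
        show "AE \<omega> in M n. \<bar>q n * (L n \<omega> - lam n) - U n \<omega>\<bar> > \<epsilon> \<longrightarrow> \<bar>Uhat n \<omega> - U n \<omega>\<bar> > \<delta> \<or> \<bar>U n \<omega>\<bar> > K n"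
          using L[of n]
        proof eventually_elim
          case (elim \<omega>)
          show ?case
          proof (rule impI, rule ccontr)
            assume far: "\<bar>q n * (L n \<omega> - lam n) - U n \<omega>\<bar> > \<epsilon>" and "\<not> (\<bar>Uhat n \<omega> - U n \<omega>\<bar> > \<delta> \<or> \<bar>U n \<omega>\<bar> > K n)"
            then have small: "\<bar>Uhat n \<omega> - U n \<omega>\<bar> \<le> \<delta>" "\<bar>U n \<omega>\<bar> \<le> K n" by auto
            let ?g = "mean_first (\<lambda>i. y n i \<omega>) (khat n \<omega>)"
            have Uh: "Uhat n \<omega> = q n * (?g - switch_mean (D n) (lam n))" by (simp add: Uhat_def a)
            have "\<bar>q n * (?g - switch_mean (D n) (lam n))\<bar> \<le> K n + 1"
              using small \<delta> unfolding Uh[symmetric] by linarith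
            moreover have "?g \<ge> 0" unfolding mean_first_def by (intro divide_nonneg_nonneg sum_nonneg y_nonneg) auto
            ultimately have "\<bar>q n * (L n \<omega> - lam n) - Uhat n \<omega>\<bar> \<le> 2 * r n * (K n + 1)"
              unfolding Uh using elim \<open>r n < 1 / 2\<close>
              by (intro intensity_estimate_linearization D q lam) (auto simp: r_def)
            then show False using small \<delta> far \<open>r n * (K n + 1) < \<epsilon> / 4\<close> by auto
          qed
        qed
      qed measurable
      also have "\<P>(\<omega> in M n. \<bar>U n \<omega>\<bar> > K n) \<le> C / (\<kappa> * (K n)\<^sup>2)" using u(1)[of n] by (intro U_tail) (simp add: K_def)
      also have "C / (\<kappa> * (K n)\<^sup>2) = C / \<kappa> * u n ^ 2" by (simp add: K_def power_divide)
      finally show ?case by simp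
    qed
  qed auto
qed

section \<open>Switches of the telegraph process\<close>

lemma integral_change_intensity:
  assumes "u \<le> w" "w \<le> \<theta> \<or> \<theta> \<le> u"
  shows "integral {u..w} (change_intensity l1 l2 \<theta>) = (if w \<le> \<theta> then l1 else l2) * (w - u)"
proof (cases "w \<le> \<theta>")
  case True
  then have "integral {u..w} (change_intensity l1 l2 \<theta>) = integral {u..w} (\<lambda>_. l1)"
    by (intro integral_cong) (auto simp: change_intensity_def)
  then show ?thesis using True assms(1) by simp
next
  case False
  then have "integral {u..w} (change_intensity l1 l2 \<theta>) = integral {u..w} (\<lambda>_. l2)"
    using assms(2) by (intro integral_spike[of "{\<theta>}"]) (auto simp: change_intensity_def)
  then show ?thesis using False assms(1) by simp
qed

lemma poisson_increment_probs:
  assumes N: "inhom_poisson_process M T lam N" and st: "0 \<le> s" "s \<le> t" "t \<le> T"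
    and I: "integral {s..t} lam = \<Lambda>" and "\<Lambda> \<ge> 0"
  shows poisson_increment_zero: "measure M {\<omega>\<in>space M. N t \<omega> - N s \<omega> = 0} = exp (- \<Lambda>)"
    and poisson_increment_pos: "measure M {\<omega>\<in>space M. 1 \<le> N t \<omega> - N s \<omega>} \<le> \<Lambda>"
    and poisson_increment_ge_2: "measure M {\<omega>\<in>space M. 2 \<le> N t \<omega> - N s \<omega>} \<le> \<Lambda>\<^sup>2"
proof -
  interpret prob_space M using N by (simp add: inhom_poisson_process_def)
  have [measurable]: "N s \<in> measurable M (count_space UNIV)" "N t \<in> measurable M (count_space UNIV)"
    using N st by (auto simp: inhom_poisson_process_def)
  have P: "\<P>(\<omega> in M. N t \<omega> - N s \<omega> = j) = \<Lambda> ^ j / fact j * exp (- \<Lambda>)" for j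
    using N st I by (auto simp: inhom_poisson_process_def)
  show P0: "\<P>(\<omega> in M. N t \<omega> - N s \<omega> = 0) = exp (- \<Lambda>)" using P[of 0] by simp
  have exp: "1 - \<Lambda> \<le> exp (- \<Lambda>)" using exp_ge_add_one_self[of "- \<Lambda>"] by simp
  have "\<P>(\<omega> in M. \<not> N t \<omega> - N s \<omega> = 0) = 1 - exp (- \<Lambda>)"
    by (subst prob_neg) (measurable, use P0 in simp)
  moreover have "{\<omega>\<in>space M. 1 \<le> N t \<omega> - N s \<omega>} = {\<omega>\<in>space M. \<not> N t \<omega> - N s \<omega> = 0}" by auto
  ultimately show "\<P>(\<omega> in M. 1 \<le> N t \<omega> - N s \<omega>) \<le> \<Lambda>" using exp by simp
  have "\<P>(\<omega> in M. N t \<omega> - N s \<omega> = 0 \<or> N t \<omega> - N s \<omega> = 1)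
      = prob ({\<omega>\<in>space M. N t \<omega> - N s \<omega> = 0} \<union> {\<omega>\<in>space M. N t \<omega> - N s \<omega> = 1})"
    by (intro arg_cong[where f = prob]) auto
  also have "\<dots> = \<P>(\<omega> in M. N t \<omega> - N s \<omega> = 0) + \<P>(\<omega> in M. N t \<omega> - N s \<omega> = 1)"
  proof (rule finite_measure_Union)
    show "{\<omega>\<in>space M. N t \<omega> - N s \<omega> = 0} \<in> events" "{\<omega>\<in>space M. N t \<omega> - N s \<omega> = 1} \<in> events"
      by measurable
  qed auto
  also have "\<dots> = (1 + \<Lambda>) * exp (- \<Lambda>)" using P0 P[of 1] by (simp add: algebra_simps)
  finally have P01: "\<P>(\<omega> in M. N t \<omega> - N s \<omega> = 0 \<or> N t \<omega> - N s \<omega> = 1) = (1 + \<Lambda>) * exp (- \<Lambda>)" .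
  have "{\<omega>\<in>space M. 2 \<le> N t \<omega> - N s \<omega>} = {\<omega>\<in>space M. \<not> (N t \<omega> - N s \<omega> = 0 \<or> N t \<omega> - N s \<omega> = 1)}" by auto
  moreover have "\<P>(\<omega> in M. \<not> (N t \<omega> - N s \<omega> = 0 \<or> N t \<omega> - N s \<omega> = 1)) = 1 - (1 + \<Lambda>) * exp (- \<Lambda>)"
    by (subst prob_neg) (measurable, use P01 in simp)
  moreover have "(1 + \<Lambda>) * (1 - \<Lambda>) \<le> (1 + \<Lambda>) * exp (- \<Lambda>)"
    using exp \<open>\<Lambda> \<ge> 0\<close> by (intro mult_left_mono) auto
  ultimately show "\<P>(\<omega> in M. 2 \<le> N t \<omega> - N s \<omega>) \<le> \<Lambda>\<^sup>2"
    by (simp add: power2_eq_square algebra_simps)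
qed

lemma parity_integrable:
  fixes g :: "real \<Rightarrow> nat"
  assumes "mono_on {a..b} g"
  shows "(\<lambda>s. (- 1) ^ g s :: real) integrable_on {a..b}"
proof (cases "a \<le> b")
  case True
  define A where "A j = {s\<in>{a..b}. g s = j}" for j
  have "convex (A j)" for j
    unfolding is_interval_convex_1[symmetric] is_interval_1
  proof safe
    fix x y z assume xy: "x \<in> A j" "y \<in> A j" and z: "x \<le> z" "z \<le> y"
    then have "g x \<le> g z" "g z \<le> g y"
      using mono_onD[OF assms, of x z] mono_onD[OF assms, of z y] by (auto simp: A_def)
    then show "z \<in> A j" using xy z by (auto simp: A_def)
  qed
  moreover have "bounded (A j)" for j by (rule bounded_subset[of "{a..b}"]) (auto simp: A_def)
  ultimately have "A j \<in> lmeasurable" for j by (rule measurable_convex)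
  then have "(indicator (A j) :: real \<Rightarrow> real) integrable_on {a..b}" for j
    by (subst integrable_on_indicator, subst Int_absorb2) (auto simp: A_def)
  then have "(\<lambda>s. \<Sum>j\<le>g b. (- 1) ^ j * indicator (A j) s :: real) integrable_on {a..b}"
    by (intro integrable_sum integrable_on_mult_right) auto
  moreover have "(\<Sum>j\<le>g b. (- 1) ^ j * indicator (A j) s :: real) = (- 1) ^ g s" if "s \<in> {a..b}" for s
  proof -
    have "g s \<le> g b" using that assms True by (auto simp: mono_on_def)
    have "(\<Sum>j\<le>g b. (- 1) ^ j * indicator (A j) s :: real) = (\<Sum>j\<le>g b. if j = g s then (- 1) ^ j else 0)"
      using that by (intro sum.cong) (auto simp: A_def indicator_def)
    then show ?thesis using \<open>g s \<le> g b\<close> by simp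
  qed
  ultimately show ?thesis by (rule integrable_eq)
qed (simp add: integrable_on_empty)

lemma integral_less_length:
  fixes h :: "real \<Rightarrow> real"
  assumes h: "h integrable_on {a..b}" and le: "\<And>x. x \<in> {a..b} \<Longrightarrow> h x \<le> 1"
    and uw: "a \<le> u" "u < w" "w \<le> b" and low: "\<And>x. x \<in> {u..<w} \<Longrightarrow> h x = - 1"
  shows "integral {a..b} h < b - a"
proof -
  have int: "h integrable_on {x..y}" if "a \<le> x" "y \<le> b" for x y
    using integrable_subinterval_real[OF h] that by auto
  have le1: "integral {x..y} h \<le> y - x" if "a \<le> x" "x \<le> y" "y \<le> b" for x y
    using integral_le[OF int integrable_const_ivl, of x y 1] that le by auto
  have "integral {u..w} h = integral {u..w} (\<lambda>_. - 1)"
    using low by (intro integral_spike[of "{w}"]) auto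
  then have "integral {u..w} h = - (w - u)" using uw by simp
  moreover have "integral {a..b} h = integral {a..u} h + integral {u..w} h + integral {w..b} h"
    using uw Henstock_Kurzweil_Integration.integral_combine[where f = h and a = a and c = u and b = w]
      Henstock_Kurzweil_Integration.integral_combine[where f = h and a = a and c = w and b = b] int by auto
  ultimately show ?thesis using le1[of a u] le1[of w b] uw by simp
qed

lemma right_constant:
  fixes g :: "real \<Rightarrow> nat"
  assumes "(g \<longlongrightarrow> g u) (at_right u)" "u < t"
  shows "\<exists>w. u < w \<and> w \<le> t \<and> (\<forall>x\<in>{u..<w}. g x = g u)"
proof -
  have "\<forall>\<^sub>F x in at_right u. g x = g u"
    using assms(1) by (simp add: tendsto_discrete)
  then obtain b where b: "b > u" "\<And>y. u < y \<Longrightarrow> y < b \<Longrightarrow> g y = g u"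
    by (auto simp: eventually_at_right[OF assms(2)])
  have const: "g x = g u" if "x \<in> {u..<min b t}" for x
    using b(2)[of x] that by (cases "x = u") auto
  show ?thesis
  proof (intro exI conjI ballI)
    show "u < min b t" "min b t \<le> t" using b(1) assms(2) by simp_all
  qed (rule const)
qed

text \<open>
  If the parity of \<open>g\<close> differs at \<open>u\<close> from that at \<open>s\<close>, then by right continuity both signs persist
  on intervals of positive length, and the integral stays strictly below the length of \<open>{s..t}\<close>
  in absolute value. The endpoint \<open>t\<close> has to be excluded: a jump at \<open>t\<close> is invisible to the integral.
\<close>
lemma parity_integral:
  fixes g :: "real \<Rightarrow> nat"
  assumes mono: "mono_on {s..t} g" and right: "\<And>u. u \<in> {s..<t} \<Longrightarrow> (g \<longlongrightarrow> g u) (at_right u)" and "s < t"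
  defines "I \<equiv> integral {s..t} (\<lambda>x. (- 1) ^ g x :: real)"
  shows parity_integral_no_jump: "g t = g s \<Longrightarrow> \<bar>I\<bar> = t - s"
    and parity_integral_extreme: "\<bar>I\<bar> \<ge> t - s \<Longrightarrow> u \<in> {s..<t} \<Longrightarrow> even (g u - g s)"
proof -
  define p where "p x = ((- 1) ^ g x :: real)" for x
  have I: "I = integral {s..t} p" by (simp add: I_def p_def[abs_def])
  have int: "p integrable_on {s..t}" using parity_integrable[OF mono] by (simp add: p_def[abs_def])
  have p_cases: "p x = 1 \<or> p x = - 1" for x unfolding p_def by (cases "even (g x)") auto
  have g_mono: "g x \<le> g y" if "s \<le> x" "x \<le> y" "y \<le> t" for x y
    using mono_onD[OF mono, of x y] that by auto
  show "\<bar>I\<bar> = t - s" if "g t = g s"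
  proof -
    have const: "p x = p s" if "x \<in> {s..t}" for x
    proof -
      have "g s \<le> g x" "g x \<le> g t" using g_mono[of s x] g_mono[of x t] that by auto
      then have "g x = g s" using \<open>g t = g s\<close> by simp
      then show ?thesis unfolding p_def by (rule arg_cong)
    qed
    have "I = integral {s..t} (\<lambda>_. p s)"
      unfolding I by (rule integral_cong) (rule const)
    then have "I = (t - s) * p s" using \<open>s < t\<close> by simp
    then show ?thesis using p_cases[of s] \<open>s < t\<close> by (elim disjE) simp_all
  qed
  show "even (g u - g s)" if large: "\<bar>I\<bar> \<ge> t - s" and u: "u \<in> {s..<t}"
  proof (rule ccontr)
    assume odd: "odd (g u - g s)"
    have u': "s \<le> u" "u < t" using u by auto
    have "g s \<le> g u" using g_mono[of s u] u' by auto
    then have pu: "p u = - p s" unfolding p_def using odd by (auto simp: minus_one_power_iff even_diff_nat)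
    have right_s: "(g \<longlongrightarrow> g s) (at_right s)" and right_u: "(g \<longlongrightarrow> g u) (at_right u)"
      using u' \<open>s < t\<close> by (simp_all add: right)
    have const: "\<exists>w. x < w \<and> w \<le> t \<and> (\<forall>y\<in>{x..<w}. p y = p x)" if right_x: "(g \<longlongrightarrow> g x) (at_right x)" "x < t" for x
    proof -
      obtain w where w: "x < w \<and> w \<le> t \<and> (\<forall>y\<in>{x..<w}. g y = g x)"
        using right_constant[OF right_x] by (rule exE)
      have "p y = p x" if "y \<in> {x..<w}" for y
        unfolding p_def using w[THEN conjunct2, THEN conjunct2, THEN bspec, OF that] by (rule arg_cong)
      then have "\<forall>y\<in>{x..<w}. p y = p x" by (rule ballI)
      with w[THEN conjunct1] w[THEN conjunct2, THEN conjunct1] show ?thesis by (intro exI[of _ w] conjI)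
    qed
    obtain w1 where w1: "s < w1" "w1 \<le> t" "\<forall>y\<in>{s..<w1}. p y = p s"
      using const[OF right_s \<open>s < t\<close>] by (elim exE conjE)
    obtain w2 where w2: "u < w2" "w2 \<le> t" "\<forall>y\<in>{u..<w2}. p y = p u"
      using const[OF right_u u'(2)] by (elim exE conjE)
    have sq: "p s * p s = 1" using p_cases[of s] by (elim disjE) simp_all
    have le1: "p s * p x \<le> 1" "- p s * p x \<le> 1" for x
      using p_cases[of s] p_cases[of x] by (elim disjE; simp)+
    have *: "integral {s..t} (\<lambda>x. p s * p x) < t - s"
    proof (rule integral_less_length[of _ _ _ u w2])
      show "(\<lambda>x. p s * p x) integrable_on {s..t}" by (rule integrable_on_mult_right[OF int])
      show "p s * p x = - 1" if "x \<in> {u..<w2}" for x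
        unfolding bspec[OF w2(3) that] pu using sq by simp
    qed (use le1 u' w2(1,2) in \<open>simp_all\<close>)
    have **: "integral {s..t} (\<lambda>x. - p s * p x) < t - s"
    proof (rule integral_less_length[of _ _ _ s w1])
      show "(\<lambda>x. - p s * p x) integrable_on {s..t}" by (rule integrable_on_mult_right[OF int])
      show "- p s * p x = - 1" if "x \<in> {s..<w1}" for x
        unfolding bspec[OF w1(3) that] using sq by simp
    qed (use le1 \<open>s < t\<close> w1(1,2) in \<open>simp_all\<close>)
    have "\<bar>p s * I\<bar> < t - s" using * ** by (simp add: I)
    moreover have "\<bar>p s\<bar> = 1" using p_cases[of s] by (elim disjE) simp_all
    ultimately show False using large by (simp add: abs_mult)
  qed
qed

text \<open>
  Divide \<open>{s..t}\<close> into \<open>m\<close> equal parts. If the parity is constant before \<open>t\<close> although the process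
  increases, then it increases by at least \<open>2\<close> on one of the parts or by at least \<open>1\<close> on the last
  one. The probability of this is of order \<open>m * (1 / m)\<^sup>2 + 1 / m\<close>, hence the event is null.
\<close>
lemma AE_no_cancelling_jumps:
  assumes N: "inhom_poisson_process M T lam N" and st: "0 \<le> s" "s < t" "t \<le> T"
    and const: "\<And>u w. s \<le> u \<Longrightarrow> u \<le> w \<Longrightarrow> w \<le> t \<Longrightarrow> integral {u..w} lam = l * (w - u)" and "l > 0"
  shows "AE \<omega> in M. (\<forall>u\<in>{s..<t}. even (N u \<omega> - N s \<omega>)) \<longrightarrow> N t \<omega> = N s \<omega>"
proof -
  interpret prob_space M using N by (simp add: inhom_poisson_process_def)
  have [measurable]: "N u \<in> measurable M (count_space UNIV)" if "0 \<le> u" "u \<le> T" for u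
    using N that by (auto simp: inhom_poisson_process_def)
  have mono: "N u \<omega> \<le> N w \<omega>" if "0 \<le> u" "u \<le> w" "w \<le> T" "\<omega> \<in> space M" for u w \<omega>
    using N that by (auto simp: inhom_poisson_process_def mono_on_def)
  define L where "L = l * (t - s)"
  define p where "p m j = s + real j * (t - s) / real m" for m j
  define E where "E m = (\<Union>j<m. {\<omega>\<in>space M. 2 \<le> N (p m (Suc j)) \<omega> - N (p m j) \<omega>})
     \<union> {\<omega>\<in>space M. 1 \<le> N t \<omega> - N (p m (m - 1)) \<omega>}" for m
  have p: "p m 0 = s" "m > 0 \<Longrightarrow> p m m = t" "\<And>i j. i \<le> j \<Longrightarrow> p m i \<le> p m j"
      "\<And>j. m > 0 \<Longrightarrow> p m (Suc j) - p m j = (t - s) / m" for m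
    using st by (auto simp: p_def intro!: divide_right_mono mult_right_mono) (simp add: field_simps)
  have p_in: "s \<le> p m j" "p m j \<le> t" if "m > 0" "j \<le> m" for m j
    using p(3)[of 0 j m] p(3)[of j m m] p(1)[of m] p(2)[of m] that by auto
  have sets: "{\<omega>\<in>space M. 2 \<le> N (p m (Suc j)) \<omega> - N (p m j) \<omega>} \<in> events"
     "{\<omega>\<in>space M. 1 \<le> N t \<omega> - N (p m (m - 1)) \<omega>} \<in> events" if "m > 0" "j < m" for m j
  proof -
    have [measurable]: "N (p m (Suc j)) \<in> measurable M (count_space UNIV)" "N (p m j) \<in> measurable M (count_space UNIV)"
       "N (p m (m - 1)) \<in> measurable M (count_space UNIV)" "N t \<in> measurable M (count_space UNIV)"
      using N st p_in[OF that(1), of j] p_in[OF that(1), of "Suc j"] p_in[OF that(1), of "m - 1"] that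
      by (auto simp: inhom_poisson_process_def)
    show "{\<omega>\<in>space M. 2 \<le> N (p m (Suc j)) \<omega> - N (p m j) \<omega>} \<in> events"
     "{\<omega>\<in>space M. 1 \<le> N t \<omega> - N (p m (m - 1)) \<omega>} \<in> events" by measurable
  qed
  have E_sets: "E m \<in> events" if "m > 0" for m
    unfolding E_def using sets[OF that] that by (intro sets.Un sets.finite_UN) auto
  have E_le: "prob (E m) \<le> (L\<^sup>2 + L) / m" if "m > 0" for m
  proof -
    have "prob (E m) \<le> prob (\<Union>j<m. {\<omega>\<in>space M. 2 \<le> N (p m (Suc j)) \<omega> - N (p m j) \<omega>})
       + \<P>(\<omega> in M. 1 \<le> N t \<omega> - N (p m (m - 1)) \<omega>)"
      unfolding E_def using sets[OF that] that by (intro measure_Un_le sets.finite_UN) auto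
    also have "prob (\<Union>j<m. {\<omega>\<in>space M. 2 \<le> N (p m (Suc j)) \<omega> - N (p m j) \<omega>})
        \<le> (\<Sum>j<m. \<P>(\<omega> in M. 2 \<le> N (p m (Suc j)) \<omega> - N (p m j) \<omega>))"
      using sets[OF that] by (intro measure_UNION_le) auto
    also have "\<dots> \<le> (\<Sum>j<m. (L / m)\<^sup>2)"
    proof (intro sum_mono)
      fix j assume j: "j \<in> {..<m}"
      have "integral {p m j..p m (Suc j)} lam = l * (p m (Suc j) - p m j)"
        using p_in[OF that, of j] p_in[OF that, of "Suc j"] p(3)[of j "Suc j" m] j by (intro const) auto
      then have "integral {p m j..p m (Suc j)} lam = L / m" using p(4)[OF that] by (simp add: L_def)
      from poisson_increment_ge_2[OF N _ _ _ this]
      show "\<P>(\<omega> in M. 2 \<le> N (p m (Suc j)) \<omega> - N (p m j) \<omega>) \<le> (L / m)\<^sup>2"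
        using p_in[OF that, of j] p_in[OF that, of "Suc j"] p(3)[of j "Suc j" m] j st \<open>l > 0\<close> by (auto simp: L_def)
    qed
    also have "\<dots> = L\<^sup>2 / m" using that by (simp add: power2_eq_square field_simps)
    also have "\<P>(\<omega> in M. 1 \<le> N t \<omega> - N (p m (m - 1)) \<omega>) \<le> L / m"
    proof -
      have "integral {p m (m - 1)..t} lam = l * (t - p m (m - 1))"
        using p_in[OF that, of "m - 1"] that by (intro const) auto
      also have "\<dots> = L / m" using p(4)[OF that, of "m - 1"] p(2)[OF that] that by (simp add: L_def)
      finally have "integral {p m (m - 1)..t} lam = L / m" .
      from poisson_increment_pos[OF N _ _ _ this] show ?thesis
        using p_in[OF that, of "m - 1"] that st \<open>l > 0\<close>
        by (auto simp: L_def)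
    qed
    finally show ?thesis by (simp add: add_divide_distrib)
  qed
  define F where "F = (\<Inter>m\<in>{0<..}. E m)"
  have F_sets: "F \<in> events" unfolding F_def using E_sets by (intro sets.countable_INT') auto
  have "prob F \<le> 0"
  proof (rule LIMSEQ_le_const)
    show "(\<lambda>m. (L\<^sup>2 + L) / real m) \<longlonglongrightarrow> 0" by (rule lim_const_over_n)
    have "prob F \<le> (L\<^sup>2 + L) / m" if "m > 0" for m :: nat
    proof -
      have "F \<subseteq> E m" unfolding F_def using that by (intro INT_lower) auto
      then have "prob F \<le> prob (E m)" using E_sets[OF that] by (rule finite_measure_mono)
      then show ?thesis using E_le[OF that] by linarith
    qed
    then show "\<exists>N. \<forall>m\<ge>N. prob F \<le> (L\<^sup>2 + L) / real m" by (intro exI[of _ 1]) auto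
  qed
  then have "prob F = 0" using measure_nonneg[of M F] by linarith
  then have "F \<in> null_sets M" using F_sets by (simp add: emeasure_eq_measure null_sets_def)
  then show ?thesis
  proof (rule AE_I')
    show "{\<omega>\<in>space M. \<not> ((\<forall>u\<in>{s..<t}. even (N u \<omega> - N s \<omega>)) \<longrightarrow> N t \<omega> = N s \<omega>)} \<subseteq> F"
      unfolding F_def
    proof (intro subsetI INT_I)
      fix \<omega> and m :: nat
      assume "\<omega> \<in> {\<omega>\<in>space M. \<not> ((\<forall>u\<in>{s..<t}. even (N u \<omega> - N s \<omega>)) \<longrightarrow> N t \<omega> = N s \<omega>)}" "m \<in> {0<..}"
      then have \<omega>: "\<omega> \<in> space M" and even: "\<forall>u\<in>{s..<t}. even (N u \<omega> - N s \<omega>)"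
        and neq: "N t \<omega> \<noteq> N s \<omega>" and m: "m > 0" by auto
      show "\<omega> \<in> E m"
      proof (rule ccontr)
        assume nE: "\<omega> \<notin> E m"
        have "N (p m j) \<omega> = N s \<omega>" if "j < m" for j
          using that
        proof (induction j)
          case 0 then show ?case by (simp add: p)
        next
          case (Suc j)
          have "(t - s) / real m > 0" using st m by simp
          then have "p m (Suc j) < t"
            using p_in(2)[OF m, of "Suc (Suc j)"] p(4)[OF m, of "Suc j"] Suc.prems by linarith
          then have "even (N (p m (Suc j)) \<omega> - N s \<omega>)" using even p_in[OF m, of "Suc j"] Suc.prems by auto
          moreover have "N (p m (Suc j)) \<omega> - N s \<omega> < 2"
          proof -
            have "\<not> 2 \<le> N (p m (Suc j)) \<omega> - N (p m j) \<omega>" using nE Suc.prems \<omega> by (auto simp: E_def)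
            then show ?thesis using Suc.IH Suc.prems by simp
          qed
          ultimately have "N (p m (Suc j)) \<omega> - N s \<omega> = 0"
            by presburger
          moreover have "N s \<omega> \<le> N (p m (Suc j)) \<omega>"
            using mono[of s "p m (Suc j)" \<omega>] p_in[OF m, of "Suc j"] Suc.prems st \<omega> by auto
          ultimately show ?case by simp
        qed
        then have "N (p m (m - 1)) \<omega> = N s \<omega>" using m by auto
        then have "\<not> 1 \<le> N t \<omega> - N s \<omega>" using nE \<omega> by (auto simp: E_def)
        then show False using neq mono[of s t \<omega>] st \<omega> by auto
      qed
    qed
  qed
qed

lemma AE_telegraph_switch_var:
  assumes driver: "telegraph_driver M T lam v V0 N" and "v > 0" "\<Delta> > 0"
    and i: "i \<ge> 1" "real i * \<Delta> \<le> T"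
    and const: "\<And>u w. real (i - 1) * \<Delta> \<le> u \<Longrightarrow> u \<le> w \<Longrightarrow> w \<le> real i * \<Delta> \<Longrightarrow> integral {u..w} lam = l * (w - u)"
    and "l > 0"
  shows "AE \<omega> in M. telegraph_switch_var v \<Delta> V0 N \<omega> i
     = (if N (real i * \<Delta>) \<omega> - N (real (i - 1) * \<Delta>) \<omega> = 0 then 0 else 1 / \<Delta>)"
proof -
  have N: "inhom_poisson_process M T lam N" using driver by (simp add: telegraph_driver_def)
  interpret prob_space M using N by (simp add: inhom_poisson_process_def)
  define s t where "s = real (i - 1) * \<Delta>" and "t = real i * \<Delta>"
  note st_def = s_def t_def
  have st: "0 \<le> s" "s < t" "t - s = \<Delta>" "t \<le> T"
    using i \<open>\<Delta> > 0\<close> by (auto simp: s_def t_def of_nat_diff algebra_simps)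
  have V0_meas[measurable]: "V0 \<in> borel_measurable M"
    and V0: "\<P>(\<omega> in M. V0 \<omega> = v) = 1 / 2" "\<P>(\<omega> in M. V0 \<omega> = - v) = 1 / 2"
    using driver by (auto simp: telegraph_driver_def)
  have "\<P>(\<omega> in M. \<bar>V0 \<omega>\<bar> = v) = prob ({\<omega>\<in>space M. V0 \<omega> = v} \<union> {\<omega>\<in>space M. V0 \<omega> = - v})"
    using \<open>v > 0\<close> by (intro arg_cong[where f = prob]) auto
  also have "\<dots> = \<P>(\<omega> in M. V0 \<omega> = v) + \<P>(\<omega> in M. V0 \<omega> = - v)"
    using \<open>v > 0\<close> by (intro finite_measure_Union) auto
  finally have "\<P>(\<omega> in M. \<bar>V0 \<omega>\<bar> = v) = 1" using V0 by simp
  then have "AE \<omega> in M. \<bar>V0 \<omega>\<bar> = v" by (subst (asm) prob_Collect_eq_1) auto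
  moreover have "AE \<omega> in M. (\<forall>u\<in>{s..<t}. even (N u \<omega> - N s \<omega>)) \<longrightarrow> N t \<omega> = N s \<omega>"
    by (rule AE_no_cancelling_jumps[OF N st(1,2,4) const[folded st_def] \<open>l > 0\<close>])
  ultimately show ?thesis
    unfolding st_def[symmetric] using AE_space
  proof eventually_elim
    case (elim \<omega>)
    note V = elim(1) and jumps = elim(2) and \<omega> = elim(3)
    have mono: "mono_on {0..T} (\<lambda>t. N t \<omega>)"
      and right: "\<And>t. t \<in> {0..<T} \<Longrightarrow> ((\<lambda>s. N s \<omega>) \<longlongrightarrow> N t \<omega>) (at_right t)"
      using N \<omega> by (auto simp: inhom_poisson_process_def)
    have mono': "mono_on {a..b} (\<lambda>t. N t \<omega>)" if "0 \<le> a" "b \<le> T" for a b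
      by (rule mono_on_subset[OF mono]) (use that in auto)
    define I where "I = integral {s..t} (\<lambda>x. (- 1) ^ N x \<omega> :: real)"
    have "integral {0..s} (\<lambda>x. (- 1) ^ N x \<omega> :: real) + I = integral {0..t} (\<lambda>x. (- 1) ^ N x \<omega>)"
      unfolding I_def using st by (intro Henstock_Kurzweil_Integration.integral_combine parity_integrable mono') auto
    then have "integral {0..t} (\<lambda>x. (- 1) ^ N x \<omega> :: real) - integral {0..s} (\<lambda>x. (- 1) ^ N x \<omega>) = I"
      by linarith
    then have "telegraph_process V0 N t \<omega> - telegraph_process V0 N s \<omega> = V0 \<omega> * I"
      by (simp only: telegraph_process_def right_diff_distrib[symmetric])
    then have switch: "telegraph_switch_var v \<Delta> V0 N \<omega> i = (if v * \<bar>I\<bar> < v * \<Delta> then 1 / \<Delta> else 0)"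
      unfolding telegraph_switch_var_def switch_var_def st_def[symmetric] using V by (simp add: abs_mult)
    have prem: "mono_on {s..t} (\<lambda>t. N t \<omega>)" "\<And>u. u \<in> {s..<t} \<Longrightarrow> ((\<lambda>s. N s \<omega>) \<longlongrightarrow> N u \<omega>) (at_right u)"
      using st by (auto intro!: mono' right)
    have 1: "N t \<omega> = N s \<omega> \<Longrightarrow> \<bar>I\<bar> = \<Delta>"
      using parity_integral_no_jump[OF prem st(2)] st(3) by (simp add: I_def)
    have 2: "\<bar>I\<bar> \<ge> \<Delta> \<Longrightarrow> N t \<omega> = N s \<omega>"
      using parity_integral_extreme[OF prem st(2)] st(3) jumps by (simp add: I_def)
    have 3: "N s \<omega> \<le> N t \<omega>" using mono st by (auto simp: mono_on_def)
    show "telegraph_switch_var v \<Delta> V0 N \<omega> i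
     = (if N t \<omega> - N s \<omega> = 0 then 0 else 1 / \<Delta>)"
      unfolding switch using 1 2 3 \<open>v > 0\<close> by auto
  qed
qed

text \<open>
  An almost sure version of \<open>Y\<^sub>i\<close> that depends on the Poisson process only.
\<close>
definition switch_indicator :: "real \<Rightarrow> (real \<Rightarrow> 'a \<Rightarrow> nat) \<Rightarrow> nat \<Rightarrow> 'a \<Rightarrow> real" where
  "switch_indicator \<Delta> N i \<omega> = (if N (real i * \<Delta>) \<omega> - N (real (i - 1) * \<Delta>) \<omega> = 0 then 0 else 1 / \<Delta>)"

lemma switch_indicator_range: "\<Delta> > 0 \<Longrightarrow> 0 \<le> switch_indicator \<Delta> N i \<omega> \<and> switch_indicator \<Delta> N i \<omega> \<le> 1 / \<Delta>"
  by (simp add: switch_indicator_def)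

lemma switch_indicator_indep:
  assumes N: "inhom_poisson_process M (real n * \<Delta>) lam N" and "\<Delta> > 0"
  shows "prob_space.indep_vars M (\<lambda>_. borel) (switch_indicator \<Delta> N) {1..n}"
proof -
  interpret prob_space M using N by (simp add: inhom_poisson_process_def)
  let ?t = "\<lambda>i. real i * \<Delta>"
  have "mono_on {..n} ?t" "?t ` {..n} \<subseteq> {0..real n * \<Delta>}"
    using \<open>\<Delta> > 0\<close> by (auto simp: mono_on_def)
  then have incr: "indep_vars (\<lambda>_. count_space UNIV) (\<lambda>i \<omega>. N (?t (Suc i)) \<omega> - N (?t i) \<omega>) {..<n}"
    using N unfolding inhom_poisson_process_def by blast
  have image: "(\<lambda>i. i - 1) ` {1..n} = {..<n}"
  proof (intro set_eqI iffI)
    fix i assume "i \<in> {..<n}"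
    then have "i = Suc i - 1" "Suc i \<in> {1..n}" by auto
    then show "i \<in> (\<lambda>i. i - 1) ` {1..n}" by (rule image_eqI)
  qed auto
  have "indep_vars (\<lambda>_. count_space UNIV) (\<lambda>i \<omega>. N (?t (Suc (i - 1))) \<omega> - N (?t (i - 1)) \<omega>) {1..n}"
    by (rule indep_vars_reindex[where X = "\<lambda>i \<omega>. N (?t (Suc i)) \<omega> - N (?t i) \<omega>" and M' = "\<lambda>_. count_space UNIV"])
       (use incr image in \<open>auto simp: inj_on_def\<close>)
  then have "indep_vars (\<lambda>_. borel) (\<lambda>i \<omega>. if N (?t (Suc (i - 1))) \<omega> - N (?t (i - 1)) \<omega> = 0 then 0 else 1 / \<Delta>) {1..n}"
    by (rule indep_vars_compose2[where Y = "\<lambda>_ d. if d = 0 then 0 else 1 / \<Delta>"]) simp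
  then show ?thesis
    by (rule iffD1[OF indep_vars_cong, rotated -1]) (auto simp: switch_indicator_def fun_eq_iff)
qed

lemma switch_indicator_moments:
  assumes N: "inhom_poisson_process M T lam N" and "\<Delta> > 0" and i: "i \<ge> 1" "real i * \<Delta> \<le> T"
    and I: "integral {real (i - 1) * \<Delta>..real i * \<Delta>} lam = l * \<Delta>" and "l > 0"
  shows switch_indicator_square_integrable: "integrable M (\<lambda>\<omega>. (switch_indicator \<Delta> N i \<omega>)\<^sup>2)"
    and switch_indicator_mean: "integral\<^sup>L M (switch_indicator \<Delta> N i) = switch_mean \<Delta> l"
    and switch_indicator_variance: "prob_space.variance M (switch_indicator \<Delta> N i)
      = switch_mean \<Delta> l * (1 / \<Delta> - switch_mean \<Delta> l)"
proof -
  interpret prob_space M using N by (simp add: inhom_poisson_process_def)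
  define s t where "s = real (i - 1) * \<Delta>" and "t = real i * \<Delta>"
  have st: "0 \<le> s" "s \<le> t" "t \<le> T" using i \<open>\<Delta> > 0\<close> by (auto simp: s_def t_def of_nat_diff algebra_simps)
  have [measurable]: "N s \<in> measurable M (count_space UNIV)" "N t \<in> measurable M (count_space UNIV)"
    using N st by (auto simp: inhom_poisson_process_def)
  define Z where "Z = {\<omega>\<in>space M. \<not> N t \<omega> - N s \<omega> = 0}"
  have Z: "Z \<in> events" unfolding Z_def by measurable
  have "\<P>(\<omega> in M. N t \<omega> - N s \<omega> = 0) = exp (- (l * \<Delta>))"
    using poisson_increment_zero[OF N st I[folded s_def t_def]] \<open>l > 0\<close> \<open>\<Delta> > 0\<close> by simp
  then have "prob Z = 1 - exp (- (l * \<Delta>))" unfolding Z_def by (subst prob_neg) measurable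
  then have P: "prob Z / \<Delta> = switch_mean \<Delta> l" by (simp add: switch_mean_def)
  have y: "switch_indicator \<Delta> N i \<omega> = indicator Z \<omega> * (1 / \<Delta>)" if "\<omega> \<in> space M" for \<omega>
    using that by (simp add: switch_indicator_def Z_def indicator_def s_def t_def)
  have int: "integrable M (indicator Z :: _ \<Rightarrow> real)" using Z by (simp add: emeasure_eq_measure)
  have y2: "(switch_indicator \<Delta> N i \<omega>)\<^sup>2 = indicator Z \<omega> * (1 / \<Delta>)\<^sup>2" if "\<omega> \<in> space M" for \<omega>
    using y[OF that] by (simp add: power_mult_distrib indicator_def power2_eq_square)
  show sq: "integrable M (\<lambda>\<omega>. (switch_indicator \<Delta> N i \<omega>)\<^sup>2)"
    using int by (simp add: y2 cong: Bochner_Integration.integrable_cong)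
  have int_y: "integrable M (switch_indicator \<Delta> N i)"
    using int by (simp add: y cong: Bochner_Integration.integrable_cong)
  show mean: "integral\<^sup>L M (switch_indicator \<Delta> N i) = switch_mean \<Delta> l"
    using Z P by (simp add: y cong: Bochner_Integration.integral_cong)
  have "integral\<^sup>L M (\<lambda>\<omega>. (switch_indicator \<Delta> N i \<omega>)\<^sup>2) = prob Z * (1 / \<Delta>)\<^sup>2"
    using Z by (simp add: y2 cong: Bochner_Integration.integral_cong)
  also have "\<dots> = switch_mean \<Delta> l * (1 / \<Delta>)" by (simp add: P[symmetric] power2_eq_square)
  finally show "variance (switch_indicator \<Delta> N i) = switch_mean \<Delta> l * (1 / \<Delta> - switch_mean \<Delta> l)"
    using variance_eq[OF int_y sq] by (simp add: mean power2_eq_square right_diff_distrib)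
qed

text \<open>
  Since the intensity changes at an observation time, it is constant on each observation interval, up
  to the left endpoint.
\<close>
lemma change_intensity_interval_integral:
  assumes "\<Delta> > 0" and u: "real (i - 1) * \<Delta> \<le> u" "u \<le> w" "w \<le> real i * \<Delta>" and "i \<ge> 1"
  shows "integral {u..w} (change_intensity l1 l2 (real k * \<Delta>)) = (if i \<le> k then l1 else l2) * (w - u)"
proof (cases "i \<le> k")
  case True
  then have "real i * \<Delta> \<le> real k * \<Delta>" using \<open>\<Delta> > 0\<close> by (intro mult_right_mono) auto
  then have "w \<le> real k * \<Delta>" using u(3) by linarith
  then show ?thesis using True u by (subst integral_change_intensity) auto
next
  case False
  then have "real k * \<Delta> \<le> real (i - 1) * \<Delta>" using \<open>\<Delta> > 0\<close> by (intro mult_right_mono) auto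
  then have k: "real k * \<Delta> \<le> u" using u(1) by simp
  show ?thesis
  proof (cases "w \<le> real k * \<Delta>")
    case True
    then have "u = w" using k u by simp
    then show ?thesis by simp
  next
    case w: False
    then show ?thesis using False k u by (subst integral_change_intensity) auto
  qed
qed

section \<open>Asymptotic normality of the intensity estimates\<close>

theorem theorem4p2:
  fixes v \<tau> lam1 :: real and lam2 \<Delta> :: "nat \<Rightarrow> real"
    and M :: "nat \<Rightarrow> 'a measure"
    and V0 :: "nat \<Rightarrow> 'a \<Rightarrow> real" and N :: "nat \<Rightarrow> real \<Rightarrow> 'a \<Rightarrow> nat"
    and khat :: "nat \<Rightarrow> 'a \<Rightarrow> nat" and lamhat1 lamhat2 :: "nat \<Rightarrow> 'a \<Rightarrow> real"
  assumes "v > 0" and "0 < \<tau>" "\<tau> < 1" and "lam1 > 0"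
    and "\<And>n. n \<ge> 2 \<Longrightarrow> lam2 n > 0" and "\<And>n. n \<ge> 2 \<Longrightarrow> \<Delta> n > 0"
    and driver: "\<And>n. n \<ge> 2 \<Longrightarrow>
      telegraph_driver (M n) (real n * \<Delta> n)
        (change_intensity lam1 (lam2 n) (real (change_index \<tau> n) * \<Delta> n)) v (V0 n) (N n)"
    and khat_meas: "\<And>n. n \<ge> 2 \<Longrightarrow> khat n \<in> measurable (M n) (count_space UNIV)"
    and khat: "\<And>n \<omega>. n \<ge> 2 \<Longrightarrow> \<omega> \<in> space (M n) \<Longrightarrow>
      is_change_point_estimate n (telegraph_switch_var v (\<Delta> n) (V0 n) (N n) \<omega>) (khat n \<omega>)"
    and lamhat_meas: "\<And>n. n \<ge> 2 \<Longrightarrow> lamhat1 n \<in> borel_measurable (M n)"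
      "\<And>n. n \<ge> 2 \<Longrightarrow> lamhat2 n \<in> borel_measurable (M n)"
    and lamhat1: "\<And>n \<omega>. n \<ge> 2 \<Longrightarrow> \<omega> \<in> space (M n) \<Longrightarrow>
      is_intensity_estimate (\<Delta> n) (mean_first (telegraph_switch_var v (\<Delta> n) (V0 n) (N n) \<omega>) (khat n \<omega>)) (lamhat1 n \<omega>)"
    and lamhat2: "\<And>n \<omega>. n \<ge> 2 \<Longrightarrow> \<omega> \<in> space (M n) \<Longrightarrow>
      is_intensity_estimate (\<Delta> n) (mean_last n (telegraph_switch_var v (\<Delta> n) (V0 n) (N n) \<omega>) (khat n \<omega>)) (lamhat2 n \<omega>)"
    and "\<Delta> \<longlonglongrightarrow> 0"
    and "filterlim (\<lambda>n. real n * \<Delta> n) at_top sequentially"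
    and "(\<lambda>n. lam2 n - lam1) \<longlonglongrightarrow> 0"
    and "filterlim (\<lambda>n. sqrt (real n * \<Delta> n) * (switch_mean (\<Delta> n) (lam2 n) - switch_mean (\<Delta> n) lam1)
                       / sqrt (ln (real n))) at_top sequentially"
  shows "converges_in_distribution M
           (\<lambda>n \<omega>. sqrt (real n * \<Delta> n) *\<^sub>R
              (vector [lamhat1 n \<omega> - lam1, lamhat2 n \<omega> - lam2 n] :: real ^ 2))
           (multivariate_normal 0
              (vector [vector [inverse \<tau> * lam1, 0],
                       vector [0, inverse (1 - \<tau>) * lim lam2]]))"
proof -
  note \<tau> = assms(2,3) and lam1_pos = assms(4) and lam2_pos = assms(5) and \<Delta>_pos = assms(6)
    and \<Delta>0 = assms(14) and T_lim = assms(15) and lam_diff = assms(16) and signal = assms(17)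
  define k0 where "k0 n = change_index \<tau> n" for n
  define q where "q n = sqrt (real n * \<Delta> n)" for n
  define a where "a n = switch_mean (\<Delta> n) lam1" for n
  define b where "b n = switch_mean (\<Delta> n) (lam2 n)" for n
  define Y where "Y n = switch_indicator (\<Delta> n) (N n)" for n
  define \<kappa> where "\<kappa> = min \<tau> (1 - \<tau>) / 2"
  define \<sigma>1 \<sigma>2 where "\<sigma>1 = sqrt (inverse \<tau> * lam1)" and "\<sigma>2 = sqrt (inverse (1 - \<tau>) * lam1)"
  have \<kappa>: "0 < \<kappa>" "\<kappa> \<le> \<tau> / 2" "\<kappa> \<le> (1 - \<tau>) / 2" using \<tau> by (auto simp: \<kappa>_def)
  have lam2_lim: "lam2 \<longlonglongrightarrow> lam1" using tendsto_add[OF lam_diff tendsto_const[of lam1]] by simp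
  have lim_lam2: "lim lam2 = lam1" using lam2_lim by (rule limI)

  have k0_bounds: "real n * \<tau> - 1 \<le> real (k0 n)" "real (k0 n) \<le> real n * \<tau>" for n
  proof -
    have "0 \<le> real n * \<tau>" using \<tau> by simp
    then have "real (k0 n) = of_int \<lfloor>real n * \<tau>\<rfloor>" by (simp add: k0_def change_index_def)
    then show "real n * \<tau> - 1 \<le> real (k0 n)" "real (k0 n) \<le> real n * \<tau>" by linarith+
  qed
  have inv_n: "(\<lambda>n. 1 / real n) \<longlonglongrightarrow> 0" by (rule lim_1_over_n)
  have k0_ratio: "(\<lambda>n. real (k0 n) / real n) \<longlonglongrightarrow> \<tau>"
  proof (rule tendsto_sandwich[OF _ _ _ tendsto_const])
    have "(\<lambda>n. \<tau> - 1 / real n) \<longlonglongrightarrow> \<tau> - 0" by (intro tendsto_intros inv_n)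
    then show "(\<lambda>n. \<tau> - 1 / real n) \<longlonglongrightarrow> \<tau>" by simp
    show "\<forall>\<^sub>F n in sequentially. \<tau> - 1 / real n \<le> real (k0 n) / real n"
      using eventually_gt_at_top[of 0]
    proof eventually_elim
      case (elim n)
      have "(real n * \<tau> - 1) / real n \<le> real (k0 n) / real n" using k0_bounds(1)[of n] by (intro divide_right_mono) auto
      then show ?case using elim by (simp add: diff_divide_distrib)
    qed
    show "\<forall>\<^sub>F n in sequentially. real (k0 n) / real n \<le> \<tau>"
      using eventually_gt_at_top[of 0]
    proof eventually_elim
      case (elim n) then show ?case using k0_bounds(2)[of n] by (simp add: pos_divide_le_eq mult.commute)
    qed
  qed
  have q_lim: "filterlim q at_top sequentially"
    unfolding q_def[abs_def] by (rule filterlim_compose[OF sqrt_at_top T_lim])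
  have pos: "0 < q n" "(q n)\<^sup>2 = real n * \<Delta> n" if "n \<ge> 2" for n
    using that \<Delta>_pos[OF that] by (auto simp: q_def)
  have mean_lim: "(\<lambda>n. switch_mean (\<Delta> n) (l n)) \<longlonglongrightarrow> lam1"
    if l: "l \<longlonglongrightarrow> lam1" "\<And>n. n \<ge> 2 \<Longrightarrow> l n > 0" for l
  proof (rule tendsto_sandwich[where f = "\<lambda>n. l n - (l n)\<^sup>2 * \<Delta> n" and h = l])
    show "l \<longlonglongrightarrow> lam1" by (rule l)
    have "(\<lambda>n. l n - (l n)\<^sup>2 * \<Delta> n) \<longlonglongrightarrow> lam1 - lam1\<^sup>2 * 0" by (intro tendsto_intros l \<Delta>0)
    then show "(\<lambda>n. l n - (l n)\<^sup>2 * \<Delta> n) \<longlonglongrightarrow> lam1" by simp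
    show "\<forall>\<^sub>F n in sequentially. l n - (l n)\<^sup>2 * \<Delta> n \<le> switch_mean (\<Delta> n) (l n)"
      using eventually_ge_at_top[of 2]
      by eventually_elim (intro switch_mean_bounds(4) \<Delta>_pos l(2))
    show "\<forall>\<^sub>F n in sequentially. switch_mean (\<Delta> n) (l n) \<le> l n"
      using eventually_ge_at_top[of 2]
      by eventually_elim (intro switch_mean_bounds(2) \<Delta>_pos l(2))
  qed
  have a_lim: "a \<longlonglongrightarrow> lam1" unfolding a_def[abs_def] by (rule mean_lim) (auto simp: lam1_pos)
  have b_lim: "b \<longlonglongrightarrow> lam1" unfolding b_def[abs_def] by (rule mean_lim) (auto simp: lam2_lim lam2_pos)

  have ln_lim: "filterlim (\<lambda>n. sqrt (ln (real n))) at_top sequentially"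
    by (intro filterlim_compose[OF sqrt_at_top] filterlim_compose[OF ln_at_top] filterlim_real_sequentially)
  \<comment> \<open>The signal is \<open>R n * sqrt (ln n)\<close>, so the logarithmic term of the error bound is \<open>1 / (R n)\<^sup>2\<close>.\<close>
  define R where "R n = q n * (b n - a n) / sqrt (ln (real n))" for n
  have R: "filterlim R at_top sequentially" using signal by (simp add: R_def[abs_def] q_def a_def b_def)
  have large: "\<forall>\<^sub>F n in sequentially. R n > 0" using R by (simp add: filterlim_at_top_dense)
  have qba: "\<forall>\<^sub>F n in sequentially. q n * \<bar>b n - a n\<bar> = R n * sqrt (ln (real n))"
    using large eventually_ge_at_top[of 2]
  proof eventually_elim
    case (elim n)
    have s: "sqrt (ln (real n)) > 0" using elim(2) by simp
    then have "q n * (b n - a n) > 0" using elim(1) by (simp add: R_def zero_less_divide_iff)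
    then have "b n - a n > 0" using pos(1)[OF elim(2)] by (simp add: zero_less_mult_iff)
    then show ?case using s by (simp add: R_def)
  qed
  have signal': "filterlim (\<lambda>n. q n * \<bar>b n - a n\<bar>) at_top sequentially"
    using filterlim_at_top_mult_at_top[OF R ln_lim] qba by (subst filterlim_cong[OF refl refl]) auto
  have log_signal: "(\<lambda>n. ln (real n) / (q n * \<bar>b n - a n\<bar>)\<^sup>2) \<longlonglongrightarrow> 0"
  proof (rule Lim_transform_eventually)
    show "(\<lambda>n. 1 / (R n)\<^sup>2) \<longlonglongrightarrow> 0"
      by (intro tendsto_divide_0[OF tendsto_const] filterlim_at_top_imp_at_infinity filterlim_pow_at_top R) simp
    show "\<forall>\<^sub>F n in sequentially. 1 / (R n)\<^sup>2 = ln (real n) / (q n * \<bar>b n - a n\<bar>)\<^sup>2"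
      using qba eventually_ge_at_top[of 2]
    proof eventually_elim
      case (elim n)
      then have "ln (real n) > 0" by simp
      then show ?case by (simp add: elim(1) power_mult_distrib)
    qed
  qed

  \<comment> \<open>The bound on \<open>1 / real n\<close> absorbs the rounding in the change index.\<close>
  have "\<forall>\<^sub>F n in sequentially. 2 \<le> n \<and> 1 / real n < \<tau> / 2 \<and> lam2 n < lam1 + 1"
    using eventually_ge_at_top[of 2] order_tendstoD(2)[OF inv_n, of "\<tau> / 2"] order_tendstoD(2)[OF lam2_lim, of "lam1 + 1"] \<tau>
    by (auto intro!: eventually_conj)
  then obtain n0 where n0: "\<And>n. n \<ge> n0 \<Longrightarrow> 2 \<le> n \<and> 1 / real n < \<tau> / 2 \<and> lam2 n < lam1 + 1"
    unfolding eventually_sequentially by blast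
  have seg: "\<kappa> * real n \<le> real (k0 n)" "\<kappa> * real n \<le> real n - real (k0 n)" "1 \<le> k0 n" "k0 n < n" if "n \<ge> n0" for n
  proof -
    have n: "real n > 0" "1 < \<tau> / 2 * real n" using n0[OF that] by (auto simp: field_simps)
    have half: "\<tau> / 2 * real n + \<tau> / 2 * real n = real n * \<tau>" by simp
    have "\<kappa> * real n \<le> \<tau> / 2 * real n" using \<kappa> n by (intro mult_right_mono) auto
    then show 1: "\<kappa> * real n \<le> real (k0 n)" using k0_bounds(1)[of n] n(2) half by linarith
    have "\<kappa> * real n \<le> (1 - \<tau>) * real n" using \<kappa> \<tau> n by (intro mult_right_mono) auto
    moreover have "(1 - \<tau>) * real n = real n - real n * \<tau>" by (simp add: left_diff_distrib)
    ultimately show 2: "\<kappa> * real n \<le> real n - real (k0 n)" using k0_bounds(2)[of n] by linarith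
    have "\<kappa> * real n > 0" using \<kappa> n by simp
    then have "real (k0 n) > 0" "real (k0 n) < real n" using 1 2 by linarith+
    then show "1 \<le> k0 n" "k0 n < n" by simp_all
  qed

  have N: "inhom_poisson_process (M n) (real n * \<Delta> n) (change_intensity lam1 (lam2 n) (real (k0 n) * \<Delta> n)) (N n)"
    if "n \<ge> 2" for n using driver[OF that] by (simp add: telegraph_driver_def k0_def)
  define l where "l n i = (if i \<le> k0 n then lam1 else lam2 n)" for n i
  have l_pos: "l n i > 0" if "n \<ge> 2" for n i using lam1_pos lam2_pos[OF that] by (simp add: l_def)
  have intensity: "integral {u..w} (change_intensity lam1 (lam2 n) (real (k0 n) * \<Delta> n)) = l n i * (w - u)"
    if "n \<ge> 2" "i \<ge> 1" "real (i - 1) * \<Delta> n \<le> u" "u \<le> w" "w \<le> real i * \<Delta> n" for n i u w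
    using change_intensity_interval_integral[OF \<Delta>_pos[OF that(1)] that(3,4,5,2)] by (simp add: l_def)
  have in_T: "real i * \<Delta> n \<le> real n * \<Delta> n" if "n \<ge> 2" "i \<le> n" for n i
    using \<Delta>_pos[OF that(1)] that(2) by (intro mult_right_mono) auto
  have obs: "AE \<omega> in M n. \<forall>i\<in>{1..n}. telegraph_switch_var v (\<Delta> n) (V0 n) (N n) \<omega> i = Y n i \<omega>" if "n \<ge> 2" for n
  proof (rule AE_finite_allI)
    fix i assume i: "i \<in> {1..n}"
    show "AE \<omega> in M n. telegraph_switch_var v (\<Delta> n) (V0 n) (N n) \<omega> i = Y n i \<omega>"
      unfolding Y_def switch_indicator_def
      by (rule AE_telegraph_switch_var[OF driver[OF that, folded k0_def] \<open>v > 0\<close> \<Delta>_pos[OF that] _ in_T[OF that] intensity[OF that] l_pos[OF that]])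
         (use i in auto)
  qed simp
  have moments: "integrable (M n) (\<lambda>\<omega>. (Y n i \<omega>)\<^sup>2)" "integral\<^sup>L (M n) (Y n i) = switch_mean (\<Delta> n) (l n i)"
    "prob_space.variance (M n) (Y n i) = switch_mean (\<Delta> n) (l n i) * (1 / \<Delta> n - switch_mean (\<Delta> n) (l n i))"
    if "n \<ge> 2" "i \<in> {1..n}" for n i
  proof -
    have i: "i \<ge> 1" "i \<le> n" using that(2) by auto
    have "integral {real (i - 1) * \<Delta> n..real i * \<Delta> n} (change_intensity lam1 (lam2 n) (real (k0 n) * \<Delta> n)) = l n i * \<Delta> n"
    proof -
      have "real i * \<Delta> n - real (i - 1) * \<Delta> n = \<Delta> n" using i(1) by (simp add: of_nat_diff left_diff_distrib)
      moreover have "real (i - 1) * \<Delta> n \<le> real i * \<Delta> n" using \<Delta>_pos[OF that(1)] by (intro mult_right_mono) auto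
      ultimately show ?thesis using intensity[OF that(1) i(1), of "real (i - 1) * \<Delta> n" "real i * \<Delta> n"] by simp
    qed
    note prem = N[OF that(1)] \<Delta>_pos[OF that(1)] i(1) in_T[OF that(1) i(2)] this l_pos[OF that(1)]
    show "integrable (M n) (\<lambda>\<omega>. (Y n i \<omega>)\<^sup>2)" "integral\<^sup>L (M n) (Y n i) = switch_mean (\<Delta> n) (l n i)"
      "prob_space.variance (M n) (Y n i) = switch_mean (\<Delta> n) (l n i) * (1 / \<Delta> n - switch_mean (\<Delta> n) (l n i))"
      unfolding Y_def
      by (rule switch_indicator_square_integrable[OF prem] switch_indicator_mean[OF prem] switch_indicator_variance[OF prem])+
  qed
  have sample: "change_point_sample (M n) n (k0 n) (Y n) (a n) (b n) ((2 * lam1 + 1) / \<Delta> n)" if "n \<ge> n0" for n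
  proof -
    have n2: "n \<ge> 2" using n0[OF that] by simp
    interpret prob_space "M n" using N[OF n2] by (simp add: inhom_poisson_process_def)
    show ?thesis
    proof
      show "indep_vars (\<lambda>_. borel) (Y n) {1..n}"
        unfolding Y_def by (rule switch_indicator_indep[OF N[OF n2] \<Delta>_pos[OF n2]])
      show "integrable (M n) (\<lambda>\<omega>. (Y n i \<omega>)\<^sup>2)" if "i \<in> {1..n}" for i by (rule moments(1)[OF n2 that])
      show "expectation (Y n i) = a n" if "i \<in> {1..k0 n}" for i
      proof -
        have "i \<in> {1..n}" using that seg(4)[OF \<open>n \<ge> n0\<close>] by auto
        then show ?thesis using moments(2)[OF n2, of i] that by (simp add: a_def l_def)
      qed
      show "expectation (Y n i) = b n" if "i \<in> {k0 n+1..n}" for i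
        using moments(2)[OF n2, of i] that by (simp add: b_def l_def)
      show "variance (Y n i) \<le> (2 * lam1 + 1) / \<Delta> n" if i: "i \<in> {1..n}" for i
      proof -
        let ?m = "switch_mean (\<Delta> n) (l n i)"
        have m: "0 < ?m" "?m \<le> l n i" using switch_mean_bounds[OF \<Delta>_pos[OF n2] l_pos[OF n2]] by auto
        have "?m * (1 / \<Delta> n - ?m) \<le> ?m * (1 / \<Delta> n)" using m by (intro mult_left_mono) auto
        also have "\<dots> \<le> (2 * lam1 + 1) * (1 / \<Delta> n)"
          using m \<Delta>_pos[OF n2] n0[OF \<open>n \<ge> n0\<close>] lam1_pos by (intro mult_right_mono) (auto simp: l_def split: if_splits)
        finally show ?thesis by (simp add: moments(3)[OF n2 i])
      qed
    qed (use seg[OF that] in auto)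
  qed

  \<comment> \<open>Dropping the first \<open>n0\<close> samples makes all conditions hold for every index.\<close>
  define sh where "sh n = n + n0" for n
  have sh: "sh n \<ge> n0" "sh n \<ge> 2" for n using n0[of "n + n0"] by (auto simp: sh_def)
  have shift: "(\<lambda>n. g (sh n)) \<longlonglongrightarrow> c" if "g \<longlonglongrightarrow> c" for g :: "nat \<Rightarrow> real" and c
    unfolding sh_def using that by (rule LIMSEQ_ignore_initial_segment)
  have sh_top: "filterlim sh at_top sequentially"
    unfolding sh_def[abs_def] by (rule filterlim_add_const_nat_at_top)
  have khat_range: "khat n \<omega> \<le> n" if "n \<ge> 2" "\<omega> \<in> space (M n)" for n \<omega>
    using khat[OF that] by (auto simp: is_change_point_estimate_def is_arg_min_def)
  interpret arr: change_point_array "\<lambda>n. M (sh n)" sh "\<lambda>n. k0 (sh n)" "\<lambda>n. Y (sh n)" "\<lambda>n. a (sh n)" "\<lambda>n. b (sh n)"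
    "\<lambda>n. (2 * lam1 + 1) / \<Delta> (sh n)" "\<lambda>n. q (sh n)" "\<lambda>n. khat (sh n)" \<kappa> "2 * lam1 + 1"
  proof (rule change_point_array.intro)
    show "AE \<omega> in M (sh n). is_change_point_estimate (sh n) (\<lambda>i. Y (sh n) i \<omega>) (khat (sh n) \<omega>)" for n
      using obs[OF sh(2)[of n]] AE_space
    proof eventually_elim
      case (elim \<omega>)
      show ?case by (rule change_point_estimate_cong[OF _ khat[OF sh(2) elim(2)]]) (use elim(1) in blast)
    qed
    show "(2 * lam1 + 1) / \<Delta> (sh n) * (q (sh n))\<^sup>2 \<le> (2 * lam1 + 1) * real (sh n)" for n
      using \<Delta>_pos[OF sh(2)[of n]] by (simp add: pos(2)[OF sh(2)])
    show "filterlim (\<lambda>n. q (sh n) * \<bar>b (sh n) - a (sh n)\<bar>) at_top sequentially"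
      by (rule filterlim_compose[OF signal' sh_top])
    show "(\<lambda>n. ln (real (sh n)) / (q (sh n) * \<bar>b (sh n) - a (sh n)\<bar>)\<^sup>2) \<longlonglongrightarrow> 0"
      by (rule shift[OF log_signal])
  qed (use sample seg sh \<kappa>(1) pos(1) khat_meas khat_range in auto)
  interpret rev: change_point_array "\<lambda>n. M (sh n)" sh "\<lambda>n. sh n - k0 (sh n)" "\<lambda>n i. Y (sh n) (Suc (sh n) - i)"
    "\<lambda>n. b (sh n)" "\<lambda>n. a (sh n)" "\<lambda>n. (2 * lam1 + 1) / \<Delta> (sh n)" "\<lambda>n. q (sh n)"
    "\<lambda>n \<omega>. sh n - khat (sh n) \<omega>" \<kappa> "2 * lam1 + 1"
    by (rule arr.reverse_array)
  note rev_U = arr.W_reverse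
  have Y_range: "0 \<le> Y (sh n) i \<omega>" "Y (sh n) i \<omega> \<le> 1 / \<Delta> (sh n)" for n i \<omega>
    using switch_indicator_range[OF \<Delta>_pos[OF sh(2)[of n]], of "N (sh n)" i \<omega>] by (auto simp: Y_def)
  define L1 L2 where "L1 n \<omega> = q (sh n) * (lamhat1 (sh n) \<omega> - lam1)"
    and "L2 n \<omega> = q (sh n) * (lamhat2 (sh n) \<omega> - lam2 (sh n))" for n \<omega>
  have close1: "vanishes_in_prob (\<lambda>n. M (sh n)) (\<lambda>n \<omega>. L1 n \<omega> - arr.U n \<omega>)"
    unfolding L1_def
  proof (rule arr.log_transform_negligible[where D = "\<lambda>n. \<Delta> (sh n)" and lam = "\<lambda>_. lam1" and ?l0.0 = lam1])
    show "AE \<omega> in M (sh n). is_intensity_estimate (\<Delta> (sh n)) (mean_first (\<lambda>i. Y (sh n) i \<omega>) (khat (sh n) \<omega>)) (lamhat1 (sh n) \<omega>)" for n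
      using obs[OF sh(2)[of n]] AE_space
    proof eventually_elim
      case (elim \<omega>)
      have "mean_first (telegraph_switch_var v (\<Delta> (sh n)) (V0 (sh n)) (N (sh n)) \<omega>) (khat (sh n) \<omega>)
          = mean_first (\<lambda>i. Y (sh n) i \<omega>) (khat (sh n) \<omega>)"
        unfolding mean_first_def using elim(1) khat_range[OF sh(2) elim(2)] by (intro arg_cong2[where f = "(/)"] sum.cong) auto
      then show ?case using lamhat1[OF sh(2) elim(2)] by simp
    qed
  qed (use sh \<Delta>_pos lam1_pos Y_range lamhat_meas shift[OF \<Delta>0] in \<open>auto simp: a_def intro: filterlim_compose[OF q_lim sh_top]\<close>)
  have close2: "vanishes_in_prob (\<lambda>n. M (sh n)) (\<lambda>n \<omega>. L2 n \<omega> - arr.W n \<omega>)"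
    unfolding L2_def rev_U[symmetric]
  proof (rule rev.log_transform_negligible[where D = "\<lambda>n. \<Delta> (sh n)" and lam = "\<lambda>n. lam2 (sh n)" and ?l0.0 = lam1])
    show "AE \<omega> in M (sh n). is_intensity_estimate (\<Delta> (sh n)) (mean_first (\<lambda>i. Y (sh n) (Suc (sh n) - i) \<omega>) (sh n - khat (sh n) \<omega>)) (lamhat2 (sh n) \<omega>)" for n
      using obs[OF sh(2)[of n]] AE_space
    proof eventually_elim
      case (elim \<omega>)
      have "mean_last (sh n) (telegraph_switch_var v (\<Delta> (sh n)) (V0 (sh n)) (N (sh n)) \<omega>) (khat (sh n) \<omega>)
          = mean_last (sh n) (\<lambda>i. Y (sh n) i \<omega>) (khat (sh n) \<omega>)"
        unfolding mean_last_def using elim(1) by (intro arg_cong2[where f = "(/)"] sum.cong) auto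
      then show ?case
        using lamhat2[OF sh(2) elim(2)] mean_first_reverse[OF khat_range[OF sh(2) elim(2)], of "\<lambda>i. Y (sh n) i \<omega>"] by simp
    qed
  qed (use sh \<Delta>_pos lam2_pos Y_range lamhat_meas shift[OF \<Delta>0] shift[OF lam2_lim] in \<open>auto simp: b_def intro: filterlim_compose[OF q_lim sh_top]\<close>)

  \<comment> \<open>Since \<open>(q n)\<^sup>2 * (1 / \<Delta> n) = real n\<close>, the variances are the inverse segment proportions
    times \<open>a n * (1 - a n * \<Delta> n)\<close> and \<open>b n * (1 - b n * \<Delta> n)\<close>.\<close>
  have \<sigma>_pos: "\<sigma>1 > 0" "\<sigma>2 > 0" using \<tau> lam1_pos by (auto simp: \<sigma>1_def \<sigma>2_def)
  have var1: "(\<lambda>n. (q n)\<^sup>2 * (a n * (1 / \<Delta> n - a n)) / real (k0 n)) \<longlonglongrightarrow> \<sigma>1\<^sup>2"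
  proof (rule Lim_transform_eventually)
    have "(\<lambda>n. inverse (real (k0 n) / real n) * (a n * (1 - a n * \<Delta> n))) \<longlonglongrightarrow> inverse \<tau> * (lam1 * (1 - lam1 * 0))"
      using \<tau> by (intro tendsto_intros k0_ratio a_lim \<Delta>0) auto
    then show "(\<lambda>n. inverse (real (k0 n) / real n) * (a n * (1 - a n * \<Delta> n))) \<longlonglongrightarrow> \<sigma>1\<^sup>2"
      using \<tau> lam1_pos by (simp add: \<sigma>1_def)
    show "\<forall>\<^sub>F n in sequentially. inverse (real (k0 n) / real n) * (a n * (1 - a n * \<Delta> n)) = (q n)\<^sup>2 * (a n * (1 / \<Delta> n - a n)) / real (k0 n)"
      using eventually_ge_at_top[of 2]
    proof eventually_elim
      case (elim n)
      have "\<Delta> n * (1 / \<Delta> n - a n) = 1 - a n * \<Delta> n" using \<Delta>_pos[OF elim] by (simp add: right_diff_distrib)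
      then have "(q n)\<^sup>2 * (a n * (1 / \<Delta> n - a n)) = real n * (a n * (1 - a n * \<Delta> n))"
        by (simp add: pos(2)[OF elim] mult_ac)
      then show ?case by (simp add: field_simps)
    qed
  qed
  have var2: "(\<lambda>n. (q n)\<^sup>2 * (b n * (1 / \<Delta> n - b n)) / (real n - real (k0 n))) \<longlonglongrightarrow> \<sigma>2\<^sup>2"
  proof (rule Lim_transform_eventually)
    have "(\<lambda>n. inverse (1 - real (k0 n) / real n) * (b n * (1 - b n * \<Delta> n))) \<longlonglongrightarrow> inverse (1 - \<tau>) * (lam1 * (1 - lam1 * 0))"
      using \<tau> by (intro tendsto_intros k0_ratio b_lim \<Delta>0) auto
    then show "(\<lambda>n. inverse (1 - real (k0 n) / real n) * (b n * (1 - b n * \<Delta> n))) \<longlonglongrightarrow> \<sigma>2\<^sup>2"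
      using \<tau> lam1_pos by (simp add: \<sigma>2_def)
    show "\<forall>\<^sub>F n in sequentially. inverse (1 - real (k0 n) / real n) * (b n * (1 - b n * \<Delta> n)) = (q n)\<^sup>2 * (b n * (1 / \<Delta> n - b n)) / (real n - real (k0 n))"
      using eventually_ge_at_top[of 2]
    proof eventually_elim
      case (elim n)
      have "\<Delta> n * (1 / \<Delta> n - b n) = 1 - b n * \<Delta> n" using \<Delta>_pos[OF elim] by (simp add: right_diff_distrib)
      then have *: "(q n)\<^sup>2 * (b n * (1 / \<Delta> n - b n)) = real n * (b n * (1 - b n * \<Delta> n))"
        by (simp add: pos(2)[OF elim] mult_ac)
      have "1 - real (k0 n) / real n = (real n - real (k0 n)) / real n" using elim by (simp add: diff_divide_distrib)
      then show ?case unfolding * by (simp add: mult.commute)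
    qed
  qed
  have scale: "(\<lambda>n. q n * (1 / \<Delta> n) / real n) \<longlonglongrightarrow> 0"
  proof (rule Lim_transform_eventually)
    show "(\<lambda>n. 1 / q n) \<longlonglongrightarrow> 0"
      by (intro tendsto_divide_0[OF tendsto_const] filterlim_at_top_imp_at_infinity q_lim)
    show "\<forall>\<^sub>F n in sequentially. 1 / q n = q n * (1 / \<Delta> n) / real n"
      using eventually_ge_at_top[of 2]
    proof eventually_elim
      case (elim n)
      have "1 / q n = q n / (q n)\<^sup>2" using pos(1)[OF elim] by (simp add: power2_eq_square)
      then show ?case by (simp add: pos(2)[OF elim])
    qed
  qed

  show ?thesis
    unfolding converges_in_distribution_def
  proof (intro allI impI)
    fix f :: "real ^ 2 \<Rightarrow> real" assume f: "continuous_on UNIV f \<and> bounded (range f)"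
    let ?Z = "\<lambda>n \<omega>. sqrt (real n * \<Delta> n) *\<^sub>R (vector [lamhat1 n \<omega> - lam1, lamhat2 n \<omega> - lam2 n] :: real ^ 2)"
    have "(\<lambda>n. integral\<^sup>L (distr (M (sh n)) borel (\<lambda>\<omega>. vector [L1 n \<omega>, L2 n \<omega>])) f)
      \<longlonglongrightarrow> integral\<^sup>L (multivariate_normal 0 (vector [vector [\<sigma>1\<^sup>2, 0], vector [0, \<sigma>2\<^sup>2]])) f"
    proof (rule arr.estimates_jointly_normal[where \<beta> = "\<lambda>n. 1 / \<Delta> (sh n)"
        and ?v1.0 = "\<lambda>n. a (sh n) * (1 / \<Delta> (sh n) - a (sh n))" and ?v2.0 = "\<lambda>n. b (sh n) * (1 / \<Delta> (sh n) - b (sh n))"])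
      have ab: "0 < a (sh n)" "a (sh n) < 1 / \<Delta> (sh n)" "0 < b (sh n)" "b (sh n) < 1 / \<Delta> (sh n)" for n
        using switch_mean_bounds[OF \<Delta>_pos[OF sh(2)] lam1_pos] switch_mean_bounds[OF \<Delta>_pos[OF sh(2)] lam2_pos[OF sh(2)]]
        by (auto simp: a_def b_def)
      show "\<bar>Y (sh n) i \<omega> - a (sh n)\<bar> \<le> 1 / \<Delta> (sh n)" "\<bar>Y (sh n) i \<omega> - b (sh n)\<bar> \<le> 1 / \<Delta> (sh n)" for n i \<omega>
        using ab[of n] Y_range[of n i \<omega>] unfolding abs_le_iff by linarith+
      show "(\<lambda>n. q (sh n) * (1 / \<Delta> (sh n)) / real (sh n)) \<longlonglongrightarrow> 0" by (rule shift[OF scale])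
      show "prob_space.variance (M (sh n)) (Y (sh n) i) = a (sh n) * (1 / \<Delta> (sh n) - a (sh n))" if "i \<in> {1..k0 (sh n)}" for n i
      proof -
        have "i \<in> {1..sh n}" using that seg(4)[OF sh(1)[of n]] by auto
        then show ?thesis using moments(3)[OF sh(2), of i n] that by (simp add: a_def l_def)
      qed
      show "prob_space.variance (M (sh n)) (Y (sh n) i) = b (sh n) * (1 / \<Delta> (sh n) - b (sh n))" if "i \<in> {k0 (sh n)+1..sh n}" for n i
        using moments(3)[OF sh(2), of i n] that by (simp add: b_def l_def)
      show "(\<lambda>n. (q (sh n))\<^sup>2 * (a (sh n) * (1 / \<Delta> (sh n) - a (sh n))) / real (k0 (sh n))) \<longlonglongrightarrow> \<sigma>1\<^sup>2"
        by (rule shift[OF var1])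
      have "real (sh n - k0 (sh n)) = real (sh n) - real (k0 (sh n))" for n using seg(4)[OF sh(1)[of n]] by simp
      then show "(\<lambda>n. (q (sh n))\<^sup>2 * (b (sh n) * (1 / \<Delta> (sh n) - b (sh n))) / real (sh n - k0 (sh n))) \<longlonglongrightarrow> \<sigma>2\<^sup>2"
        using shift[OF var2] by simp
      show "L1 n \<in> borel_measurable (M (sh n))" "L2 n \<in> borel_measurable (M (sh n))" for n
        unfolding L1_def[abs_def] L2_def[abs_def] using lamhat_meas[OF sh(2)[of n]] by auto
    qed (use \<sigma>_pos close1 close2 f in auto)
    also have "(\<lambda>n. integral\<^sup>L (distr (M (sh n)) borel (\<lambda>\<omega>. vector [L1 n \<omega>, L2 n \<omega>])) f)
      = (\<lambda>n. integral\<^sup>L (distr (M (n + n0)) borel (?Z (n + n0))) f)"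
    proof
      fix n
      have "(\<lambda>\<omega>. vector [L1 n \<omega>, L2 n \<omega>] :: real ^ 2) = ?Z (sh n)"
        by (intro ext) (simp add: vec_eq_iff forall_2 L1_def L2_def q_def)
      then show "integral\<^sup>L (distr (M (sh n)) borel (\<lambda>\<omega>. vector [L1 n \<omega>, L2 n \<omega>])) f
        = integral\<^sup>L (distr (M (n + n0)) borel (?Z (n + n0))) f" by (simp add: sh_def)
    qed
    finally have "(\<lambda>n. integral\<^sup>L (distr (M n) borel (?Z n)) f)
      \<longlonglongrightarrow> integral\<^sup>L (multivariate_normal 0 (vector [vector [\<sigma>1\<^sup>2, 0], vector [0, \<sigma>2\<^sup>2]])) f"
      by (rule LIMSEQ_offset)
    then show "(\<lambda>n. integral\<^sup>L (distr (M n) borel (?Z n)) f)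
      \<longlonglongrightarrow> integral\<^sup>L (multivariate_normal 0 (vector [vector [inverse \<tau> * lam1, 0],
                       vector [0, inverse (1 - \<tau>) * lim lam2]])) f"
      using \<tau> lam1_pos by (simp add: \<sigma>1_def \<sigma>2_def lim_lam2)
  qed
qed

end
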